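(* Let $m\ge2$, let $L\subset S^3$ be an oriented link with $q$ components satisfying Assumption $\mathcal{A}_m$, and let $h\ge m$. Then the homomorphism $\bar f_h:\pi_1(S^3\setminus L)\to\mathrm{Im}(\Upsilon_h)/\mathcal{N}_{h,L}$ induces a group isomorphism $$\pi_1(S^3\setminus L)/\Gamma_h\pi_1(S^3\setminus L)\;\cong\;\mathrm{Im}(\Upsilon_h)/\mathcal{N}_{h,L}.$$
   Context: Groups. For a group $G$, $\Gamma_1G=G$, $\Gamma_nG=[\Gamma_{n-1}G,G]$. $F$ is the free group on $x_1,\dots,x_q$; $Q_n=\Gamma_{n-1}F/\Gamma_nF$, central in $F/\Gamma_nF$; $p_{n}:F/\Gamma_{n+1}F\to F/\Gamma_{n}F$ is the projection. Unipotent Magnus embedding. $\Omega_n=\mathbb{Z}[\lambda_i^{(j)}]$ is the commutative polynomial ring in indeterminates $\lambda_i^{(j)}$, $1\le i\le n-1$, $1\le j\le q$. $\Upsilon_n:F\to GL_n(\Omega_n)$ is the homomorphism sending $x_j$ to $I_n+\sum_{i=1}^{n-1}\lambda_i^{(j)}E_{i,i+1}$. It induces an isomorphism $F/\Gamma_nF\cong\mathrm{Im}(\Upsilon_n)$; through it, $p_n$ is regarded as a map $\mathrm{Im}(\Upsilon_{n+1})\to\mathrm{Im}(\Upsilon_n)$. $\Upsilon_n(Q_n)$ denotes $\Upsilon_n(\Gamma_{n-1}F)$. Link diagram. Let $D$ be a diagram of $L$ in which every component passes under at least one crossing. For each component $j$, traverse it along its orientation, starting from a chosen arc $\alpha_1$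 whose Wirtinger generator is the meridian $\mathfrak{m}_j$; let $\alpha_1,\dots,\alpha_{N_j}$ be its successive arcs, $\beta_k$ the over-passing arc at the crossing separating $\alpha_k$ and $\alpha_{k+1}$ (with $\alpha_{N_j+1}=\alpha_1$), and $\epsilon_k\in\{\pm1\}$ the sign of that crossing. Arcs are identified with Wirtinger generators of $\pi_1(S^3\setminus L)$, with conventions such that the Wirtinger relations are $\alpha_{k+1}=\beta_k^{-\epsilon_k}\alpha_k\beta_k^{\epsilon_k}$. Assumption $\mathcal{A}_m$. There are homomorphisms $f_k:\pi_1(S^3\setminus L)\to F/\Gamma_kF$, $2\le k\le m$, with $f_2$ the abelianization (sending $\mathfrak{m}_j$ to the class of $x_j$), $p_{k-1}\circ f_k=f_{k-1}$, and (normalization) $f_k(\mathfrak{m}_j)=[x_j]$ for all $j$. Inductive construction. For each $h\ge m$ choose a set-theoretic section $\mathfrak{s}_h:\mathrm{Im}(\Upsilon_h)\to\mathrm{Im}(\Upsilon_{h+1})$ of $p_h$. Put $K_m=\emptyset$, $\mathcal{N}_{m,L}=\{1\}$, $\bar f_m=f_m$ (viewed in $\mathrm{Im}(\Upsilon_m)$). Given a finite set $K_h\subset\mathrm{Im}(\Upsilon_h)$, its normal closure $\mathcal{N}_{h,L}$, and $\bar f_h:\pi_1(S^3\setminus L)\to\mathrm{Im}(\Upsilon_h)/\mathcal{N}_{h,L}$ with $\bar f_h(\mathfrak{m}_j)=[\Upsilon_h(x_j)]$, let $\langle\mathfrak{s}_h(K_h)\rangle$ be the normal closure of $\mathfrak{s}_h(K_h)$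 in $\mathrm{Im}(\Upsilon_{h+1})$. For each component $j$ define $\mathcal{C}_h(\alpha_1)=\Upsilon_{h+1}(x_j)$ and $\mathcal{C}_h(\alpha_{k+1})=B_k^{-\epsilon_k}\mathcal{C}_h(\alpha_k)B_k^{\epsilon_k}$ ($1\le k<N_j$) in $\mathrm{Im}(\Upsilon_{h+1})/\langle\mathfrak{s}_h(K_h)\rangle$, where, for $1\le k\le N_j$, $B_k\in\mathrm{Im}(\Upsilon_{h+1})$ is any element with $[p_h(B_k)]=\bar f_h(\beta_k)$. Put $$\bar\mu_L^h(j)=\Upsilon_{h+1}(x_j)^{-1}B_{N_j}^{-\epsilon_{N_j}}\mathcal{C}_h(\alpha_{N_j})B_{N_j}^{\epsilon_{N_j}}\in\mathrm{Im}(\Upsilon_{h+1})/\langle\mathfrak{s}_h(K_h)\rangle,$$ which lies in the image of $\Upsilon_{h+1}(Q_{h+1})$. Let $K_{h+1}=\mathfrak{s}_h(K_h)\cup\{\bar\mu_L^h(1),\dots,\bar\mu_L^h(q)\}$ (with representatives of the $\bar\mu_L^h(j)$ chosen in $\Upsilon_{h+1}(Q_{h+1})$), let $\mathcal{N}_{h+1,L}$ be the normal closure of $K_{h+1}$ in $\mathrm{Im}(\Upsilon_{h+1})$, and let $\bar f_{h+1}:\pi_1(S^3\setminus L)\to\mathrm{Im}(\Upsilon_{h+1})/\mathcal{N}_{h+1,L}$ be the homomorphism defined on arcs by $\mathcal{C}_h$; it satisfies $[p_h]\circ\bar f_{h+1}=\bar f_h$.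
   Formalization: For arbitrary set-theoretic sections the claim fails (e.g. 2-component unlink, section sending 1 to a nontrivial central element); it is required that each section lifts K_i (m≤i<h) to relations among meridians modulo Γ_{i+1}π, and existence of such a construction is also proved. *)

theory Defs
  imports
    "HOL-Analysis.Analysis"
    "HOL-Algebra.Generated_Groups"
    "HOL-Library.Poly_Mapping"
    "Jordan_Normal_Form.Matrix"
begin

section \<open>Groups\<close>

definition commutator_subgroup :: "('a, 'b) monoid_scheme \<Rightarrow> 'a set \<Rightarrow> 'a set \<Rightarrow> 'a set" where
  "commutator_subgroup G H K =
     generate G (\<Union>h\<in>H. \<Union>k\<in>K. {h \<otimes>\<^bsub>G\<^esub> k \<otimes>\<^bsub>G\<^esub> inv\<^bsub>G\<^esub> h \<otimes>\<^bsub>G\<^esub> inv\<^bsub>G\<^esub> k})"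

text \<open>Indexed from 1, as usual; the value at 0 is junk.\<close>

fun lcs :: "('a, 'b) monoid_scheme \<Rightarrow> nat \<Rightarrow> 'a set" where
  "lcs G 0 = carrier G"
| "lcs G (Suc 0) = carrier G"
| "lcs G (Suc (Suc n)) = commutator_subgroup G (lcs G (Suc n)) (carrier G)"

definition normal_closure :: "('a, 'b) monoid_scheme \<Rightarrow> 'a set \<Rightarrow> 'a set" where
  "normal_closure G S = generate G {g \<otimes>\<^bsub>G\<^esub> s \<otimes>\<^bsub>G\<^esub> inv\<^bsub>G\<^esub> g | g s. g \<in> carrier G \<and> s \<in> S}"

text \<open>The map \<open>G/H \<rightarrow> G/N\<close> for \<open>H \<subseteq> N\<close> sends the coset \<open>Hg\<close> to \<open>Ng = N(Hg)\<close>.\<close>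

definition coset_proj :: "('a, 'b) monoid_scheme \<Rightarrow> 'a set \<Rightarrow> 'a set \<Rightarrow> 'a set" where
  "coset_proj G N C = N <#>\<^bsub>G\<^esub> C"

text \<open>\<open>\<phi> : G \<rightarrow> H\<close> factors through an isomorphism \<open>G/N \<rightarrow> H\<close>.\<close>

definition induces_iso ::
    "('a, 'b) monoid_scheme \<Rightarrow> 'a set \<Rightarrow> ('c, 'd) monoid_scheme \<Rightarrow> ('a \<Rightarrow> 'c) \<Rightarrow> bool" where
  "induces_iso G N H \<phi> \<longleftrightarrow> \<phi> \<in> hom G H \<and>
     (\<exists>\<Phi>\<in>iso (G Mod N) H. \<forall>g\<in>carrier G. \<Phi> (N #>\<^bsub>G\<^esub> g) = \<phi> g)"

section \<open>Free groups and presentations\<close>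

text \<open>The free group on \<open>X\<close>, as reduced words in the letters \<open>(x, True)\<close> (standing for \<open>x\<close>)
  and \<open>(x, False)\<close> (standing for the inverse of \<open>x\<close>).\<close>

fun cons_reduce :: "'x \<times> bool \<Rightarrow> ('x \<times> bool) list \<Rightarrow> ('x \<times> bool) list" where
  "cons_reduce a [] = [a]"
| "cons_reduce a (b # v) = (if b = (fst a, \<not> snd a) then v else a # b # v)"

definition free_group :: "'x set \<Rightarrow> ('x \<times> bool) list monoid" where
  "free_group X =
     \<lparr> carrier = {v. fst ` set v \<subseteq> X \<and> successively (\<lambda>a b. b \<noteq> (fst a, \<not> snd a)) v},
       mult = (\<lambda>u v. foldr cons_reduce u v),
       one = [] \<rparr>"

definition fgen :: "'x \<Rightarrow> ('x \<times> bool) list" where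
  "fgen x = [(x, True)]"

definition free_lift :: "('a, 'b) monoid_scheme \<Rightarrow> ('x \<Rightarrow> 'a) \<Rightarrow> ('x \<times> bool) list \<Rightarrow> 'a" where
  "free_lift G g v =
     foldr (\<lambda>(x, e) y. (if e then g x else inv\<^bsub>G\<^esub> (g x)) \<otimes>\<^bsub>G\<^esub> y) v \<one>\<^bsub>G\<^esub>"

definition is_presentation ::
    "('a, 'b) monoid_scheme \<Rightarrow> 'x set \<Rightarrow> ('x \<times> bool) list set \<Rightarrow> ('x \<Rightarrow> 'a) \<Rightarrow> bool" where
  "is_presentation G X R g \<longleftrightarrow>
     g ` X \<subseteq> carrier G \<and> generate G (g ` X) = carrier G \<and>
     kernel (free_group X) G (free_lift G g) = normal_closure (free_group X) R"

section \<open>The unipotent Magnus embedding\<close>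

abbreviation FG :: "nat \<Rightarrow> (nat \<times> bool) list monoid" where
  "FG q \<equiv> free_group {1..q}"

type_synonym lpoly = "((nat \<times> nat) \<Rightarrow>\<^sub>0 nat) \<Rightarrow>\<^sub>0 int"

definition lam :: "nat \<Rightarrow> nat \<Rightarrow> lpoly" where
  "lam i j = Poly_Mapping.single (Poly_Mapping.single (i, j) 1) 1"

definition Omega :: "nat \<Rightarrow> nat \<Rightarrow> lpoly set" where
  "Omega q n = {p. \<forall>\<mu>\<in>Poly_Mapping.keys p. Poly_Mapping.keys \<mu> \<subseteq> {1..n - 1} \<times> {1..q}}"

definition GL :: "nat \<Rightarrow> nat \<Rightarrow> lpoly mat monoid" where
  "GL q n = units_of
     \<lparr> carrier = {A \<in> carrier_mat n n. \<forall>r<n. \<forall>c<n. A $$ (r, c) \<in> Omega q n},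
       mult = (*), one = 1\<^sub>m n \<rparr>"

text \<open>Rows and columns are numbered from 0 here, hence the index \<open>r + 1\<close>.\<close>

definition magnus_gen :: "nat \<Rightarrow> nat \<Rightarrow> lpoly mat" where
  "magnus_gen n j =
     Matrix.mat n n (\<lambda>(r, c). if c = r then 1 else if c = r + 1 then lam (r + 1) j else 0)"

definition Ups :: "nat \<Rightarrow> nat \<Rightarrow> (nat \<times> bool) list \<Rightarrow> lpoly mat" where
  "Ups q n = free_lift (GL q n) (magnus_gen n)"

definition ImUps :: "nat \<Rightarrow> nat \<Rightarrow> lpoly mat monoid" where
  "ImUps q n = (GL q n) \<lparr> carrier := Ups q n ` carrier (FG q) \<rparr>"

text \<open>The bijection from \<open>F/\<Gamma>\<^sub>nF\<close> to the image induced by \<^term>\<open>Ups q n\<close>, which is constant on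
  each coset of \<open>\<Gamma>\<^sub>nF\<close>.\<close>

definition Ups_bar :: "nat \<Rightarrow> nat \<Rightarrow> (nat \<times> bool) list set \<Rightarrow> lpoly mat" where
  "Ups_bar q n C = the_elem (Ups q n ` C)"

definition pF :: "nat \<Rightarrow> nat \<Rightarrow> (nat \<times> bool) list set \<Rightarrow> (nat \<times> bool) list set" where
  "pF q n = coset_proj (FG q) (lcs (FG q) n)"

definition pUps :: "nat \<Rightarrow> nat \<Rightarrow> lpoly mat \<Rightarrow> lpoly mat" where
  "pUps q n M = Ups_bar q n (pF q n
     (inv_into (carrier (FG q Mod lcs (FG q) (n + 1))) (Ups_bar q (n + 1)) M))"

section \<open>Fundamental group\<close>

definition loop_class :: "'a::real_normed_vector set \<Rightarrow> (real \<Rightarrow> 'a) \<Rightarrow> (real \<Rightarrow> 'a) set" where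
  "loop_class X p = {r. homotopic_paths X p r}"

definition pi1 :: "'a::real_normed_vector set \<Rightarrow> 'a \<Rightarrow> (real \<Rightarrow> 'a) set monoid" where
  "pi1 X b =
     \<lparr> carrier = {loop_class X p | p.
          path p \<and> path_image p \<subseteq> X \<and> pathstart p = b \<and> pathfinish p = b},
       mult = (\<lambda>P R. \<Union>p\<in>P. \<Union>r\<in>R. loop_class X (p +++ r)),
       one = loop_class X (linepath b b) \<rparr>"

section \<open>Links and diagrams\<close>

text \<open>A point of \<open>\<real>\<^sup>3\<close> is a pair of its projection to the plane of the diagram and its height
  above that plane.\<close>

type_synonym R3 = "(real \<times> real) \<times> real"
type_synonym R4 = "R3 \<times> real"

definition S3 :: "R4 set" where
  "S3 = sphere 0 1"

definition stereo_inv :: "R3 \<Rightarrow> R4" where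
  "stereo_inv y = (1 / (1 + (norm y)\<^sup>2)) *\<^sub>R (2 *\<^sub>R y, (norm y)\<^sup>2 - 1)"

text \<open>The components are numbered \<open>1, \<dots>, q\<close> and oriented by their parametrisations.\<close>

definition oriented_link :: "nat \<Rightarrow> (nat \<Rightarrow> real \<Rightarrow> R4) \<Rightarrow> bool" where
  "oriented_link q \<gamma> \<longleftrightarrow>
     (\<forall>j\<in>{1..q}. simple_path (\<gamma> j) \<and> pathfinish (\<gamma> j) = pathstart (\<gamma> j) \<and> path_image (\<gamma> j) \<subseteq> S3) \<and>
     (\<forall>i\<in>{1..q}. \<forall>j\<in>{1..q}. i \<noteq> j \<longrightarrow> path_image (\<gamma> i) \<inter> path_image (\<gamma> j) = {})"

definition link_set :: "nat \<Rightarrow> (nat \<Rightarrow> real \<Rightarrow> R4) \<Rightarrow> R4 set" where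
  "link_set q \<gamma> = (\<Union>j\<in>{1..q}. path_image (\<gamma> j))"

definition ambient_isotopic :: "nat \<Rightarrow> (nat \<Rightarrow> real \<Rightarrow> R4) \<Rightarrow> (nat \<Rightarrow> real \<Rightarrow> R4) \<Rightarrow> bool" where
  "ambient_isotopic q \<gamma> \<delta> \<longleftrightarrow>
     (\<exists>H. continuous_on ({0..1} \<times> S3) (\<lambda>(t, x). H (t::real) x) \<and>
          (\<forall>t\<in>{0..1}. \<exists>H'. homeomorphism S3 S3 (H t) H') \<and>
          (\<forall>x\<in>S3. H 0 x = x) \<and>
          (\<forall>j\<in>{1..q}. \<forall>t\<in>{0..1}. H 1 (\<gamma> j t) = \<delta> j t))"

definition cross2 :: "real \<times> real \<Rightarrow> real \<times> real \<Rightarrow> real" where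
  "cross2 u v = fst u * snd v - snd u * fst v"

definition tangent2 :: "(nat \<Rightarrow> real \<Rightarrow> R3) \<Rightarrow> nat \<times> real \<Rightarrow> real \<times> real" where
  "tangent2 c a = fst (vector_derivative (c (fst a)) (at (snd a)))"

definition pt :: "(nat \<Rightarrow> real \<Rightarrow> R3) \<Rightarrow> nat \<times> real \<Rightarrow> R3" where
  "pt c a = c (fst a) (snd a)"

definition params :: "nat \<Rightarrow> (nat \<times> real) set" where
  "params q = {1..q} \<times> {0..<1}"

definition passes_over :: "nat \<Rightarrow> (nat \<Rightarrow> real \<Rightarrow> R3) \<Rightarrow> nat \<times> real \<Rightarrow> nat \<times> real \<Rightarrow> bool" where
  "passes_over q c a b \<longleftrightarrow> a \<in> params q \<and> b \<in> params q \<and>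
     fst (pt c a) = fst (pt c b) \<and> snd (pt c b) < snd (pt c a)"

definition under_params :: "nat \<Rightarrow> (nat \<Rightarrow> real \<Rightarrow> R3) \<Rightarrow> nat \<Rightarrow> real set" where
  "under_params q c j = {s. \<exists>a. passes_over q c a (j, s)}"

text \<open>A diagram is a family of embedded closed curves in \<open>\<real>\<^sup>3\<close> (parametrised with period 1)
  whose projection to the plane is an immersion with only finitely many, transverse, double points.
  Parameter 0 is not that of an under-crossing, so that it singles out the first arc of
  each component.\<close>

definition link_diagram :: "nat \<Rightarrow> (nat \<Rightarrow> real \<Rightarrow> R3) \<Rightarrow> bool" where
  "link_diagram q c \<longleftrightarrow>
     (\<forall>j\<in>{1..q}. c j C1_differentiable_on UNIV \<and>
        (\<forall>t. c j (t + 1) = c j t \<and> fst (vector_derivative (c j) (at t)) \<noteq> 0)) \<and>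
     inj_on (pt c) (params q) \<and>
     finite {(a, b). a \<in> params q \<and> b \<in> params q \<and> a \<noteq> b \<and> fst (pt c a) = fst (pt c b)} \<and>
     (\<forall>a\<in>params q. \<forall>b\<in>params q. a \<noteq> b \<and> fst (pt c a) = fst (pt c b) \<longrightarrow>
        cross2 (tangent2 c a) (tangent2 c b) \<noteq> 0 \<and>
        (\<forall>d\<in>params q. fst (pt c d) = fst (pt c a) \<longrightarrow> d = a \<or> d = b)) \<and>
     (\<forall>j\<in>{1..q}. 0 \<notin> under_params q c j)"

definition diagram_of_link ::
    "nat \<Rightarrow> (nat \<Rightarrow> real \<Rightarrow> R3) \<Rightarrow> (nat \<Rightarrow> real \<Rightarrow> R4) \<Rightarrow> bool" where
  "diagram_of_link q c \<gamma> \<longleftrightarrow>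
     link_diagram q c \<and> ambient_isotopic q \<gamma> (\<lambda>j. stereo_inv \<circ> c j)"

definition n_arcs :: "nat \<Rightarrow> (nat \<Rightarrow> real \<Rightarrow> R3) \<Rightarrow> nat \<Rightarrow> nat" where
  "n_arcs q c j = card (under_params q c j)"

text \<open>The arcs of component \<open>j\<close> are \<open>(j, 1), \<dots>, (j, N\<^sub>j)\<close>. With \<open>s\<^sub>1 < \<dots> < s\<^sub>N\<close> the under-crossing
  parameters, arc \<open>(j, 1)\<close> has the parameters below \<open>s\<^sub>1\<close> and those above \<open>s\<^sub>N\<close>, and
  \<open>(j, k + 1)\<close> those between \<open>s\<^sub>k\<close> and \<open>s\<^sub>k\<^sub>+\<^sub>1\<close>.\<close>

definition arcs :: "nat \<Rightarrow> (nat \<Rightarrow> real \<Rightarrow> R3) \<Rightarrow> (nat \<times> nat) set" where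
  "arcs q c = (SIGMA j:{1..q}. {1..n_arcs q c j})"

definition arc_at :: "nat \<Rightarrow> (nat \<Rightarrow> real \<Rightarrow> R3) \<Rightarrow> nat \<times> real \<Rightarrow> nat \<times> nat" where
  "arc_at q c a = (fst a, card {s \<in> under_params q c (fst a). s < snd a} mod n_arcs q c (fst a) + 1)"

definition next_arc :: "nat \<Rightarrow> (nat \<Rightarrow> real \<Rightarrow> R3) \<Rightarrow> nat \<Rightarrow> nat \<Rightarrow> nat \<times> nat" where
  "next_arc q c j k = (j, if k = n_arcs q c j then 1 else k + 1)"

text \<open>The crossing at which arc \<open>(j, k)\<close> ends: the parameters of its two strands, the
  over-passing arc \<open>\<beta>\<^sub>k\<close>, and its sign (positive if the over-strand turns counterclockwise
  into the under-strand).\<close>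

definition under_strand :: "nat \<Rightarrow> (nat \<Rightarrow> real \<Rightarrow> R3) \<Rightarrow> nat \<Rightarrow> nat \<Rightarrow> nat \<times> real" where
  "under_strand q c j k = (j, sorted_list_of_set (under_params q c j) ! (k - 1))"

definition over_strand :: "nat \<Rightarrow> (nat \<Rightarrow> real \<Rightarrow> R3) \<Rightarrow> nat \<Rightarrow> nat \<Rightarrow> nat \<times> real" where
  "over_strand q c j k = (THE a. passes_over q c a (under_strand q c j k))"

definition over_arc :: "nat \<Rightarrow> (nat \<Rightarrow> real \<Rightarrow> R3) \<Rightarrow> nat \<Rightarrow> nat \<Rightarrow> nat \<times> nat" where
  "over_arc q c j k = arc_at q c (over_strand q c j k)"

definition crossing_sign :: "nat \<Rightarrow> (nat \<Rightarrow> real \<Rightarrow> R3) \<Rightarrow> nat \<Rightarrow> nat \<Rightarrow> int" where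
  "crossing_sign q c j k =
     (if cross2 (tangent2 c (over_strand q c j k)) (tangent2 c (under_strand q c j k)) > 0
      then 1 else - 1)"

definition wirtinger_relators ::
    "nat \<Rightarrow> (nat \<Rightarrow> real \<Rightarrow> R3) \<Rightarrow> ((nat \<times> nat) \<times> bool) list set" where
  "wirtinger_relators q c =
     (let A = free_group (arcs q c) in
      {inv\<^bsub>A\<^esub> (fgen (next_arc q c j k)) \<otimes>\<^bsub>A\<^esub>
         (fgen (over_arc q c j k) [^]\<^bsub>A\<^esub> (- crossing_sign q c j k) \<otimes>\<^bsub>A\<^esub> fgen (j, k) \<otimes>\<^bsub>A\<^esub>
          fgen (over_arc q c j k) [^]\<^bsub>A\<^esub> crossing_sign q c j k)
       | j k. (j, k) \<in> arcs q c})"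

text \<open>An identification of the arcs with elements of the link group \<open>G\<close>, under which they are
  generators of \<open>G\<close> with the Wirtinger relations as defining relations.\<close>

definition wirtinger_generators ::
    "nat \<Rightarrow> (nat \<Rightarrow> real \<Rightarrow> R3) \<Rightarrow> ('a, 'b) monoid_scheme \<Rightarrow> (nat \<times> nat \<Rightarrow> 'a) \<Rightarrow> bool" where
  "wirtinger_generators q c G w \<longleftrightarrow> is_presentation G (arcs q c) (wirtinger_relators q c) w"

abbreviation meridian :: "(nat \<times> nat \<Rightarrow> 'a) \<Rightarrow> nat \<Rightarrow> 'a" where
  "meridian w j \<equiv> w (j, 1)"

section \<open>The inductive construction\<close>

definition assumption_A ::
    "nat \<Rightarrow> nat \<Rightarrow> ('a, 'b) monoid_scheme \<Rightarrow> (nat \<times> nat \<Rightarrow> 'a) \<Rightarrow>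
     (nat \<Rightarrow> 'a \<Rightarrow> (nat \<times> bool) list set) \<Rightarrow> bool" where
  "assumption_A q m G w f \<longleftrightarrow>
     (\<forall>k\<in>{2..m}. f k \<in> hom G (FG q Mod lcs (FG q) k) \<and>
        (\<forall>j\<in>{1..q}. f k (meridian w j) = lcs (FG q) k #>\<^bsub>FG q\<^esub> fgen j)) \<and>
     induces_iso G (derived G (carrier G)) (FG q Mod lcs (FG q) 2) (f 2) \<and>
     (\<forall>k\<in>{3..m}. \<forall>g\<in>carrier G. pF q (k - 1) (f k g) = f (k - 1) g)"

text \<open>\<open>b k\<close> is the conjugating element at the end of the \<open>k\<close>-th arc and \<open>e k\<close> the sign of that
  crossing; arcs are numbered from 1 (the value at 0 is junk).\<close>

fun arc_chain :: "('a, 'b) monoid_scheme \<Rightarrow> 'a \<Rightarrow> (nat \<Rightarrow> 'a) \<Rightarrow> (nat \<Rightarrow> int) \<Rightarrow> nat \<Rightarrow> 'a" where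
  "arc_chain A x b e 0 = x"
| "arc_chain A x b e (Suc 0) = x"
| "arc_chain A x b e (Suc (Suc k)) =
     b (Suc k) [^]\<^bsub>A\<^esub> (- e (Suc k)) \<otimes>\<^bsub>A\<^esub> arc_chain A x b e (Suc k) \<otimes>\<^bsub>A\<^esub>
     b (Suc k) [^]\<^bsub>A\<^esub> e (Suc k)"

definition arc_holonomy :: "('a, 'b) monoid_scheme \<Rightarrow> 'a \<Rightarrow> (nat \<Rightarrow> 'a) \<Rightarrow> (nat \<Rightarrow> int) \<Rightarrow> nat \<Rightarrow> 'a" where
  "arc_holonomy A x b e N =
     inv\<^bsub>A\<^esub> x \<otimes>\<^bsub>A\<^esub> b N [^]\<^bsub>A\<^esub> (- e N) \<otimes>\<^bsub>A\<^esub> arc_chain A x b e N \<otimes>\<^bsub>A\<^esub> b N [^]\<^bsub>A\<^esub> e N"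

definition Nsub :: "nat \<Rightarrow> (nat \<Rightarrow> lpoly mat set) \<Rightarrow> nat \<Rightarrow> lpoly mat set" where
  "Nsub q K h = normal_closure (ImUps q h) (K h)"

definition Ssub ::
    "nat \<Rightarrow> (nat \<Rightarrow> lpoly mat \<Rightarrow> lpoly mat) \<Rightarrow> (nat \<Rightarrow> lpoly mat set) \<Rightarrow> nat \<Rightarrow> lpoly mat set" where
  "Ssub q s K h = normal_closure (ImUps q (h + 1)) (s h ` K h)"

text \<open>\<open>\<C>\<^sub>h(\<alpha>\<^sub>k)\<close> on component \<open>j\<close>, and the class \<open>\<mu>\<^sup>h(j)\<close>, in the quotient of the image of
  \<open>\<Upsilon>\<^sub>h\<^sub>+\<^sub>1\<close> by \<^term>\<open>Ssub q s K h\<close>.\<close>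

definition Ccls where
  "Ccls q c s K B h j k =
     (let I = ImUps q (h + 1); S = Ssub q s K h in
      arc_chain (I Mod S) (S #>\<^bsub>I\<^esub> Ups q (h + 1) (fgen j))
        (\<lambda>k. S #>\<^bsub>I\<^esub> B h j k) (crossing_sign q c j) k)"

definition mu_bar where
  "mu_bar q c s K B h j =
     (let I = ImUps q (h + 1); S = Ssub q s K h in
      arc_holonomy (I Mod S) (S #>\<^bsub>I\<^esub> Ups q (h + 1) (fgen j))
        (\<lambda>k. S #>\<^bsub>I\<^esub> B h j k) (crossing_sign q c j) (n_arcs q c j))"

text \<open>The data of the construction: sections \<open>s h\<close>, lifts \<open>B h j k\<close> of the over-passing arcs,
  representatives \<open>\<rho> h j\<close> of the classes \<^term>\<open>mu_bar q c s K B h j\<close>, the sets \<open>K h\<close> and the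
  homomorphisms \<open>\<phi> h\<close> to \<open>ImUps q h Mod Nsub q K h\<close>.\<close>

definition is_construction ::
    "nat \<Rightarrow> nat \<Rightarrow> (nat \<Rightarrow> real \<Rightarrow> R3) \<Rightarrow> ('a, 'b) monoid_scheme \<Rightarrow> (nat \<times> nat \<Rightarrow> 'a) \<Rightarrow>
     (nat \<Rightarrow> 'a \<Rightarrow> (nat \<times> bool) list set) \<Rightarrow>
     (nat \<Rightarrow> lpoly mat \<Rightarrow> lpoly mat) \<Rightarrow> (nat \<Rightarrow> nat \<Rightarrow> nat \<Rightarrow> lpoly mat) \<Rightarrow> (nat \<Rightarrow> nat \<Rightarrow> lpoly mat) \<Rightarrow>
     (nat \<Rightarrow> lpoly mat set) \<Rightarrow> (nat \<Rightarrow> 'a \<Rightarrow> lpoly mat set) \<Rightarrow> bool" where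
  "is_construction q m c G w f s B \<rho> K \<phi> \<longleftrightarrow>
     K m = {} \<and>
     (\<forall>g\<in>carrier G. \<phi> m g = Nsub q K m #>\<^bsub>ImUps q m\<^esub> Ups_bar q m (f m g)) \<and>
     (\<forall>h\<ge>m.
        (\<forall>M\<in>carrier (ImUps q h). s h M \<in> carrier (ImUps q (h + 1)) \<and> pUps q h (s h M) = M) \<and>
        (\<forall>(j, k)\<in>arcs q c. B h j k \<in> carrier (ImUps q (h + 1)) \<and>
           Nsub q K h #>\<^bsub>ImUps q h\<^esub> pUps q h (B h j k) = \<phi> h (w (over_arc q c j k))) \<and>
        (\<forall>j\<in>{1..q}. \<rho> h j \<in> Ups q (h + 1) ` lcs (FG q) h \<and>
           Ssub q s K h #>\<^bsub>ImUps q (h + 1)\<^esub> \<rho> h j = mu_bar q c s K B h j) \<and>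
        K (h + 1) = s h ` K h \<union> \<rho> h ` {1..q} \<and>
        \<phi> (h + 1) \<in> hom G (ImUps q (h + 1) Mod Nsub q K (h + 1)) \<and>
        (\<forall>(j, k)\<in>arcs q c.
           \<phi> (h + 1) (w (j, k)) =
             coset_proj (ImUps q (h + 1)) (Nsub q K (h + 1)) (Ccls q c s K B h j k)))"

text \<open>For an arbitrary set-theoretic section \<open>s h\<close> the elements of \<open>s h ` K h\<close> need not be
  relations of \<open>G/\<Gamma>\<^sub>h\<^sub>+\<^sub>1G\<close>: already for a trivial link with \<open>q \<ge> 2\<close> and \<open>m = 2\<close> one has
  \<open>K 3 = {1}\<close>, while \<open>s 3 1\<close> may be any element of \<open>\<Upsilon>\<^sub>4(\<Gamma>\<^sub>3F)\<close>. The condition below says that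
  \<open>s h\<close> lifts the relations in \<open>K h\<close> to relations between the meridians in \<open>G/\<Gamma>\<^sub>h\<^sub>+\<^sub>1G\<close>. As
  \<open>\<phi> (h + 1)\<close> sends the \<open>j\<close>-th meridian to the class of \<open>\<Upsilon>\<^sub>h\<^sub>+\<^sub>1(x\<^sub>j)\<close>, this is necessary for
  \<open>\<phi> (h + 1)\<close> to be injective on \<open>G/\<Gamma>\<^sub>h\<^sub>+\<^sub>1G\<close>.\<close>

definition lifts_relations ::
    "nat \<Rightarrow> ('a, 'b) monoid_scheme \<Rightarrow> (nat \<times> nat \<Rightarrow> 'a) \<Rightarrow>
     (nat \<Rightarrow> lpoly mat \<Rightarrow> lpoly mat) \<Rightarrow> (nat \<Rightarrow> lpoly mat set) \<Rightarrow> nat \<Rightarrow> bool" where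
  "lifts_relations q G w s K h \<longleftrightarrow>
     (\<forall>v\<in>carrier (FG q). Ups q (h + 1) v \<in> s h ` K h \<longrightarrow>
        free_lift G (meridian w) v \<in> lcs G (h + 1))"

end

theory Submission
  imports Defs
begin

text \<open>Let \<open>\<pi>\<close> be the link group and \<open>\<psi> : F \<rightarrow> \<pi>\<close> the homomorphism that sends \<open>x\<^sub>j\<close> to the \<open>j\<close>-th meridian. The
  arcs of a component are conjugate, so \<open>\<pi> = \<psi>(F) \<Gamma>\<^sub>h\<pi>\<close> for all \<open>h\<close>, and the claim is that \<open>\<psi>\<close> induces an
  inverse of the map in the theorem. By Magnus' theorem the kernel of \<open>\<Upsilon>\<^sub>h\<close> is \<open>\<Gamma>\<^sub>hF\<close>, so it remains to see
  that \<open>\<psi> v \<in> \<Gamma>\<^sub>h\<pi>\<close> whenever \<open>\<Upsilon>\<^sub>h v \<in> K\<^sub>h\<close>. Conjugation modulo \<open>\<Gamma>\<^sub>h\<^sub>+\<^sub>1\<close> only depends on the conjugating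
  element modulo \<open>\<Gamma>\<^sub>h\<close>; by induction on \<open>h\<close>, \<open>\<psi>\<close> therefore takes \<open>\<C>\<^sub>h(\<alpha>\<^sub>k)\<close> to \<open>\<alpha>\<^sub>k\<close> modulo \<open>\<Gamma>\<^sub>h\<^sub>+\<^sub>1\<pi>\<close>, and the
  last Wirtinger relation of the component makes the image of \<open>\<mu>\<^sup>h(j)\<close> trivial. For the same reason the
  \<open>\<C>\<^sub>h(\<alpha>\<^sub>k)\<close> satisfy the Wirtinger relations modulo \<open>K\<^sub>h\<^sub>+\<^sub>1\<close>, which gives the existence of the construction.

  Magnus' theorem is proved by Lazard elimination: replacing a generator \<open>x\<close> by the iterated
  commutators \<open>[y, x, \<dots>, x]\<close> with the other generators \<open>y\<close> keeps the leading words of the Magnus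
  expansions free generators of a monoid, until no words of length less than \<open>n\<close> are left.\<close>

section \<open>The lower central series\<close>

text \<open>Two obstacles shape the proof. First, the matrix entries lie in a commutative ring. The
  lower index of an indeterminate records the position of a letter, so the first row of
  \<open>Ups q n v\<close> still determines the coefficients of all words shorter than n in the
  noncommutative Magnus series. The kernel question thus becomes one about power series, whose hard
  half asks for a nonzero coefficient in degree below n for each element outside Gamma_nF. Leading
  words supply it: a power g^k keeps its word with coefficient k, nonzero in the integers, and this
  term cannot cancel against the other factor because the eliminated word is not a product of the
  remaining ones. Second, sections are only set-theoretic, so the lift of a relation may fail to be
  one. The invariant carried from level to level is that every v in F over an element of K_h has psi
  v in Gamma_h of the link group. A section respecting it exists because Gamma_h of the link group
  is psi(Gamma_hF) modulo Gamma_(h+1), so a lift can be corrected by a word that Upsilon_h does not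
  see.\<close>

abbreviation comm_elt :: "('a, 'b) monoid_scheme \<Rightarrow> 'a \<Rightarrow> 'a \<Rightarrow> 'a" where
  "comm_elt G x y \<equiv> x \<otimes>\<^bsub>G\<^esub> y \<otimes>\<^bsub>G\<^esub> inv\<^bsub>G\<^esub> x \<otimes>\<^bsub>G\<^esub> inv\<^bsub>G\<^esub> y"

context group
begin

lemma cancel_left:
  assumes "x \<in> carrier G" "y \<in> carrier G"
  shows "x \<otimes> (inv x \<otimes> y) = y" "inv x \<otimes> (x \<otimes> y) = y"
  using assms by (simp_all add: m_assoc[symmetric])

lemmas word_simps = m_assoc inv_mult_group cancel_left

lemma normal_conj:
  assumes "N \<lhd> G" "x \<in> carrier G" "h \<in> N"
  shows "x \<otimes> h \<otimes> inv x \<in> N" "inv x \<otimes> h \<otimes> x \<in> N"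
  by (rule normal.inv_op_closed2[OF assms]) (rule normal.inv_op_closed1[OF assms])

lemma rcos_eq_iff:
  assumes N: "N \<lhd> G" and x: "x \<in> carrier G" and y: "y \<in> carrier G"
  shows "N #> x = N #> y \<longleftrightarrow> x \<otimes> inv y \<in> N"
proof -
  have sub: "subgroup N G" using N by (rule normal_imp_subgroup)
  have "N #> x = N #> y \<longleftrightarrow> x \<in> N #> y"
    using repr_independence[of x N y] rcos_self[OF x sub] x y sub by auto
  also have "\<dots> \<longleftrightarrow> x \<otimes> inv y \<in> N"
    using subgroup.rcos_module[OF sub is_group y x] .
  finally show ?thesis .
qed

lemma rcos_eq_normal_iff:
  assumes "N \<lhd> G" "x \<in> carrier G"
  shows "N #> x = N \<longleftrightarrow> x \<in> N"
  using rcos_eq_iff[OF assms one_closed] assms normal_imp_subgroup[OF assms(1)]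
  by (simp add: subgroup.subset)

lemma comm_elt_closed: "x \<in> carrier G \<Longrightarrow> y \<in> carrier G \<Longrightarrow> comm_elt G x y \<in> carrier G"
  by simp

lemma comm_elt_conj:
  assumes "x \<in> carrier G" "y \<in> carrier G" "g \<in> carrier G"
  shows "g \<otimes> comm_elt G x y \<otimes> inv g = comm_elt G (g \<otimes> x \<otimes> inv g) (g \<otimes> y \<otimes> inv g)"
  using assms by (simp add: word_simps)

lemma commutator_subgroup_normal:
  assumes "H \<lhd> G" "K \<lhd> G"
  shows "commutator_subgroup G H K \<lhd> G"
  unfolding commutator_subgroup_def
proof (rule normal_generateI)
  have sub: "H \<subseteq> carrier G" "K \<subseteq> carrier G"
    using assms by (simp_all add: normal_imp_subgroup subgroup.subset)
  then show "(\<Union>h\<in>H. \<Union>k\<in>K. {comm_elt G h k}) \<subseteq> carrier G"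
    by (auto intro!: comm_elt_closed)
  fix c g assume "c \<in> (\<Union>h\<in>H. \<Union>k\<in>K. {comm_elt G h k})" and g: "g \<in> carrier G"
  then obtain h k where hk: "h \<in> H" "k \<in> K" "c = comm_elt G h k" by auto
  then have "g \<otimes> c \<otimes> inv g = comm_elt G (g \<otimes> h \<otimes> inv g) (g \<otimes> k \<otimes> inv g)"
    using comm_elt_conj[of h k g] g sub by auto
  then show "g \<otimes> c \<otimes> inv g \<in> (\<Union>h\<in>H. \<Union>k\<in>K. {comm_elt G h k})"
    using normal_conj(1)[OF assms(1) g hk(1)] normal_conj(1)[OF assms(2) g hk(2)] by auto
qed

lemma lcs_normal: "lcs G n \<lhd> G"
proof (induction n)
  case 0 show ?case by (simp add: normal_self)
next
  case (Suc n) then show ?case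
    by (cases n) (auto simp: normal_self intro: commutator_subgroup_normal)
qed

lemma lcs_subgroup: "subgroup (lcs G n) G"
  using lcs_normal by (rule normal_imp_subgroup)

lemma lcs_subset: "lcs G n \<subseteq> carrier G"
  using lcs_subgroup by (rule subgroup.subset)

lemma lcs_carrier: "x \<in> lcs G n \<Longrightarrow> x \<in> carrier G"
  using lcs_subset by auto

lemma lcs_closed:
  "\<one> \<in> lcs G n"
  "x \<in> lcs G n \<Longrightarrow> y \<in> lcs G n \<Longrightarrow> x \<otimes> y \<in> lcs G n"
  "x \<in> lcs G n \<Longrightarrow> inv x \<in> lcs G n"
  using lcs_subgroup[of n] by (auto intro: subgroup.one_closed subgroup.m_closed subgroup.m_inv_closed)

lemma lcs_Suc:
  assumes "n \<ge> 1"
  shows "lcs G (Suc n) = commutator_subgroup G (lcs G n) (carrier G)"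
  using assms by (cases n) auto

lemma comm_elt_lcs_Suc:
  assumes "n \<ge> 1" "x \<in> lcs G n" "y \<in> carrier G"
  shows "comm_elt G x y \<in> lcs G (Suc n)"
  unfolding lcs_Suc[OF assms(1)] commutator_subgroup_def
  using assms by (intro generate.incl) auto

lemma comm_elt_in_normal:
  assumes "N \<lhd> G" "x \<in> N" "y \<in> carrier G"
  shows "comm_elt G x y \<in> N"
proof -
  have sub: "subgroup N G" using assms(1) by (rule normal_imp_subgroup)
  have x: "x \<in> carrier G" using assms sub by (auto dest: subgroup.subset)
  have "x \<otimes> (y \<otimes> inv x \<otimes> inv y) \<in> N"
    using assms sub by (intro subgroup.m_closed[OF sub] normal_conj) (auto intro: subgroup.m_inv_closed)
  then show ?thesis using x assms by (simp add: m_assoc)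
qed

lemma lcs_Suc_subset: "lcs G (Suc n) \<subseteq> lcs G n"
proof (cases n)
  case 0 then show ?thesis by simp
next
  case (Suc k)
  have "generate G (\<Union>h\<in>lcs G n. \<Union>k\<in>carrier G. {comm_elt G h k}) \<subseteq> lcs G n"
    by (rule generate_subgroup_incl[OF _ lcs_subgroup]) (auto intro: comm_elt_in_normal[OF lcs_normal])
  then show ?thesis using Suc by (simp add: commutator_subgroup_def)
qed

lemma lcs_antimono: "m \<le> n \<Longrightarrow> lcs G n \<subseteq> lcs G m"
  using lcs_Suc_subset by (rule lift_Suc_antimono_le)

text \<open>The inverses translate the classical identity for the convention [a,b] = a^-1 b^-1 a b,
  which is \<open>comm_elt G (inv a) (inv b)\<close>. It holds already by free reduction.\<close>

lemma Hall_Witt: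
  assumes "x \<in> carrier G" "y \<in> carrier G" "z \<in> carrier G"
  shows "(inv y \<otimes> comm_elt G (inv (comm_elt G (inv x) y)) (inv z) \<otimes> y) \<otimes>
         (inv z \<otimes> comm_elt G (inv (comm_elt G (inv y) z)) (inv x) \<otimes> z) \<otimes>
         (inv x \<otimes> comm_elt G (inv (comm_elt G (inv z) x)) (inv y) \<otimes> x) = \<one>"
  using assms by (simp add: word_simps)

text \<open>Rests on [x,tu] = [x,t] (t [x,u] t^-1). Its use is to test a commutator condition on t
  only on generators.\<close>

lemma centralizer_mod_subgroup:
  assumes N: "N \<lhd> G" and A: "A \<subseteq> carrier G"
  shows "subgroup {t \<in> carrier G. \<forall>x\<in>A. comm_elt G x t \<in> N} G" (is "subgroup ?S G")
proof (rule subgroupI)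
  have sub: "subgroup N G" using N by (rule normal_imp_subgroup)
  show "?S \<noteq> {}"
    using A subgroup.one_closed[OF sub] by (auto intro!: exI[of _ \<one>])
  fix t assume t: "t \<in> ?S"
  have "comm_elt G x (inv t) \<in> N" if "x \<in> A" for x
  proof -
    have x: "x \<in> carrier G" using that A by auto
    have "inv t \<otimes> inv (comm_elt G x t) \<otimes> t \<in> N"
      using t that by (intro normal_conj[OF N]) (auto intro: subgroup.m_inv_closed[OF sub])
    then show ?thesis using t x by (simp add: word_simps)
  qed
  then show "inv t \<in> ?S" using t by simp
  fix u assume u: "u \<in> ?S"
  have "comm_elt G x (t \<otimes> u) \<in> N" if "x \<in> A" for x
  proof -
    have x: "x \<in> carrier G" using that A by auto
    have "comm_elt G x t \<otimes> (t \<otimes> comm_elt G x u \<otimes> inv t) \<in> N"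
      using t u that by (intro subgroup.m_closed[OF sub _ normal_conj(1)[OF N]]) auto
    then show ?thesis using t u x by (simp add: word_simps)
  qed
  then show "t \<otimes> u \<in> ?S" using t u by simp
qed auto

lemma comm_elt_swap:
  assumes "N \<lhd> G" "x \<in> carrier G" "y \<in> carrier G" "comm_elt G x y \<in> N"
  shows "comm_elt G y x \<in> N"
proof -
  have "inv (comm_elt G x y) \<in> N"
    using assms normal_imp_subgroup subgroup.m_inv_closed by metis
  then show ?thesis using assms by (simp add: word_simps)
qed

text \<open>Three subgroups argument, by induction on b with a free. For t = [y,z] with y in
  Gamma_b, the Hall-Witt identity bounds [t,x] by [[x,y],z], controlled by the induction hypothesis
  at a, and by [[z,x],y], controlled by it at a + 1.\<close>

lemma lcs_comm_elt:
  assumes "a \<ge> 1" "b \<ge> 1" "x \<in> lcs G a" "y \<in> lcs G b"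
  shows "comm_elt G x y \<in> lcs G (a + b)"
  using assms(2,1,3,4)
proof (induction b arbitrary: a x y rule: nat_induct_at_least)
  case base
  then show ?case using comm_elt_lcs_Suc lcs_carrier by simp
next
  case (Suc b)
  let ?N = "lcs G (a + Suc b)"
  note N = lcs_normal[of "a + Suc b"]
  let ?T = "{t \<in> carrier G. \<forall>x\<in>lcs G a. comm_elt G x t \<in> ?N}"
  have sub: "subgroup ?T G" by (rule centralizer_mod_subgroup[OF N lcs_subset])
  have "comm_elt G y z \<in> ?T" if y: "y \<in> lcs G b" and z: "z \<in> carrier G" for y z
  proof -
    have "comm_elt G x (comm_elt G y z) \<in> ?N" if x: "x \<in> lcs G a" for x
    proof -
      note c = lcs_carrier[OF x] lcs_carrier[OF y] z
      \<comment> \<open>With inv y in place of y, the double inverse turns the middle factor of the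
        Hall-Witt identity into a commutator of [y,z] itself.\<close>
      let ?y = "inv y"
      let ?t = "comm_elt G y z"
      let ?P = "inv ?y \<otimes> comm_elt G (inv (comm_elt G (inv x) ?y)) (inv z) \<otimes> ?y"
      let ?Q = "inv z \<otimes> comm_elt G (inv (comm_elt G (inv ?y) z)) (inv x) \<otimes> z"
      let ?R = "inv x \<otimes> comm_elt G (inv (comm_elt G (inv z) x)) (inv ?y) \<otimes> x"
      have "inv (comm_elt G (inv x) ?y) \<in> lcs G (a + b)"
        using Suc.IH[of a "inv x" ?y] Suc.prems x y by (simp add: lcs_closed)
      then have P: "?P \<in> ?N"
        using comm_elt_lcs_Suc[of "a + b" "inv (comm_elt G (inv x) ?y)" "inv z"] Suc.prems c
        by (intro normal_conj[OF N]) (simp_all del: inv_mult_group)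
      have "comm_elt G x (inv z) \<in> lcs G (Suc a)"
        using Suc.prems c x by (intro comm_elt_lcs_Suc) auto
      then have "inv (comm_elt G (inv z) x) \<in> lcs G (Suc a)"
        using comm_elt_swap[OF lcs_normal, of x "inv z" "Suc a"] c by (auto intro: lcs_closed)
      then have "comm_elt G (inv (comm_elt G (inv z) x)) (inv ?y) \<in> lcs G (Suc a + b)"
        using Suc.IH[of "Suc a" _ "inv ?y"] y by (simp add: lcs_closed)
      then have R: "?R \<in> ?N"
        using c by (intro normal_conj[OF N]) auto
      have "?P \<otimes> ?Q \<otimes> ?R = \<one>" using Hall_Witt[of x ?y z] c by blast
      then have "inv ?P \<otimes> (?P \<otimes> ?Q \<otimes> ?R) \<otimes> inv ?R = inv ?P \<otimes> \<one> \<otimes> inv ?R" by (rule arg_cong)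
      then have "?Q = inv ?P \<otimes> inv ?R" using c by (simp add: word_simps)
      then have "?Q \<in> ?N" using P R by (metis lcs_closed(2,3))
      then have "z \<otimes> ?Q \<otimes> inv z \<in> ?N" using c by (intro normal_conj(1)[OF N])
      moreover have "z \<otimes> (inv z \<otimes> C \<otimes> z) \<otimes> inv z = C" if "C \<in> carrier G" for C
        using that c by (simp add: word_simps)
      moreover have "comm_elt G (inv (comm_elt G (inv ?y) z)) (inv x) \<in> carrier G" using c by simp
      ultimately have "comm_elt G (inv ?t) (inv x) \<in> ?N" using c by (simp del: inv_mult_group)
      \<comment> \<open>Conjugation by x t turns [t^-1, x^-1] into [t, x].\<close>
      then have "(x \<otimes> ?t) \<otimes> comm_elt G (inv ?t) (inv x) \<otimes> inv (x \<otimes> ?t) \<in> ?N"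
        using c by (intro normal_conj(1)[OF N]) auto
      then have "comm_elt G ?t x \<in> ?N" using c by (simp add: word_simps)
      then show ?thesis using comm_elt_swap[OF N] c by auto
    qed
    then show ?thesis using y z lcs_carrier by simp
  qed
  then have "lcs G (Suc b) \<subseteq> ?T"
    unfolding lcs_Suc[OF Suc.hyps] commutator_subgroup_def
    by (intro generate_subgroup_incl[OF _ sub]) auto
  then show ?case using Suc.prems by auto
qed

end

lemma (in group_hom) hom_comm_elt:
  assumes "x \<in> carrier G" "y \<in> carrier G"
  shows "h (comm_elt G x y) = comm_elt H (h x) (h y)"
  using assms by simp

lemma (in group_hom) commutator_subgroup_img:
  assumes "A \<subseteq> carrier G" "B \<subseteq> carrier G"
  shows "h ` commutator_subgroup G A B = commutator_subgroup H (h ` A) (h ` B)"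
proof -
  have "h ` (\<Union>a\<in>A. \<Union>b\<in>B. {comm_elt G a b}) = (\<Union>a\<in>h ` A. \<Union>b\<in>h ` B. {comm_elt H a b})"
    using assms hom_comm_elt by (force simp: image_UN subset_iff)
  then show ?thesis
    unfolding commutator_subgroup_def using assms
    by (subst generate_img[symmetric]) (auto intro!: G.comm_elt_closed)
qed

lemma (in group_hom) lcs_img:
  assumes "h ` carrier G = carrier H"
  shows "h ` lcs G n = lcs H n"
proof (induction n)
  case (Suc n)
  then show ?case
    using assms commutator_subgroup_img[OF G.lcs_subset[of n] subset_refl] by (cases n) auto
qed (use assms in simp)

lemma (in group_hom) lcs_img_subset: "h ` lcs G n \<subseteq> lcs H n"
proof (induction n)
  case (Suc n)
  show ?case
  proof (cases n)
    case (Suc k)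
    have "commutator_subgroup H (h ` lcs G n) (h ` carrier G) \<subseteq> commutator_subgroup H (lcs H n) (carrier H)"
      unfolding commutator_subgroup_def using Suc.IH by (intro H.mono_generate UN_mono) auto
    then show ?thesis
      using Suc commutator_subgroup_img[OF G.lcs_subset[of n] subset_refl] by simp
  qed auto
qed auto

section \<open>Normal closures\<close>

context group
begin

lemma conj_mult_inv:
  "a \<in> carrier G \<Longrightarrow> b \<in> carrier G \<Longrightarrow> g \<in> carrier G \<Longrightarrow>
    a \<otimes> (b \<otimes> g \<otimes> inv b) \<otimes> inv a = (a \<otimes> b) \<otimes> g \<otimes> inv (a \<otimes> b)"
  by (simp add: word_simps)

lemma normal_closure_normal:
  assumes "S \<subseteq> carrier G"
  shows "normal_closure G S \<lhd> G"
  unfolding normal_closure_def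
proof (rule normal_generateI)
  show "{g \<otimes> s \<otimes> inv g |g s. g \<in> carrier G \<and> s \<in> S} \<subseteq> carrier G" using assms by auto
  fix h g assume "h \<in> {g \<otimes> s \<otimes> inv g |g s. g \<in> carrier G \<and> s \<in> S}" and g: "g \<in> carrier G"
  then obtain a s where "a \<in> carrier G" "s \<in> S" "h = a \<otimes> s \<otimes> inv a" by auto
  then show "g \<otimes> h \<otimes> inv g \<in> {g \<otimes> s \<otimes> inv g |g s. g \<in> carrier G \<and> s \<in> S}"
    using conj_mult_inv[of g a s] g assms by blast
qed

lemma normal_closure_incl:
  assumes "S \<subseteq> carrier G"
  shows "S \<subseteq> normal_closure G S"
proof
  fix s assume "s \<in> S"
  then have "s = \<one> \<otimes> s \<otimes> inv \<one>" using assms by auto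
  then show "s \<in> normal_closure G S"
    unfolding normal_closure_def using \<open>s \<in> S\<close> by (intro generate.incl) blast
qed

lemma normal_closure_minimal:
  assumes "N \<lhd> G" "S \<subseteq> N"
  shows "normal_closure G S \<subseteq> N"
  unfolding normal_closure_def
  using assms by (intro generate_subgroup_incl normal_imp_subgroup) (auto intro: normal_conj)

end

lemma (in group_hom) vimage_normal:
  assumes "N \<lhd> H"
  shows "{x \<in> carrier G. h x \<in> N} \<lhd> G"
proof -
  have sub: "subgroup N H" using assms by (rule normal_imp_subgroup)
  have "subgroup {x \<in> carrier G. h x \<in> N} G"
    by (rule G.subgroupI)
      (auto intro!: exI[of _ "\<one>"] subgroup.one_closed[OF sub] subgroup.m_closed[OF sub] subgroup.m_inv_closed[OF sub])
  then show ?thesis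
    unfolding G.normal_inv_iff using H.normal_conj(1)[OF assms] by auto
qed

lemma (in group_hom) normal_closure_img:
  assumes "h ` carrier G = carrier H" "S \<subseteq> carrier G"
  shows "h ` normal_closure G S = normal_closure H (h ` S)"
proof -
  have "h ` {g \<otimes> s \<otimes> inv g |g s. g \<in> carrier G \<and> s \<in> S} =
      {g \<otimes>\<^bsub>H\<^esub> s \<otimes>\<^bsub>H\<^esub> inv\<^bsub>H\<^esub> g |g s. g \<in> carrier H \<and> s \<in> h ` S}" (is "?A = ?B")
  proof
    show "?A \<subseteq> ?B" using assms(2) by (force simp: subset_iff)
    show "?B \<subseteq> ?A"
    proof
      fix y assume "y \<in> ?B"
      then obtain g' s where "g' \<in> h ` carrier G" "s \<in> S" "y = g' \<otimes>\<^bsub>H\<^esub> h s \<otimes>\<^bsub>H\<^esub> inv\<^bsub>H\<^esub> g'"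
        unfolding assms(1) by auto
      moreover from this obtain g where "g \<in> carrier G" "g' = h g" by auto
      moreover from calculation have "y = h (g \<otimes> s \<otimes> inv g)" using assms(2) by (auto simp: subset_iff)
      ultimately show "y \<in> ?A" by blast
    qed
  qed
  then show ?thesis
    unfolding normal_closure_def using assms(2) by (subst generate_img[symmetric]) auto
qed

section \<open>Free groups\<close>

abbreviation letter_inv :: "'x \<times> bool \<Rightarrow> 'x \<times> bool" where
  "letter_inv a \<equiv> (fst a, \<not> snd a)"

abbreviation reduced :: "('x \<times> bool) list \<Rightarrow> bool" where
  "reduced \<equiv> successively (\<lambda>a b. b \<noteq> letter_inv a)"

lemma reduced_cons_reduce: "reduced v \<Longrightarrow> reduced (cons_reduce a v)"
  by (cases v) (auto simp: successively_Cons)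

lemma reduced_foldr: "reduced v \<Longrightarrow> reduced (foldr cons_reduce u v)"
  by (induction u) (auto simp: reduced_cons_reduce)

lemma set_cons_reduce: "set (cons_reduce a v) \<subseteq> insert a (set v)"
  by (cases v) auto

lemma set_foldr_cons_reduce: "set (foldr cons_reduce u v) \<subseteq> set u \<union> set v"
proof (induction u)
  case (Cons a u)
  then show ?case using set_cons_reduce[of a "foldr cons_reduce u v"] by auto
qed simp

lemma cons_reduce_reduced: "reduced (a # v) \<Longrightarrow> cons_reduce a v = a # v"
  by (cases v) auto

text \<open>The device of van der Waerden: on reduced words a letter and its inverse act as mutually
  inverse permutations. Reducedness matters when \<open>a\<close> cancels the head of
  \<open>v\<close>, since the head put back must not cancel with the next letter.\<close>

lemma cons_reduce_inv:
  assumes "reduced v"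
  shows "cons_reduce (letter_inv a) (cons_reduce a v) = v"
proof (cases v)
  case (Cons b w)
  show ?thesis
  proof (cases "b = letter_inv a")
    case True
    then show ?thesis using Cons assms cons_reduce_reduced[of b w] by simp
  qed (use Cons in simp)
qed simp

lemma cons_reduce_inv': "reduced v \<Longrightarrow> cons_reduce a (cons_reduce (letter_inv a) v) = v"
  using cons_reduce_inv[of v "letter_inv a"] by simp

lemma foldr_cons_reduce_cons:
  "reduced w \<Longrightarrow> foldr cons_reduce (cons_reduce a v) w = cons_reduce a (foldr cons_reduce v w)"
  by (cases v) (auto simp: cons_reduce_inv' reduced_foldr)

text \<open>A product is the action of the left word on the right one, and a cancelled pair of
  letters acts trivially, so the reduced word acts like the unreduced concatenation.\<close>

lemma foldr_cons_reduce_assoc: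
  "reduced w \<Longrightarrow> foldr cons_reduce (foldr cons_reduce u v) w = foldr cons_reduce u (foldr cons_reduce v w)"
  by (induction u) (auto simp: foldr_cons_reduce_cons)

lemma foldr_cons_reduce_Nil: "reduced u \<Longrightarrow> foldr cons_reduce u [] = u"
proof (induction u)
  case (Cons a u)
  then show ?case by (cases u) (auto simp: successively_Cons)
qed simp

lemma foldr_cons_reduce_inverse:
  "reduced w \<Longrightarrow> foldr cons_reduce (rev (map letter_inv u)) (foldr cons_reduce u w) = w"
  by (induction u) (auto simp: cons_reduce_inv reduced_foldr)

lemma free_group_carrier_iff: "v \<in> carrier (free_group X) \<longleftrightarrow> fst ` set v \<subseteq> X \<and> reduced v"
  by (simp add: free_group_def)

lemma free_group_mult: "u \<otimes>\<^bsub>free_group X\<^esub> v = foldr cons_reduce u v"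
  by (simp add: free_group_def)

lemma free_group_one: "\<one>\<^bsub>free_group X\<^esub> = []"
  by (simp add: free_group_def)

lemma free_group_is_group: "group (free_group X)"
proof (rule groupI, unfold free_group_mult free_group_one free_group_carrier_iff)
  fix u v w :: "('a \<times> bool) list"
  assume u: "fst ` set u \<subseteq> X \<and> reduced u"
  show "foldr cons_reduce [] u = u" by simp
  have "set (foldr cons_reduce (rev (map letter_inv u)) []) \<subseteq> letter_inv ` set u"
    using set_foldr_cons_reduce[of "rev (map letter_inv u)" "[]"] by auto
  then have "fst ` set (foldr cons_reduce (rev (map letter_inv u)) []) \<subseteq> X"
    using u by fastforce
  moreover have "foldr cons_reduce (foldr cons_reduce (rev (map letter_inv u)) []) u = []"
    using u foldr_cons_reduce_inverse[of "[]" u] foldr_cons_reduce_Nil[of u]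
    by (simp add: foldr_cons_reduce_assoc)
  ultimately show "\<exists>v\<in>carrier (free_group X). foldr cons_reduce v u = []"
    using reduced_foldr[of "[]" "rev (map letter_inv u)"]
    by (intro bexI[of _ "foldr cons_reduce (rev (map letter_inv u)) []"])
      (simp_all add: free_group_carrier_iff)
  assume v: "fst ` set v \<subseteq> X \<and> reduced v"
  show "fst ` set (foldr cons_reduce u v) \<subseteq> X \<and> reduced (foldr cons_reduce u v)"
    using u v set_foldr_cons_reduce[of u v] reduced_foldr[of v u] by fastforce
  assume "fst ` set w \<subseteq> X \<and> reduced w"
  then show "foldr cons_reduce (foldr cons_reduce u v) w = foldr cons_reduce u (foldr cons_reduce v w)"
    by (simp add: foldr_cons_reduce_assoc)
qed auto

lemma fgen_carrier: "x \<in> X \<Longrightarrow> fgen x \<in> carrier (free_group X)"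
  by (simp add: free_group_carrier_iff fgen_def)

lemma fgen_inv:
  assumes "x \<in> X"
  shows "inv\<^bsub>free_group X\<^esub> (fgen x) = [(x, False)]"
proof -
  interpret group "free_group X" by (rule free_group_is_group)
  have "[(x, False)] \<otimes>\<^bsub>free_group X\<^esub> fgen x = \<one>\<^bsub>free_group X\<^esub>"
    by (simp add: free_group_mult free_group_one fgen_def)
  then show ?thesis
    using assms by (intro inv_equality fgen_carrier) (auto simp: free_group_carrier_iff)
qed

lemma free_group_Cons:
  assumes "(x, e) # v \<in> carrier (free_group X)"
  shows "x \<in> X" "v \<in> carrier (free_group X)"
    "(x, e) # v = (if e then fgen x else inv\<^bsub>free_group X\<^esub> (fgen x)) \<otimes>\<^bsub>free_group X\<^esub> v"
proof -
  have red: "reduced ((x, e) # v)" and x: "x \<in> X" and v: "v \<in> carrier (free_group X)"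
    using assms by (auto simp: free_group_carrier_iff successively_Cons)
  show "x \<in> X" "v \<in> carrier (free_group X)" by fact+
  have "(x, e) # v = [(x, e)] \<otimes>\<^bsub>free_group X\<^esub> v"
    using red by (cases v) (auto simp: free_group_mult successively_Cons)
  then show "(x, e) # v = (if e then fgen x else inv\<^bsub>free_group X\<^esub> (fgen x)) \<otimes>\<^bsub>free_group X\<^esub> v"
    using fgen_inv[OF x] by (simp add: fgen_def)
qed

lemma free_group_induct [consumes 1, case_names one gen inv]:
  assumes "v \<in> carrier (free_group X)"
    and "P \<one>\<^bsub>free_group X\<^esub>"
    and "\<And>x v. x \<in> X \<Longrightarrow> v \<in> carrier (free_group X) \<Longrightarrow> P v \<Longrightarrow> P (fgen x \<otimes>\<^bsub>free_group X\<^esub> v)"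
    and "\<And>x v. x \<in> X \<Longrightarrow> v \<in> carrier (free_group X) \<Longrightarrow> P v \<Longrightarrow>
      P (inv\<^bsub>free_group X\<^esub> (fgen x) \<otimes>\<^bsub>free_group X\<^esub> v)"
  shows "P v"
  using assms(1)
proof (induction v)
  case Nil then show ?case using assms(2) by (simp add: free_group_one)
next
  case (Cons a v)
  obtain x e where a: "a = (x, e)" by (cases a)
  then show ?case
    using Cons free_group_Cons[of x e v X] assms(3,4)[of x v] by (cases e) auto
qed

lemma free_group_generate: "generate (free_group X) (fgen ` X) = carrier (free_group X)"
proof
  interpret group "free_group X" by (rule free_group_is_group)
  show "generate (free_group X) (fgen ` X) \<subseteq> carrier (free_group X)"
    by (intro generate_incl) (auto intro: fgen_carrier)
  show "carrier (free_group X) \<subseteq> generate (free_group X) (fgen ` X)"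
  proof
    fix v assume "v \<in> carrier (free_group X)"
    then show "v \<in> generate (free_group X) (fgen ` X)"
    proof (induction rule: free_group_induct)
      case one show ?case by (rule generate.one)
    next
      case (gen x v)
      then show ?case by (intro generate.eng[OF generate.incl]) auto
    next
      case (inv x v)
      then show ?case by (intro generate.eng[OF generate.inv]) auto
    qed
  qed
qed

context group
begin

lemma free_lift_closed:
  "g ` X \<subseteq> carrier G \<Longrightarrow> fst ` set v \<subseteq> X \<Longrightarrow> free_lift G g v \<in> carrier G"
  by (induction v) (auto simp: free_lift_def)

lemma free_lift_Cons:
  "free_lift G g (a # v) = (if snd a then g (fst a) else inv (g (fst a))) \<otimes> free_lift G g v"
  by (cases a) (simp add: free_lift_def)

lemma free_lift_cons_reduce:
  assumes "g ` X \<subseteq> carrier G" "fst a \<in> X" "fst ` set v \<subseteq> X"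
  shows "free_lift G g (cons_reduce a v) = (if snd a then g (fst a) else inv (g (fst a))) \<otimes> free_lift G g v"
proof (cases v)
  case (Cons b w)
  have "free_lift G g w \<in> carrier G" "g (fst a) \<in> carrier G"
    using assms Cons by (auto intro: free_lift_closed)
  then show ?thesis using Cons by (auto simp: free_lift_Cons cancel_left)
qed (simp add: free_lift_Cons)

lemma free_lift_hom:
  assumes "g ` X \<subseteq> carrier G"
  shows "free_lift G g \<in> hom (free_group X) G"
proof (rule homI)
  fix u assume "u \<in> carrier (free_group X)"
  then show "free_lift G g u \<in> carrier G"
    using assms free_lift_closed by (auto simp: free_group_carrier_iff)
next
  fix u v assume u: "u \<in> carrier (free_group X)" and v: "v \<in> carrier (free_group X)"
  have v': "fst ` set v \<subseteq> X" using v by (simp add: free_group_carrier_iff)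
  have "fst ` set u \<subseteq> X" using u by (simp add: free_group_carrier_iff)
  then have "free_lift G g (foldr cons_reduce u v) = free_lift G g u \<otimes> free_lift G g v"
  proof (induction u)
    case Nil
    then show ?case using free_lift_closed[OF assms v'] by (simp add: free_lift_def)
  next
    case (Cons a u)
    have "fst ` set (foldr cons_reduce u v) \<subseteq> X"
      using Cons v' set_foldr_cons_reduce[of u v] by fastforce
    then have "free_lift G g (foldr cons_reduce (a # u) v) =
        (if snd a then g (fst a) else inv (g (fst a))) \<otimes> free_lift G g (foldr cons_reduce u v)"
      using assms Cons.prems by (simp add: free_lift_cons_reduce[where X = X])
    moreover have "free_lift G g u \<in> carrier G" "free_lift G g v \<in> carrier G" "g (fst a) \<in> carrier G"
      using assms Cons.prems v' by (auto intro: free_lift_closed)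
    ultimately show ?case
      using Cons by (simp add: free_lift_Cons m_assoc)
  qed
  then show "free_lift G g (u \<otimes>\<^bsub>free_group X\<^esub> v) = free_lift G g u \<otimes> free_lift G g v"
    by (simp add: free_group_mult)
qed

lemma free_lift_group_hom:
  "g ` X \<subseteq> carrier G \<Longrightarrow> group_hom (free_group X) G (free_lift G g)"
  by (simp add: group_hom_def group_hom_axioms_def free_group_is_group free_lift_hom is_group)

lemma free_lift_fgen: "g x \<in> carrier G \<Longrightarrow> free_lift G g (fgen x) = g x"
  by (simp add: free_lift_def fgen_def)

lemma free_lift_image:
  assumes "g ` X \<subseteq> carrier G"
  shows "free_lift G g ` carrier (free_group X) = generate G (g ` X)"
proof -
  interpret hom: group_hom "free_group X" G "free_lift G g" using assms by (rule free_lift_group_hom)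
  have "free_lift G g ` fgen ` X = g ` X"
    unfolding image_image by (rule image_cong) (use assms in \<open>auto intro: free_lift_fgen\<close>)
  moreover have "fgen ` X \<subseteq> carrier (free_group X)" by (auto intro: fgen_carrier)
  ultimately show ?thesis
    using hom.generate_img[of "fgen ` X"] by (simp add: free_group_generate)
qed

end

lemma free_group_hom_eqI:
  assumes "group_hom (free_group X) H h" "group_hom (free_group X) H k"
    and "\<And>x. x \<in> X \<Longrightarrow> h (fgen x) = k (fgen x)" and "v \<in> carrier (free_group X)"
  shows "h v = k v"
proof -
  interpret h: group_hom "free_group X" H h by fact
  interpret k: group_hom "free_group X" H k by fact
  show ?thesis
    using assms(4)
    by (induction rule: free_group_induct) (simp_all add: assms(3) fgen_carrier[where X = X])
qed

section \<open>Noncommutative power series and the Magnus map\<close>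

text \<open>The Cauchy product of noncommutative power series. Recursing through the left quotient
  of \<open>f\<close> by the first letter turns the ring laws into inductions on the word;
  \<open>conv_eq_sum\<close> recovers the sum over all cuts.\<close>

fun conv :: "(nat list \<Rightarrow> int) \<Rightarrow> (nat list \<Rightarrow> int) \<Rightarrow> nat list \<Rightarrow> int" where
  "conv f g [] = f [] * g []"
| "conv f g (a # u) = f [] * g (a # u) + conv (\<lambda>v. f (a # v)) g u"

lemma conv_add_left: "conv (\<lambda>v. f v + f' v) g u = conv f g u + conv f' g u"
  by (induction u arbitrary: f f') (simp_all add: algebra_simps)

lemma conv_scale_left: "conv (\<lambda>v. c * f v) g u = c * conv f g u"
  by (induction u arbitrary: f) (simp_all add: algebra_simps)

lemma conv_add_right: "conv f (\<lambda>v. g v + g' v) u = conv f g u + conv f g' u"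
  by (induction u arbitrary: f) (simp_all add: algebra_simps)

lemma conv_zero_left: "conv (\<lambda>v. 0) g u = 0"
  by (induction u) simp_all

lemma conv_one_left: "conv (\<lambda>v. if v = [] then 1 else 0) g u = g u"
  by (cases u) (simp_all add: conv_zero_left)

lemma conv_one_right: "conv f (\<lambda>v. if v = [] then 1 else 0) u = f u"
  by (induction u arbitrary: f) simp_all

lemma conv_assoc: "conv (conv f g) h u = conv f (conv g h) u"
  by (induction u arbitrary: f) (simp_all add: conv_add_left conv_scale_left algebra_simps)

lemma conv_eq_sum: "conv f g u = (\<Sum>i\<le>length u. f (take i u) * g (drop i u))"
  by (induction u arbitrary: f) (simp_all add: sum.atMost_Suc_shift del: sum.atMost_Suc)

text \<open>Series rather than polynomials, because the inverse of 1 + X_j is infinite; a separate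
  type lets the class \<open>ring_1\<close> supply the algebra.\<close>

typedef series = "UNIV :: (nat list \<Rightarrow> int) set"
  morphisms scoeff Series ..

lemma scoeff_Series [simp]: "scoeff (Series f) = f"
  by (simp add: Series_inverse)

lemma series_eqI: "(\<And>u. scoeff f u = scoeff g u) \<Longrightarrow> f = g"
  by (metis scoeff_inverse ext)

instantiation series :: ring_1
begin

definition "0 = Series (\<lambda>u. 0)"
definition "1 = Series (\<lambda>u. if u = [] then 1 else 0)"
definition "f + g = Series (\<lambda>u. scoeff f u + scoeff g u)"
definition "- f = Series (\<lambda>u. - scoeff f u)"
definition "(f :: series) - g = Series (\<lambda>u. scoeff f u - scoeff g u)"
definition "f * g = Series (conv (scoeff f) (scoeff g))"

lemma scoeff_simps [simp]:
  "scoeff 0 u = 0"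
  "scoeff 1 u = (if u = [] then 1 else 0)"
  "scoeff (f + g) u = scoeff f u + scoeff g u"
  "scoeff (- f) u = - scoeff f u"
  "scoeff (f - g) u = scoeff f u - scoeff g u"
  by (simp_all add: zero_series_def one_series_def plus_series_def uminus_series_def minus_series_def)

lemma scoeff_mult: "scoeff (f * g) u = conv (scoeff f) (scoeff g) u"
  by (simp add: times_series_def)

instance
proof
  fix a b c :: series
  have eta: "scoeff (f * g) = conv (scoeff f) (scoeff g)" "scoeff (f + g) = (\<lambda>u. scoeff f u + scoeff g u)"
    "scoeff 1 = (\<lambda>u. if u = [] then 1 else 0)" for f g
    by (auto simp: scoeff_mult)
  show "a * b * c = a * (b * c)"
    by (rule series_eqI) (simp add: eta conv_assoc)
  show "(a + b) * c = a * c + b * c" "a * (b + c) = a * b + a * c"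
    by (rule series_eqI, simp add: eta conv_add_left conv_add_right)+
  show "1 * a = a" "a * 1 = a"
    by (rule series_eqI, simp add: eta conv_one_left conv_one_right)+
  have "scoeff 0 [] \<noteq> scoeff 1 []" by simp
  then show "(0 :: series) \<noteq> 1" by metis
qed (auto intro!: series_eqI)

end

lemma scoeff_mult_sum: "scoeff (f * g) u = (\<Sum>i\<le>length u. scoeff f (take i u) * scoeff g (drop i u))"
  by (simp add: scoeff_mult conv_eq_sum)

lemma scoeff_mult_Nil: "scoeff (f * g) [] = scoeff f [] * scoeff g []"
  by (simp add: scoeff_mult)

definition svar :: "nat \<Rightarrow> series" where
  "svar j = Series (\<lambda>u. if u = [j] then 1 else 0)"

definition inv_one_svar :: "nat \<Rightarrow> series" where
  "inv_one_svar j = Series (\<lambda>u. if set u \<subseteq> {j} then (- 1) ^ length u else 0)"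

lemma one_svar_inverse:
  "(1 + svar j) * inv_one_svar j = 1" "inv_one_svar j * (1 + svar j) = 1"
proof -
  define Y where "Y = scoeff (inv_one_svar j)"
  have Y: "Y [] = 1" "Y (a # u) = (if a = j then - Y u else 0)" for a u
    by (auto simp: Y_def inv_one_svar_def)
  have X: "scoeff (1 + svar j) = (\<lambda>u. (if u = [] then 1 else 0) + (if u = [j] then 1 else 0))"
    by (auto simp: svar_def)
  have "conv (\<lambda>u. if u = [j] then 1 else 0) Y (a # u) = (if a = j then Y u else 0)" for a u
    by (simp add: conv_zero_left conv_one_left)
  then have "scoeff ((1 + svar j) * inv_one_svar j) u = scoeff 1 u" for u
    unfolding scoeff_mult X conv_add_left conv_one_left Y_def[symmetric]
    by (cases u) (simp_all add: Y del: conv.simps(2))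
  then show "(1 + svar j) * inv_one_svar j = 1" by (intro series_eqI)
  have *: "Y u + conv Y (\<lambda>u. if u = [j] then 1 else 0) u = (if u = [] then 1 else 0)" for u
  proof (induction u)
    case (Cons a u)
    have "(\<lambda>v. Y (a # v)) = (\<lambda>v. (if a = j then - 1 else 0) * Y v)" by (auto simp: Y)
    then have "conv (\<lambda>v. Y (a # v)) (\<lambda>u. if u = [j] then 1 else 0) u =
        (if a = j then - 1 else 0) * conv Y (\<lambda>u. if u = [j] then 1 else 0) u"
      using conv_scale_left by metis
    then show ?case using Cons by (auto simp: Y)
  qed (simp add: Y)
  have "scoeff (inv_one_svar j * (1 + svar j)) u = scoeff 1 u" for u
    unfolding scoeff_mult X conv_add_right conv_one_right Y_def[symmetric] using * by simp
  then show "inv_one_svar j * (1 + svar j) = 1" by (intro series_eqI)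
qed

definition series_units :: "series monoid" where
  "series_units = units_of \<lparr>carrier = UNIV, mult = (*), one = 1\<rparr>"

lemma series_units_group: "group series_units"
proof -
  interpret monoid "\<lparr>carrier = UNIV, mult = (*), one = 1 :: series\<rparr>"
    by (rule monoidI) (simp_all add: mult.assoc)
  show ?thesis unfolding series_units_def by (rule units_group)
qed

lemma series_units_simps [simp]:
  "f \<otimes>\<^bsub>series_units\<^esub> g = f * g" "\<one>\<^bsub>series_units\<^esub> = 1"
  by (simp_all add: series_units_def units_of_def)

definition magnus :: "(nat \<times> bool) list \<Rightarrow> series" where
  "magnus = free_lift series_units (\<lambda>j. 1 + svar j)"

lemma one_svar_unit: "1 + svar j \<in> carrier series_units"
  using one_svar_inverse by (auto simp: series_units_def units_of_def Units_def)

lemma magnus_group_hom: "group_hom (free_group X) series_units magnus"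
  unfolding magnus_def
  by (intro group.free_lift_group_hom series_units_group) (auto simp: one_svar_unit)

lemma magnus_fgen: "magnus (fgen j) = 1 + svar j"
  unfolding magnus_def
  by (rule group.free_lift_fgen[OF series_units_group]) (rule one_svar_unit)

lemma magnus_mult:
  "u \<in> carrier (free_group X) \<Longrightarrow> v \<in> carrier (free_group X) \<Longrightarrow>
    magnus (u \<otimes>\<^bsub>free_group X\<^esub> v) = magnus u * magnus v"
  using group_hom.hom_mult[OF magnus_group_hom] by simp

lemma magnus_one: "magnus \<one>\<^bsub>free_group X\<^esub> = 1"
  using group_hom.hom_one[OF magnus_group_hom] by simp

lemma magnus_inv:
  assumes "v \<in> carrier (free_group X)"
  shows "magnus v * magnus (inv\<^bsub>free_group X\<^esub> v) = 1" "magnus (inv\<^bsub>free_group X\<^esub> v) * magnus v = 1"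
proof -
  interpret group "free_group X" by (rule free_group_is_group)
  show "magnus v * magnus (inv\<^bsub>free_group X\<^esub> v) = 1" "magnus (inv\<^bsub>free_group X\<^esub> v) * magnus v = 1"
    using assms by (simp_all add: magnus_mult[of _ X, symmetric] magnus_one)
qed

lemma scoeff_magnus_Nil:
  assumes "v \<in> carrier (free_group X)"
  shows "scoeff (magnus v) [] = 1"
proof -
  interpret group "free_group X" by (rule free_group_is_group)
  have gen: "scoeff (magnus (fgen x)) [] = 1" for x by (simp add: magnus_fgen svar_def)
  have gen': "scoeff (magnus (inv\<^bsub>free_group X\<^esub> (fgen x))) [] = 1" if "x \<in> X" for x
    using magnus_inv(1)[OF fgen_carrier[OF that]] gen[of x] scoeff_mult_Nil
    by (metis mult_1 scoeff_simps(2))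
  show ?thesis using assms
    by (induction rule: free_group_induct)
      (simp_all add: gen gen' magnus_one magnus_mult[of _ X] fgen_carrier[of _ X] scoeff_mult_Nil)
qed

definition vanishes_below :: "nat \<Rightarrow> series \<Rightarrow> bool" where
  "vanishes_below k f \<longleftrightarrow> (\<forall>u. length u < k \<longrightarrow> scoeff f u = 0)"

lemma vanishes_below_add: "vanishes_below k f \<Longrightarrow> vanishes_below k g \<Longrightarrow> vanishes_below k (f + g)"
  and vanishes_below_diff: "vanishes_below k f \<Longrightarrow> vanishes_below k g \<Longrightarrow> vanishes_below k (f - g)"
  and vanishes_below_minus: "vanishes_below k f \<Longrightarrow> vanishes_below k (- f)"
  and vanishes_below_zero: "vanishes_below k 0"
  and vanishes_below_0: "vanishes_below 0 f"
  by (simp_all add: vanishes_below_def)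

lemma vanishes_below_mono: "vanishes_below k f \<Longrightarrow> j \<le> k \<Longrightarrow> vanishes_below j f"
  by (simp add: vanishes_below_def)

lemma vanishes_below_mult:
  assumes "vanishes_below a f" "vanishes_below b g"
  shows "vanishes_below (a + b) (f * g)"
  unfolding vanishes_below_def scoeff_mult_sum
proof (intro allI impI sum.neutral ballI)
  fix u :: "nat list" and i assume "length u < a + b" "i \<in> {..length u}"
  then have "length (take i u) < a \<or> length (drop i u) < b" by auto
  then show "scoeff f (take i u) * scoeff g (drop i u) = 0"
    using assms unfolding vanishes_below_def by auto
qed

lemma vanishes_below_mult_left: "vanishes_below k g \<Longrightarrow> vanishes_below k (f * g)"
  using vanishes_below_mult[OF vanishes_below_0] by simp

lemma vanishes_below_mult_right: "vanishes_below k f \<Longrightarrow> vanishes_below k (f * g)"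
  using vanishes_below_mult[OF _ vanishes_below_0] by simp

text \<open>Since ab - ba = (a-1)(b-1) - (b-1)(a-1), the series of a commutator minus 1 starts no
  earlier than the sum of the degrees in which its two entries start.\<close>

lemma magnus_comm_elt:
  assumes "x \<in> carrier (free_group X)" "y \<in> carrier (free_group X)"
  shows "magnus (comm_elt (free_group X) x y) - 1 =
    ((magnus x - 1) * (magnus y - 1) - (magnus y - 1) * (magnus x - 1)) *
      magnus (inv\<^bsub>free_group X\<^esub> x) * magnus (inv\<^bsub>free_group X\<^esub> y)"
proof -
  interpret group "free_group X" by (rule free_group_is_group)
  let ?a = "magnus x" and ?b = "magnus y"
    and ?a' = "magnus (inv\<^bsub>free_group X\<^esub> x)" and ?b' = "magnus (inv\<^bsub>free_group X\<^esub> y)"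
  have "(?a - 1) * (?b - 1) - (?b - 1) * (?a - 1) = ?a * ?b - ?b * ?a"
    by (simp add: algebra_simps)
  moreover have "?b * ?a * ?a' * ?b' = ?b * (?a * ?a') * ?b'" by (simp add: mult.assoc)
  then have "?b * ?a * ?a' * ?b' = 1" using assms by (simp add: magnus_inv)
  ultimately show ?thesis
    using assms by (simp add: magnus_mult[of _ X] left_diff_distrib)
qed

lemma magnus_vanishes_subgroup:
  "subgroup {v \<in> carrier (free_group X). vanishes_below k (magnus v - 1)} (free_group X)" (is "subgroup ?S _")
proof -
  interpret group "free_group X" by (rule free_group_is_group)
  show ?thesis
  proof (rule subgroupI)
    show "?S \<noteq> {}"
      using one_closed by (auto simp: magnus_one vanishes_below_zero intro!: exI[of _ "\<one>\<^bsub>free_group X\<^esub>"])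
  next
    fix v assume "v \<in> ?S"
    then have v: "v \<in> carrier (free_group X)" "vanishes_below k (magnus v - 1)" by auto
    have "magnus (inv\<^bsub>free_group X\<^esub> v) - 1 = - ((magnus v - 1) * magnus (inv\<^bsub>free_group X\<^esub> v))"
      using magnus_inv[OF v(1)] by (simp add: algebra_simps)
    then show "inv\<^bsub>free_group X\<^esub> v \<in> ?S"
      using v by (simp add: vanishes_below_minus vanishes_below_mult_right)
    fix w assume "w \<in> ?S"
    then have w: "w \<in> carrier (free_group X)" "vanishes_below k (magnus w - 1)" by auto
    have "magnus v * magnus w - 1 = (magnus v - 1) * magnus w + (magnus w - 1)"
      by (simp add: algebra_simps)
    then show "v \<otimes>\<^bsub>free_group X\<^esub> w \<in> ?S"
      using v w vanishes_below_add[OF vanishes_below_mult_right[OF v(2)] w(2)]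
      by (simp only: magnus_mult[of _ X] mem_Collect_eq m_closed)
  qed auto
qed

lemma magnus_vanishes_one:
  "v \<in> carrier (free_group X) \<Longrightarrow> vanishes_below 1 (magnus v - 1)"
  by (simp add: vanishes_below_def scoeff_magnus_Nil[of v X])

lemma magnus_lcs:
  assumes "k \<ge> 1" "v \<in> lcs (free_group X) k"
  shows "vanishes_below k (magnus v - 1)"
  using assms
proof (induction k arbitrary: v rule: nat_induct_at_least)
  case base
  then show ?case using magnus_vanishes_one by simp
next
  case (Suc k)
  interpret group "free_group X" by (rule free_group_is_group)
  have "vanishes_below (Suc k) (magnus (comm_elt (free_group X) x y) - 1)"
    if x: "x \<in> lcs (free_group X) k" and y: "y \<in> carrier (free_group X)" for x y
  proof -
    have "vanishes_below (k + 1) ((magnus x - 1) * (magnus y - 1))"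
      "vanishes_below (1 + k) ((magnus y - 1) * (magnus x - 1))"
      using vanishes_below_mult[OF Suc.IH[OF x] magnus_vanishes_one[OF y]]
        vanishes_below_mult[OF magnus_vanishes_one[OF y] Suc.IH[OF x]] by simp_all
    then show ?thesis
      unfolding magnus_comm_elt[OF lcs_carrier[OF x] y]
      by (auto intro!: vanishes_below_mult_right vanishes_below_diff)
  qed
  then have "lcs (free_group X) (Suc k) \<subseteq> {v \<in> carrier (free_group X). vanishes_below (Suc k) (magnus v - 1)}"
    unfolding lcs_Suc[OF Suc.hyps] commutator_subgroup_def
    by (intro generate_subgroup_incl magnus_vanishes_subgroup) (auto simp: lcs_carrier)
  then show ?case using Suc.prems by auto
qed

section \<open>Leading words\<close>

fun val :: "nat \<Rightarrow> nat list \<Rightarrow> nat" where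
  "val B [] = 0"
| "val B (a # u) = a * B ^ length u + val B u"

lemma val_append: "val B (u @ v) = val B u * B ^ length v + val B v"
  by (induction u) (simp_all add: algebra_simps power_add)

lemma val_less: "set u \<subseteq> {..<B} \<Longrightarrow> val B u < B ^ length u"
proof (induction u)
  case (Cons a u)
  then have "a * B ^ length u + val B u < (a + 1) * B ^ length u" by simp
  also have "\<dots> \<le> B * B ^ length u" using Cons.prems by (intro mult_right_mono) auto
  finally show ?case by simp
qed simp

lemma val_inj:
  assumes "length u = length v" "set u \<subseteq> {..<B}" "set v \<subseteq> {..<B}" "val B u = val B v"
  shows "u = v"
  using assms
proof (induction u v rule: list_induct2)
  case (Cons a u b v)
  have u: "val B u < B ^ length u" and v: "val B v < B ^ length u"
    using Cons val_less[of u B] val_less[of v B] by auto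
  have eq: "a * B ^ length u + val B u = b * B ^ length u + val B v" using Cons by simp
  have B: "B ^ length u > 0" using u by linarith
  have "a = (a * B ^ length u + val B u) div B ^ length u" using u B by (simp add: div_add1_eq)
  also have "\<dots> = b" unfolding eq using v B by (simp add: div_add1_eq)
  finally show ?case using Cons eq by simp
qed simp

text \<open>Series are compared by their lowest term, where among the words of the same length the one
  with the largest value in base \<open>B\<close> comes first.\<close>

definition lead :: "nat \<Rightarrow> series \<Rightarrow> nat list \<Rightarrow> int \<Rightarrow> bool" where
  "lead B f l c \<longleftrightarrow> scoeff f l = c \<and> vanishes_below (length l) f \<and>
     (\<forall>u. length u = length l \<longrightarrow> u \<noteq> l \<longrightarrow> val B l \<le> val B u \<longrightarrow> scoeff f u = 0)"

definition prec :: "nat \<Rightarrow> nat list \<Rightarrow> nat list \<Rightarrow> bool" where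
  "prec B l m \<longleftrightarrow> length l < length m \<or> length l = length m \<and> val B m < val B l"

lemma lead_one: "scoeff f [] = c \<Longrightarrow> lead B f [] c"
  by (simp add: lead_def vanishes_below_0)

lemma lead_add:
  assumes "lead B f l c" "lead B g m d" "prec B l m"
  shows "lead B (f + g) l c"
  using assms unfolding lead_def prec_def vanishes_below_def by fastforce

lemma lead_add_higher:
  assumes "lead B f l c" "vanishes_below (Suc (length l)) g"
  shows "lead B (f + g) l c"
  using assms unfolding lead_def vanishes_below_def by auto

lemma lead_minus: "lead B f l c \<Longrightarrow> lead B (- f) l (- c)"
  unfolding lead_def by (auto simp: vanishes_below_minus)

text \<open>In degree |l| + |m| only the cut after |l| letters contributes, and for halves of fixed
  lengths the value in base \<open>B\<close> is strictly monotone in each half.\<close>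

lemma lead_mult:
  assumes f: "lead B f l c" and g: "lead B g m d" and B: "B > 0"
  shows "lead B (f * g) (l @ m) (c * d)"
proof -
  have vf: "vanishes_below (length l) f" and vg: "vanishes_below (length m) g"
    using f g by (auto simp: lead_def)
  have coeff: "scoeff (f * g) u = scoeff f (take (length l) u) * scoeff g (drop (length l) u)"
    if u: "length u = length l + length m" for u
  proof -
    have "scoeff f (take i u) * scoeff g (drop i u) = 0" if "i \<le> length u" "i \<noteq> length l" for i
    proof -
      have "length (take i u) < length l \<or> length (drop i u) < length m" using that u by auto
      then show ?thesis using vf vg unfolding vanishes_below_def by auto
    qed
    then have "(\<Sum>i\<le>length u. scoeff f (take i u) * scoeff g (drop i u)) =
        (\<Sum>i\<in>{length l}. scoeff f (take i u) * scoeff g (drop i u))"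
      using u by (intro sum.mono_neutral_right) auto
    then show ?thesis by (simp add: scoeff_mult_sum)
  qed
  have "scoeff (f * g) u = 0"
    if u: "length u = length l + length m" "u \<noteq> l @ m" "val B (l @ m) \<le> val B u" for u
  proof (rule ccontr)
    assume nz: "scoeff (f * g) u \<noteq> 0"
    define u1 u2 where "u1 = take (length l) u" and "u2 = drop (length l) u"
    have u12: "u = u1 @ u2" "length u1 = length l" "length u2 = length m"
      using u by (auto simp: u1_def u2_def)
    have "scoeff f u1 \<noteq> 0" "scoeff g u2 \<noteq> 0"
      using nz coeff[OF u(1)] by (auto simp: u1_def u2_def)
    then have 1: "u1 = l \<or> val B u1 < val B l" and 2: "u2 = m \<or> val B u2 < val B m"
      using f g u12 unfolding lead_def by (metis not_le)+
    have "val B u < val B (l @ m)"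
    proof (cases "u1 = l")
      case True
      then show ?thesis using u(2) u12 2 by (auto simp: val_append)
    next
      case False
      then have "val B u1 * B ^ length m < val B l * B ^ length m" using 1 B by simp
      moreover have "val B u2 \<le> val B m" using 2 by auto
      ultimately have "val B u1 * B ^ length m + val B u2 < val B l * B ^ length m + val B m"
        by (rule add_less_le_mono)
      then show ?thesis using u12 by (simp add: val_append)
    qed
    then show False using u(3) by simp
  qed
  moreover have "vanishes_below (length (l @ m)) (f * g)"
    using vanishes_below_mult[OF vf vg] by simp
  moreover have "scoeff (f * g) (l @ m) = c * d" using coeff[of "l @ m"] f g by (simp add: lead_def)
  ultimately show ?thesis by (auto simp: lead_def)
qed

lemma lead_mult_unit:
  assumes "lead B f l c" "scoeff g [] = 1" "B > 0"
  shows "lead B (f * g) l c" "lead B (g * f) l c"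
  using lead_mult[OF assms(1) lead_one[OF assms(2)]] lead_mult[OF lead_one[OF assms(2)] assms(1)] assms(3)
  by simp_all

text \<open>The binomial expansion to first order. A negative power is treated as the inverse of a
  positive one: p q = 1 expresses the error of q by that of p and by products of higher
  degree.\<close>

lemma magnus_int_pow:
  assumes x: "x \<in> carrier (free_group X)" and d: "d \<ge> 1" and v: "vanishes_below d (magnus x - 1)"
  shows "vanishes_below (Suc d) (magnus (x [^]\<^bsub>free_group X\<^esub> (k :: int)) - 1 - of_int k * (magnus x - 1))"
proof -
  interpret group "free_group X" by (rule free_group_is_group)
  have nat: "vanishes_below (Suc d) (magnus (x [^]\<^bsub>free_group X\<^esub> n) - 1 - of_nat n * (magnus x - 1))" for n :: nat
  proof (induction n)
    case 0 then show ?case by (simp add: magnus_one vanishes_below_zero)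
  next
    case (Suc n)
    let ?p = "x [^]\<^bsub>free_group X\<^esub> n"
    have "magnus (x [^]\<^bsub>free_group X\<^esub> Suc n) - 1 - of_nat (Suc n) * (magnus x - 1) =
        (magnus ?p - 1 - of_nat n * (magnus x - 1)) + (magnus ?p - 1) * (magnus x - 1)"
      using x by (simp add: magnus_mult[of _ X] algebra_simps)
    moreover have "vanishes_below (1 + d) ((magnus ?p - 1) * (magnus x - 1))"
      using x v by (intro vanishes_below_mult magnus_vanishes_one) auto
    ultimately show ?case using vanishes_below_add[OF Suc] by (metis plus_1_eq_Suc)
  qed
  show ?thesis
  proof (cases k)
    case (nonneg n) then show ?thesis using nat[of n] by (simp add: int_pow_int)
  next
    case (neg n)
    let ?m = "Suc n"
    let ?p = "x [^]\<^bsub>free_group X\<^esub> ?m" and ?a = "magnus x - 1"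
    let ?q = "inv\<^bsub>free_group X\<^esub> ?p"
    have xk: "x [^]\<^bsub>free_group X\<^esub> k = ?q" using neg x by (metis int_pow_neg_int)
    have p: "?p \<in> carrier (free_group X)" using x by blast
    have "magnus ?p * magnus ?q = 1" using magnus_inv(1)[OF p] .
    then have "magnus ?q - 1 + of_nat ?m * ?a =
        - (magnus ?p - 1 - of_nat ?m * ?a) * magnus ?q - of_nat ?m * (?a * (magnus ?q - 1))"
      by (simp add: algebra_simps del: of_nat_Suc)
    moreover have "vanishes_below (Suc d) (- (magnus ?p - 1 - of_nat ?m * ?a) * magnus ?q)"
      using nat[of ?m] by (intro vanishes_below_mult_right vanishes_below_minus)
    moreover have "vanishes_below (d + 1) (?a * (magnus ?q - 1))"
      using p v by (intro vanishes_below_mult magnus_vanishes_one[of _ X]) auto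
    ultimately have "vanishes_below (Suc d) (magnus ?q - 1 + of_nat ?m * ?a)"
      by (simp add: vanishes_below_diff vanishes_below_mult_left del: of_nat_Suc)
    moreover have "- (of_int k :: series) = of_nat ?m" using neg by simp
    then have "- (of_int k * ?a) = of_nat ?m * ?a" by (metis minus_mult_left)
    ultimately show ?thesis unfolding xk by (metis diff_conv_add_uminus)
  qed
qed

lemma lead_magnus_int_pow:
  assumes x: "x \<in> carrier (free_group X)" and l: "l \<noteq> []" and v: "lead B (magnus x - 1) l 1"
  shows "lead B (magnus (x [^]\<^bsub>free_group X\<^esub> (k :: int)) - 1) l k"
proof -
  let ?a = "magnus x - 1"
  have va: "vanishes_below (length l) ?a" using v by (simp add: lead_def)
  have scale: "scoeff (of_nat n * f) u = int n * scoeff f u" for n f u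
    by (induction n) (simp_all add: algebra_simps)
  have scale': "scoeff (of_int k * f) u = k * scoeff f u" for f u
    by (cases k) (simp_all add: scale del: of_nat_Suc)
  have "lead B (of_int k * ?a) l k"
    using v unfolding lead_def vanishes_below_def scale' by auto
  moreover have "vanishes_below (Suc (length l))
      (magnus (x [^]\<^bsub>free_group X\<^esub> k) - 1 - of_int k * ?a)"
    using magnus_int_pow[OF x _ va] l by (cases l) auto
  ultimately show ?thesis using lead_add_higher by fastforce
qed

section \<open>Codes\<close>

text \<open>A code in the sense of free monoids: \<open>W\<close> is a free generating set of
  \<open>word_monoid W\<close>.\<close>

definition word_code :: "'a list set \<Rightarrow> bool" where
  "word_code W \<longleftrightarrow> (\<forall>us\<in>lists W. \<forall>vs\<in>lists W. concat us = concat vs \<longrightarrow> us = vs)"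

abbreviation word_monoid :: "'a list set \<Rightarrow> 'a list set" where
  "word_monoid W \<equiv> concat ` lists W"

abbreviation word_power :: "'a list \<Rightarrow> nat \<Rightarrow> 'a list" where
  "word_power x i \<equiv> concat (replicate i x)"

lemma word_codeD:
  "word_code W \<Longrightarrow> us \<in> lists W \<Longrightarrow> vs \<in> lists W \<Longrightarrow> concat us = concat vs \<Longrightarrow> us = vs"
  unfolding word_code_def by blast

text \<open>The words y x^i are the leading words of the iterated commutators [y,x,...,x]. The bound
  keeps the set finite; longer words belong to commutators in Gamma_(n+1).\<close>

definition eliminated :: "nat \<Rightarrow> 'a list \<Rightarrow> 'a list set \<Rightarrow> 'a list set" where
  "eliminated n x W = {y @ word_power x i |y i. y \<in> W - {x} \<and> length y + i * length x \<le> n}"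

lemma length_word_power: "length (word_power x i) = i * length x"
  by (simp add: length_concat sum_list_replicate)

lemma word_code_elim_inj:
  assumes "word_code W" "x \<in> W" "y \<in> W - {x}" "y' \<in> W - {x}"
    and "y @ word_power x i = y' @ word_power x i'"
  shows "y = y' \<and> i = i'"
proof -
  have "y # replicate i x = y' # replicate i' x"
    using assms by (intro word_codeD[OF assms(1)]) auto
  then show ?thesis by (metis length_replicate list.inject)
qed

lemma replicate_append_eq:
  assumes "replicate i x @ R = replicate j x @ S" "R = [] \<or> hd R \<noteq> x" "S = [] \<or> hd S \<noteq> x"
  shows "i = j \<and> R = S"
  using assms
proof (induction i arbitrary: j)
  case 0 then show ?case by (cases j) auto
next
  case (Suc i) then show ?case by (cases j) auto
qed

text \<open>A product of words y x^i splits back uniquely over \<open>W\<close>: a new block begins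
  at each factor other than x, and the run of x after it gives i. A nonempty product therefore
  begins with a factor other than x, and so is never x itself.\<close>

lemma eliminated_code:
  assumes code: "word_code W" and x: "x \<in> W"
  shows "word_code (eliminated n x W)" "x \<notin> word_monoid (eliminated n x W)"
    "word_monoid (eliminated n x W) \<subseteq> word_monoid W"
proof -
  let ?W' = "eliminated n x W"
  have "\<forall>l\<in>?W'. \<exists>yi. fst yi \<in> W - {x} \<and> l = fst yi @ word_power x (snd yi)"
    by (auto simp: eliminated_def)
  then obtain e where e: "\<And>l. l \<in> ?W' \<Longrightarrow> fst (e l) \<in> W - {x} \<and> l = fst (e l) @ word_power x (snd (e l))"
    by (metis bchoice)
  \<comment> \<open>The factorisation of \<open>l\<close> over \<open>W\<close>: the head y, then i
    copies of x.\<close>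
  define E where "E l = fst (e l) # replicate (snd (e l)) x" for l
  have concat_E: "concat (E l) = l" if "l \<in> ?W'" for l using e[OF that] by (simp add: E_def)
  have E_lists: "E l \<in> lists W" if "l \<in> ?W'" for l using e[OF that] x by (auto simp: E_def)
  have EE: "concat (map E us) \<in> lists W \<and> concat (concat (map E us)) = concat us"
    if "us \<in> lists ?W'" for us
    using that by induction (use concat_E E_lists in auto)
  have hd_E: "concat (map E us) = [] \<or> hd (concat (map E us)) \<noteq> x" if "us \<in> lists ?W'" for us
    using that e by cases (auto simp: E_def)
  have E_inj: "us = vs" if "us \<in> lists ?W'" "vs \<in> lists ?W'" "concat (map E us) = concat (map E vs)" for us vs
    using that
  proof (induction us arbitrary: vs)
    case Nil then show ?case by (cases vs) (auto simp: E_def)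
  next
    case (Cons l us)
    then obtain l' vs' where vs: "vs = l' # vs'" by (cases vs) (auto simp: E_def)
    have 1: "fst (e l) = fst (e l')" and 2:
      "replicate (snd (e l)) x @ concat (map E us) = replicate (snd (e l')) x @ concat (map E vs')"
      using Cons.prems(2) by (simp_all add: E_def[of l] E_def[of l'] vs)
    have vs': "l' \<in> ?W'" "vs' \<in> lists ?W'" using Cons.prems(1) vs by simp_all
    have 3: "snd (e l) = snd (e l') \<and> concat (map E us) = concat (map E vs')"
      using 2 by (rule replicate_append_eq) (intro hd_E Cons.hyps vs')+
    then have "us = vs'" using vs'(2) by (intro Cons.IH) simp_all
    have "E l = E l'" using 1 3 unfolding E_def by simp
    then have "l = l'" using concat_E[OF vs'(1)] concat_E[OF Cons.hyps(1)] by simp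
    then show ?case using \<open>us = vs'\<close> vs by simp
  qed
  show "word_code ?W'"
    unfolding word_code_def
  proof (intro ballI impI)
    fix us vs assume uv: "us \<in> lists ?W'" "vs \<in> lists ?W'" "concat us = concat vs"
    have "concat (map E us) = concat (map E vs)"
      using EE[OF uv(1)] EE[OF uv(2)] uv(3) by (intro word_codeD[OF code]) simp_all
    then show "us = vs" using E_inj uv by blast
  qed
  show "word_monoid ?W' \<subseteq> word_monoid W"
  proof
    fix u assume "u \<in> word_monoid ?W'"
    then obtain us where "us \<in> lists ?W'" "u = concat us" by blast
    then show "u \<in> word_monoid W"
      using EE[of us] by (intro image_eqI[of _ _ "concat (map E us)"]) simp_all
  qed
  show "x \<notin> word_monoid ?W'"
  proof
    assume "x \<in> word_monoid ?W'"
    then obtain us where us: "us \<in> lists ?W'" "x = concat us" by auto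
    have 1: "concat (map E us) \<in> lists W" and 2: "concat (concat (map E us)) = concat [x]"
      using EE[OF us(1)] us(2) by simp_all
    have 3: "concat (map E us) = [x]"
      by (rule word_codeD[OF code 1 _ 2]) (use x in simp)
    show False using hd_E[OF us(1)] unfolding 3 by simp
  qed
qed

text \<open>For words \<open>u, v\<close> the condition \<open>uv < vu\<close> compares the periodic expansions of \<open>u\<close> and \<open>v\<close> in
  base \<open>B\<close>, that is the fractions \<open>val u / (B ^ |u| - 1)\<close>.\<close>

lemma ex_val_minimal:
  assumes fin: "finite W" and ne: "W \<noteq> {}" and code: "word_code W"
    and W: "\<And>l. l \<in> W \<Longrightarrow> l \<noteq> [] \<and> set l \<subseteq> {..<B}" and B: "B \<ge> 2"
  shows "\<exists>x\<in>W. \<forall>y\<in>W - {x}. val B (x @ y) < val B (y @ x)"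
proof -
  define \<rho> where "\<rho> l = real (val B l) / (real B ^ length l - 1)" for l
  obtain x where x: "x \<in> W" "\<And>y. y \<in> W \<Longrightarrow> \<rho> x \<le> \<rho> y"
    using ex_min_if_finite[of "\<rho> ` W"] fin ne by (force simp: not_less)
  have "val B (x @ y) < val B (y @ x)" if y: "y \<in> W - {x}" for y
  proof -
    have pos: "real B ^ length l - 1 > 0" if "l \<in> W" for l
      using W[OF that] B by simp
    \<comment> \<open>This is the comparison of the fractions \<open>\<rho>\<close>,
      cross-multiplied. Rearranged it reads val x B^|y| + val y \<le> val y B^|x| + val x, which
      compares the two concatenations.\<close>
    have "real (val B x) * (real B ^ length y - 1) \<le> real (val B y) * (real B ^ length x - 1)"
      using x(2)[of y] y pos[of x] pos[of y] x(1) by (simp add: \<rho>_def field_simps)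
    then have "real (val B (x @ y)) \<le> real (val B (y @ x))"
      by (simp add: val_append algebra_simps)
    \<comment> \<open>Equal values would force xy = yx, giving one word two factorisations over a
      code.\<close>
    moreover have "val B (x @ y) \<noteq> val B (y @ x)"
    proof
      assume "val B (x @ y) = val B (y @ x)"
      then have "x @ y = y @ x" using W[of x] W[of y] x(1) y by (intro val_inj) auto
      then have *: "concat [x, y] = concat [y, x]" by (simp only: concat.simps append_Nil2)
      have "[x, y] = [y, x]" by (rule word_codeD[OF code _ _ *]) (use x(1) y in simp_all)
      then have "hd [x, y] = hd [y, x]" by (rule arg_cong)
      then show False using y by simp
    qed
    ultimately show ?thesis by simp
  qed
  then show ?thesis using x(1) by blast
qed

section \<open>Magnus' theorem\<close>

context group
begin

text \<open>The inverses give [c,x] = c^-1 x^-1 c x, the convention in which x^-1 c x = c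
  [c,x].\<close>

fun comm_iter :: "'a \<Rightarrow> 'a \<Rightarrow> nat \<Rightarrow> 'a" where
  "comm_iter y x 0 = y"
| "comm_iter y x (Suc i) = comm_elt G (inv (comm_iter y x i)) (inv x)"

lemma comm_iter_closed:
  "y \<in> carrier G \<Longrightarrow> x \<in> carrier G \<Longrightarrow> comm_iter y x i \<in> carrier G"
  by (induction i) (auto intro: comm_elt_closed)

lemma comm_iter_lcs:
  assumes "y \<in> lcs G a" "x \<in> lcs G b" "a \<ge> 1" "b \<ge> 1"
  shows "comm_iter y x i \<in> lcs G (a + i * b)"
proof (induction i)
  case (Suc i)
  have "comm_elt G (inv (comm_iter y x i)) (inv x) \<in> lcs G ((a + i * b) + b)"
    using assms Suc by (intro lcs_comm_elt lcs_closed) auto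
  then show ?case by (simp add: algebra_simps)
qed (use assms in simp)

lemma comm_iter_conj:
  assumes "y \<in> carrier G" "x \<in> carrier G"
  shows "inv x \<otimes> comm_iter y x i \<otimes> x = comm_iter y x i \<otimes> comm_iter y x (Suc i)"
  using assms comm_iter_closed[of y x i] by (simp add: word_simps)

text \<open>Both conjugations are demanded because for infinite subgroups g N g^-1 \<subseteq> N
  does not imply equality.\<close>

lemma normalizer_subgroup:
  assumes "subgroup N G"
  shows "subgroup {g \<in> carrier G. \<forall>t\<in>N. g \<otimes> t \<otimes> inv g \<in> N \<and> inv g \<otimes> t \<otimes> g \<in> N} G" (is "subgroup ?S G")
proof (rule subgroupI)
  have N: "t \<in> carrier G" if "t \<in> N" for t using that assms by (auto dest: subgroup.subset)
  show "?S \<noteq> {}"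
    using N by (auto intro!: exI[of _ \<one>])
  fix g h assume g: "g \<in> ?S"
    and h: "h \<in> ?S"
  have "g \<otimes> h \<otimes> t \<otimes> inv (g \<otimes> h) = g \<otimes> (h \<otimes> t \<otimes> inv h) \<otimes> inv g"
    "inv (g \<otimes> h) \<otimes> t \<otimes> (g \<otimes> h) = inv h \<otimes> (inv g \<otimes> t \<otimes> g) \<otimes> h" if "t \<in> N" for t
    using g h N[OF that] by (auto simp: word_simps)
  then show "g \<otimes> h \<in> ?S"
    using g h by simp
qed auto

lemma conj_vimage_subgroup:
  assumes "subgroup N G" "x \<in> carrier G"
  shows "subgroup {t \<in> carrier G. x \<otimes> t \<otimes> inv x \<in> N \<and> inv x \<otimes> t \<otimes> x \<in> N} G" (is "subgroup ?S G")
proof (rule subgroupI)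
  show "?S \<noteq> {}"
    using assms by (auto intro!: exI[of _ \<one>] simp: subgroup.one_closed)
  fix t u assume t: "t \<in> ?S"
  have "x \<otimes> inv t \<otimes> inv x = inv (x \<otimes> t \<otimes> inv x)" "inv x \<otimes> inv t \<otimes> x = inv (inv x \<otimes> t \<otimes> x)"
    using t assms(2) by (auto simp: word_simps)
  then show "inv t \<in> ?S"
    using t subgroup.m_inv_closed[OF assms(1)] by simp
  assume u: "u \<in> ?S"
  have "x \<otimes> (t \<otimes> u) \<otimes> inv x = (x \<otimes> t \<otimes> inv x) \<otimes> (x \<otimes> u \<otimes> inv x)"
    "inv x \<otimes> (t \<otimes> u) \<otimes> x = (inv x \<otimes> t \<otimes> x) \<otimes> (inv x \<otimes> u \<otimes> x)"
    using t u assms(2) by (auto simp: word_simps)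
  then show "t \<otimes> u \<in> ?S"
    using t u subgroup.m_closed[OF assms(1)] by simp
qed auto

lemma int_pow_times_subgroup:
  assumes N: "subgroup N G" and x: "x \<in> carrier G"
    and norm: "\<And>t. t \<in> N \<Longrightarrow> x \<otimes> t \<otimes> inv x \<in> N \<and> inv x \<otimes> t \<otimes> x \<in> N"
  shows "subgroup {x [^] (k :: int) \<otimes> t |k t. t \<in> N} G" (is "subgroup ?S G")
proof (rule subgroupI)
  have NG: "t \<in> carrier G" if "t \<in> N" for t using that N by (auto dest: subgroup.subset)
  have conj: "inv (x [^] k) \<otimes> t \<otimes> x [^] k \<in> N" "x [^] k \<otimes> t \<otimes> inv (x [^] k) \<in> N" if "t \<in> N" for t and k :: int
    using subgroup_int_pow_closed[OF normalizer_subgroup[OF N], of x k] x norm that by auto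
  show "?S \<subseteq> carrier G" using x NG by auto
  show "?S \<noteq> {}" using subgroup.one_closed[OF N] by auto
  fix a assume "a \<in> ?S"
  then obtain k :: int and t where a: "a = x [^] k \<otimes> t" "t \<in> N" by auto
  have "inv a = x [^] (- k) \<otimes> (x [^] k \<otimes> inv t \<otimes> inv (x [^] k))"
    using a x NG by (simp add: word_simps int_pow_neg)
  moreover have "x [^] k \<otimes> inv t \<otimes> inv (x [^] k) \<in> N"
    using a by (intro conj subgroup.m_inv_closed[OF N])
  ultimately show "inv a \<in> ?S" by blast
  fix b assume "b \<in> ?S"
  then obtain l :: int and u where b: "b = x [^] l \<otimes> u" "u \<in> N" by auto
  have "a \<otimes> b = x [^] (k + l) \<otimes> ((inv (x [^] l) \<otimes> t \<otimes> x [^] l) \<otimes> u)"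
    using a b x NG by (simp add: word_simps int_pow_mult)
  moreover have "(inv (x [^] l) \<otimes> t \<otimes> x [^] l) \<otimes> u \<in> N"
    using a b by (intro subgroup.m_closed[OF N] conj)
  ultimately show "a \<otimes> b \<in> ?S" by blast
qed

text \<open>That \<open>x\<close> normalises the subgroup generated by the iterated commutators is clear for conjugation by
  \<open>inv x\<close>; for conjugation by \<open>x\<close> it follows by descending induction from nilpotency modulo \<open>N\<close>.\<close>

lemma elimination:
  assumes N: "N \<lhd> G" and x: "x \<in> carrier G" and Y: "Y \<subseteq> carrier G"
    and nil: "\<And>y i. y \<in> Y \<Longrightarrow> i \<ge> n \<Longrightarrow> comm_iter y x i \<in> N"
    and H': "subgroup H' G" "N \<subseteq> H'" and iter: "\<And>y i. y \<in> Y \<Longrightarrow> comm_iter y x i \<in> H'"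
    and gen: "H' \<subseteq> generate G ({comm_iter y x i |y i. y \<in> Y} \<union> N)"
    and h: "h \<in> generate G (insert x Y \<union> N)"
  shows "\<exists>(k :: int) t. t \<in> H' \<and> h = x [^] k \<otimes> t"
proof -
  have NG: "N \<subseteq> carrier G" using N by (simp add: normal_imp_subgroup subgroup.subset)
  have it: "comm_iter y x i \<in> carrier G" if "y \<in> Y" for y i
    using that x Y by (intro comm_iter_closed) auto
  have up: "x \<otimes> comm_iter y x (n - j) \<otimes> inv x \<in> H'" if y: "y \<in> Y" for y j
  proof (induction j)
    case 0
    then show ?case using nil[OF y, of n] normal_conj(1)[OF N x] H'(2) by auto
  next
    case (Suc j)
    show ?case
    proof (cases "j < n")
      case False then show ?thesis using Suc by simp
    next
      case True
      let ?a = "comm_iter y x (n - Suc j)" and ?b = "comm_iter y x (n - j)"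
      have ba: "inv x \<otimes> ?a \<otimes> x = ?a \<otimes> ?b"
        using comm_iter_conj[of y x "n - Suc j"] y Y x True by (auto simp: Suc_diff_Suc)
      \<comment> \<open>Conjugating x^-1 a x = a b by x expresses x a x^-1 through a and x b x^-1,
        and the latter is known since b is the next commutator.\<close>
      have "?a = x \<otimes> (inv x \<otimes> ?a \<otimes> x) \<otimes> inv x" using it[OF y] x by (simp add: word_simps)
      then have "?a = (x \<otimes> ?a \<otimes> inv x) \<otimes> (x \<otimes> ?b \<otimes> inv x)"
        unfolding ba using it[OF y] x by (simp add: word_simps)
      then have "?a \<otimes> inv (x \<otimes> ?b \<otimes> inv x) = (x \<otimes> ?a \<otimes> inv x) \<otimes> (x \<otimes> ?b \<otimes> inv x) \<otimes> inv (x \<otimes> ?b \<otimes> inv x)"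
        by simp
      then have "x \<otimes> ?a \<otimes> inv x = ?a \<otimes> inv (x \<otimes> ?b \<otimes> inv x)"
        using it[OF y] x by (simp add: word_simps)
      then show ?thesis
        using Suc iter[OF y] by (simp only: subgroup.m_closed[OF H'(1)] subgroup.m_inv_closed[OF H'(1)])
    qed
  qed
  have up': "x \<otimes> comm_iter y x i \<otimes> inv x \<in> H'" if y: "y \<in> Y" for y i
  proof (cases "i \<le> n")
    case True then show ?thesis using up[OF y, of "n - i"] by simp
  next
    case False
    then show ?thesis using nil[OF y, of i] normal_conj(1)[OF N x] H'(2) by auto
  qed
  have down: "inv x \<otimes> comm_iter y x i \<otimes> x \<in> H'" if y: "y \<in> Y" for y i
    using comm_iter_conj[of y x i] y Y x iter[OF y] subgroup.m_closed[OF H'(1)] by (metis subsetD)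
  let ?T = "{t \<in> carrier G. x \<otimes> t \<otimes> inv x \<in> H' \<and> inv x \<otimes> t \<otimes> x \<in> H'}"
  have "generate G ({comm_iter y x i |y i. y \<in> Y} \<union> N) \<subseteq> ?T"
    using up' down it NG normal_conj[OF N x] H'(2)
    by (intro generate_subgroup_incl conj_vimage_subgroup H'(1) x) blast
  then have norm: "x \<otimes> t \<otimes> inv x \<in> H' \<and> inv x \<otimes> t \<otimes> x \<in> H'" if "t \<in> H'" for t
    using gen that by blast
  let ?S = "{x [^] (k :: int) \<otimes> t |k t. t \<in> H'}"
  have sub: "subgroup ?S G" using int_pow_times_subgroup[OF H'(1) x norm] .
  have "x = x [^] (1 :: int) \<otimes> \<one>" using x by simp
  then have "x \<in> ?S" using subgroup.one_closed[OF H'(1)] by blast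
  moreover have "t \<in> ?S" if "t \<in> H'" for t
  proof -
    have "t = x [^] (0 :: int) \<otimes> t" using that subgroup.subset[OF H'(1)] by auto
    then show ?thesis using that by blast
  qed
  ultimately have "generate G (insert x Y \<union> N) \<subseteq> ?S"
    using iter[of _ 0] H'(2) by (intro generate_subgroup_incl[OF _ sub]) auto
  then show ?thesis using h by blast
qed

end

text \<open>With c the previous commutator, [c,x] - 1 is cx - xc times a series with constant term
  1. The two possible leading words share the suffix m^i; cancelling it reduces their comparison to
  ml against lm, so one hypothesis serves all i and the word ending in m wins with coefficient
  1.\<close>

lemma lead_comm_iter:
  fixes q :: nat
  assumes y: "y \<in> carrier (free_group X)" and x: "x \<in> carrier (free_group X)"
    and ly: "lead B (magnus y - 1) l 1" and lx: "lead B (magnus x - 1) m 1"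
    and lt: "val B (m @ l) < val B (l @ m)" and B: "B > 0"
  shows "lead B (magnus (group.comm_iter (free_group X) y x i) - 1) (l @ word_power m i) 1"
proof (induction i)
  interpret group "free_group X" by (rule free_group_is_group)
  case 0 then show ?case using ly by simp
next
  interpret group "free_group X" by (rule free_group_is_group)
  case (Suc i)
  let ?z = "comm_iter y x i"
  have z: "?z \<in> carrier (free_group X)" using x y by (rule comm_iter_closed[rotated])
  let ?a = "magnus ?z - 1" and ?b = "magnus x - 1" and ?l = "l @ word_power m i"
  have pow: "word_power m i @ m = m @ word_power m i" by (induction i) simp_all
  have 1: "lead B (?a * ?b) (?l @ m) 1" and 2: "lead B (- (?b * ?a)) (m @ ?l) (- 1)"
    using lead_mult[OF Suc lx B] lead_minus[OF lead_mult[OF lx Suc B]] by simp_all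
  have "val B (m @ ?l) < val B (?l @ m)"
    using lt B by (simp add: val_append[of B "m @ l" "word_power m i", simplified]
        val_append[of B "l @ m" "word_power m i", simplified] pow)
  then have "lead B (?a * ?b + - (?b * ?a)) (?l @ m) 1"
    by (intro lead_add[OF 1 2]) (simp add: prec_def)
  then have 3: "lead B (?a * ?b - ?b * ?a) (l @ word_power m (Suc i)) 1"
    by (simp add: pow)
  have "magnus (comm_iter y x (Suc i)) = magnus (inv\<^bsub>free_group X\<^esub> ?z) * magnus (inv\<^bsub>free_group X\<^esub> x) * magnus ?z * magnus x"
    using x z by (simp add: magnus_mult[of _ X])
  moreover have "magnus (inv\<^bsub>free_group X\<^esub> ?z) * magnus (inv\<^bsub>free_group X\<^esub> x) * (magnus x * magnus ?z) = 1"
    using magnus_inv[OF x] magnus_inv[OF z] by (metis mult.assoc mult_1)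
  moreover have "?a * ?b - ?b * ?a = magnus ?z * magnus x - magnus x * magnus ?z"
    by (simp add: algebra_simps)
  ultimately have "magnus (comm_iter y x (Suc i)) - 1 =
      magnus (inv\<^bsub>free_group X\<^esub> ?z) * (magnus (inv\<^bsub>free_group X\<^esub> x) * (?a * ?b - ?b * ?a))"
    by (simp add: right_diff_distrib mult.assoc)
  then show ?case
    using lead_mult_unit(2)[OF lead_mult_unit(2)[OF 3 _ B] _ B] x z
    by (simp add: scoeff_magnus_Nil[of _ X])
qed

lemma finite_bounded_words: "finite {u. set u \<subseteq> {1..q :: nat} \<and> length u \<le> (n :: nat)}"
  by (rule finite_lists_length_le) simp

lemma word_monoid_alphabet:
  assumes "W \<subseteq> lists A" shows "word_monoid W \<subseteq> lists A"
proof (rule image_subsetI)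
  fix us assume "us \<in> lists W"
  then show "concat us \<in> lists A"
    by induction (use assms in \<open>simp_all add: subset_iff\<close>)
qed

text \<open>Lazard elimination: with \<open>x\<close> minimal in the sense of \<open>ex_val_minimal\<close>, passing from \<open>W\<close> to
  \<open>eliminated n x W\<close> replaces the generated subgroup by one that it normalises, while the leading
  words still form a code and \<open>x\<close> is no longer a product of them.\<close>

lemma leading_word_dichotomy:
  fixes q n :: nat and g :: "nat list \<Rightarrow> (nat \<times> bool) list"
  defines "F \<equiv> FG q"
  assumes "finite W" and "word_code W"
    and "\<And>l. l \<in> W \<Longrightarrow> l \<noteq> [] \<and> length l \<le> n \<and> set l \<subseteq> {1..q}"
    and "\<And>l. l \<in> W \<Longrightarrow> g l \<in> lcs F (length l) \<and> lead (Suc q) (magnus (g l) - 1) l 1"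
    and "h \<in> generate F (g ` W \<union> lcs F (Suc n))"
  shows "h \<in> lcs F (Suc n) \<or>
    (\<exists>l c. c \<noteq> 0 \<and> lead (Suc q) (magnus h - 1) l c \<and> length l \<le> n \<and> l \<in> word_monoid W)"
  using assms(2-)
\<comment> \<open>Elimination may enlarge \<open>W\<close>. What shrinks is the set of words of
  length at most n in the generated monoid, because x is lost.\<close>
proof (induction "card {u \<in> word_monoid W. length u \<le> n}" arbitrary: W g h rule: less_induct)
  case less
  interpret F: group F unfolding F_def by (rule free_group_is_group)
  let ?B = "Suc q" and ?\<Gamma> = "lcs F (Suc n)"
  note fin = less.prems(1) and code = less.prems(2) and W = less.prems(3) and g = less.prems(4)
  show ?case
  proof (cases "W = {}")
    case True
    then have "h \<in> ?\<Gamma>"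
      using less.prems(5) F.generate_subgroup_incl[OF subset_refl F.lcs_subgroup] by auto
    then show ?thesis by blast
  next
    case False
    then obtain l0 where l0: "l0 \<in> W" by blast
    then have "hd l0 \<in> {1..q}" using W[OF l0] hd_in_set by blast
    then have q: "q \<ge> 1" by simp
    have alph: "set l \<subseteq> {..<?B}" if "set l \<subseteq> {1..q}" for l using that by fastforce
    have "\<exists>x\<in>W. \<forall>y\<in>W - {x}. val ?B (x @ y) < val ?B (y @ x)"
    proof (rule ex_val_minimal[OF fin False code])
      show "l \<noteq> [] \<and> set l \<subseteq> {..<?B}" if "l \<in> W" for l using W[OF that] alph by blast
      show "2 \<le> ?B" using q by simp
    qed
    then obtain x where x: "x \<in> W" and min: "\<forall>y\<in>W - {x}. val ?B (x @ y) < val ?B (y @ x)"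
      by (elim bexE)
    define W' where "W' = eliminated n x W"
    have W'_code: "word_code W'" "x \<notin> word_monoid W'" "word_monoid W' \<subseteq> word_monoid W"
      unfolding W'_def by (rule eliminated_code[OF code x])+
    \<comment> \<open>Unique factorisation makes y x^i determine the pair (y, i), so the new group
      elements can be indexed by their words.\<close>
    define idx where "idx = (\<lambda>(y, i). y @ word_power x i)"
    have inj: "inj_on idx ((W - {x}) \<times> UNIV)"
    proof (rule inj_onI)
      fix a b assume "a \<in> (W - {x}) \<times> UNIV" "b \<in> (W - {x}) \<times> UNIV" "idx a = idx b"
      then have "fst a = fst b \<and> snd a = snd b"
        using word_code_elim_inj[OF code x, of "fst a" "fst b" "snd a" "snd b"]
        by (simp add: idx_def case_prod_unfold mem_Times_iff)
      then show "a = b" by (simp add: prod_eq_iff)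
    qed
    define g' where "g' l = (let (y, i) = inv_into ((W - {x}) \<times> UNIV) idx l in F.comm_iter (g y) (g x) i)" for l
    have g': "g' (y @ word_power x i) = F.comm_iter (g y) (g x) i" if "y \<in> W - {x}" for y i
      using inv_into_f_f[OF inj, of "(y, i)"] that by (auto simp: g'_def idx_def)
    have gF: "g l \<in> carrier F" if "l \<in> W" for l using g[OF that] F.lcs_carrier by blast
    have iter_lcs: "F.comm_iter (g y) (g x) i \<in> lcs F (length y + i * length x)" if "y \<in> W - {x}" for y i
      using that x W[of y] W[of x] g[of y] g[of x] by (intro F.comm_iter_lcs) (auto simp: Suc_le_eq)
    \<comment> \<open>This accounts for the truncation in \<open>eliminated\<close>: a commutator
      with a longer word lies in Gamma_(n+1) already.\<close>
    have iter_nil: "F.comm_iter (g y) (g x) i \<in> ?\<Gamma>"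
      if y: "y \<in> W - {x}" and "length y + i * length x > n" for y i
      using iter_lcs[OF y, of i] F.lcs_antimono[of "Suc n" "length y + i * length x"] that(2) by auto
    have W'_mem: "\<exists>y i. y \<in> W - {x} \<and> l = y @ word_power x i \<and> length y + i * length x \<le> n" if "l \<in> W'" for l
      using that by (auto simp: W'_def eliminated_def)
    have W': "l \<noteq> [] \<and> length l \<le> n \<and> set l \<subseteq> {1..q}" if "l \<in> W'" for l
    proof -
      obtain y i where y: "y \<in> W - {x}" "l = y @ word_power x i" "length y + i * length x \<le> n"
        using W'_mem[OF \<open>l \<in> W'\<close>] by blast
      have "set (word_power x i) \<subseteq> set x" by (induction i) auto
      then show ?thesis using y W[of y] W[OF x] by (simp add: length_word_power) blast
    qed
    have finW': "finite W'"
      by (rule finite_subset[OF _ finite_bounded_words[of q n]]) (use W' in blast)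
    have g'_W': "g' l \<in> lcs F (length l) \<and> lead ?B (magnus (g' l) - 1) l 1" if "l \<in> W'" for l
    proof -
      obtain y i where y: "y \<in> W - {x}" "l = y @ word_power x i"
        using W'_mem[OF \<open>l \<in> W'\<close>] by blast
      have "lead ?B (magnus (F.comm_iter (g y) (g x) i) - 1) l 1"
        unfolding y(2) F_def using gF[of y] gF[OF x] g[of y] g[OF x] y(1) bspec[OF min y(1)]
        by (intro lead_comm_iter) (simp_all add: F_def)
      then show ?thesis using iter_lcs[OF y(1), of i] g'[OF y(1)] y(2) by (simp add: length_word_power)
    qed
    define H' where "H' = generate F (g' ` W' \<union> ?\<Gamma>)"
    have g'F: "g' ` W' \<subseteq> carrier F" using g'_W' F.lcs_carrier by blast
    have H'sub: "subgroup H' F"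
      unfolding H'_def using g'F F.lcs_subset by (intro F.generate_is_subgroup) auto
    have H'\<Gamma>: "?\<Gamma> \<subseteq> H'" unfolding H'_def by (auto intro: generate.incl)
    have iter_H': "F.comm_iter y (g x) i \<in> H'" if "y \<in> g ` (W - {x})" for y i
    proof -
      obtain z where z: "z \<in> W - {x}" "y = g z" using \<open>y \<in> g ` (W - {x})\<close> by blast
      show ?thesis
      proof (cases "length z + i * length x \<le> n")
        case True
        then have "z @ word_power x i \<in> W'" using z by (auto simp: W'_def eliminated_def)
        then have "g' (z @ word_power x i) \<in> H'" unfolding H'_def by (intro generate.incl) auto
        then show ?thesis using g' z by simp
      next
        case False then show ?thesis using iter_nil[OF z(1), of i] z(2) H'\<Gamma> by auto
      qed
    qed
    have "\<exists>(k :: int) t. t \<in> H' \<and> h = g x [^]\<^bsub>F\<^esub> k \<otimes>\<^bsub>F\<^esub> t"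
    proof (rule F.elimination[where Y = "g ` (W - {x})" and n = n and N = ?\<Gamma>])
      show "F.comm_iter y (g x) i \<in> ?\<Gamma>" if "y \<in> g ` (W - {x})" "n \<le> i" for y i
      proof -
        obtain z where z: "z \<in> W - {x}" "y = g z" using \<open>y \<in> g ` (W - {x})\<close> by blast
        have "length z \<ge> 1" using W[of z] z by (cases z) auto
        moreover have "length x \<ge> 1" using W[OF x] by (cases x) auto
        then have "i * 1 \<le> i * length x" by (rule mult_le_mono2)
        ultimately have "length z + i * length x > n" using \<open>n \<le> i\<close> by linarith
        then show ?thesis using iter_nil z by blast
      qed
      show "H' \<subseteq> generate F ({F.comm_iter y (g x) i |y i. y \<in> g ` (W - {x})} \<union> ?\<Gamma>)"
        unfolding H'_def
      proof (rule F.mono_generate, rule Un_mono[OF _ subset_refl])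
        show "g' ` W' \<subseteq> {F.comm_iter y (g x) i |y i. y \<in> g ` (W - {x})}"
        proof (rule image_subsetI)
          fix l assume "l \<in> W'"
          then obtain y i where "y \<in> W - {x}" "l = y @ word_power x i" using W'_mem by blast
          then show "g' l \<in> {F.comm_iter y (g x) i |y i. y \<in> g ` (W - {x})}" using g' by blast
        qed
      qed
      have "insert (g x) (g ` (W - {x})) = g ` W" using x by blast
      then show "h \<in> generate F (insert (g x) (g ` (W - {x})) \<union> ?\<Gamma>)" using less.prems(5) by simp
      show "g x \<in> carrier F" using gF x .
      show "g ` (W - {x}) \<subseteq> carrier F" using gF by blast
    qed (use F.lcs_normal H'sub H'\<Gamma> iter_H' in blast)+
    then obtain k :: int and t where t: "t \<in> H'" and h: "h = g x [^]\<^bsub>F\<^esub> k \<otimes>\<^bsub>F\<^esub> t" by blast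
    have tF: "t \<in> carrier F" using t H'sub subgroup.subset by blast
    have "word_monoid W \<subseteq> lists {1..q}"
      by (rule word_monoid_alphabet) (use W in \<open>auto simp: in_lists_conv_set\<close>)
    then have Wq: "set u \<subseteq> {1..q}" if "u \<in> word_monoid W" for u
      using that by (auto simp only: in_lists_conv_set)
    have measure: "card {u \<in> word_monoid W'. length u \<le> n} < card {u \<in> word_monoid W. length u \<le> n}"
    proof (rule psubset_card_mono)
      show "finite {u \<in> word_monoid W. length u \<le> n}"
        by (rule finite_subset[OF _ finite_bounded_words[of q n]]) (use Wq in blast)
      have "x \<in> word_monoid W" using x by (intro image_eqI[of _ _ "[x]"]) simp_all
      then show "{u \<in> word_monoid W'. length u \<le> n} \<subset> {u \<in> word_monoid W. length u \<le> n}"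
        using W'_code W[OF x] by blast
    qed
    have IH: "t \<in> ?\<Gamma> \<or> (\<exists>l c. c \<noteq> 0 \<and> lead ?B (magnus t - 1) l c \<and> length l \<le> n \<and> l \<in> word_monoid W')"
      using less.hyps[OF measure finW' W'_code(1) W' g'_W'] t unfolding H'_def by blast
    let ?p = "g x [^]\<^bsub>F\<^esub> k"
    have pF: "?p \<in> carrier F" using gF[OF x] by simp
    have xmon: "x \<in> word_monoid W" using x by (intro image_eqI[of _ _ "[x]"]) simp_all
    have leadp: "lead ?B (magnus ?p - 1) x k"
      using gF[OF x] W[OF x] g[OF x] unfolding F_def by (intro lead_magnus_int_pow) auto
    have van1: "vanishes_below 1 (magnus t - 1)" "vanishes_below 1 (magnus ?p - 1)"
      using tF pF magnus_vanishes_one unfolding F_def by blast+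
    have vanp: "vanishes_below (length x) (magnus ?p - 1)" using leadp by (simp add: lead_def)
    \<comment> \<open>(1 + a)(1 + b) - 1 = a + b + ab, where ab starts in a higher degree than the
      leading word of a and than that of b.\<close>
    have expand: "magnus h - 1 = (magnus ?p - 1) + (magnus t - 1) + (magnus ?p - 1) * (magnus t - 1)"
    proof -
      have "magnus h = magnus ?p * magnus t"
        using pF tF unfolding h F_def by (rule magnus_mult)
      then show ?thesis by (simp add: algebra_simps)
    qed
    show ?thesis
    proof (cases "k = 0")
      case True
      then have "h = t" using h tF by simp
      then show ?thesis using IH W'_code(3) by blast
    next
      case False
      from IH show ?thesis
      proof (elim disjE exE conjE)
        assume "t \<in> ?\<Gamma>"
        then have "vanishes_below (Suc n) (magnus t - 1)" unfolding F_def by (intro magnus_lcs) auto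
        then have vt: "vanishes_below (Suc (length x)) (magnus t - 1)"
          using W[OF x] by (auto intro: vanishes_below_mono)
        then have "vanishes_below (Suc (length x)) ((magnus t - 1) + (magnus ?p - 1) * (magnus t - 1))"
          by (intro vanishes_below_add vanishes_below_mult_left)
        then have "lead ?B (magnus h - 1) x k"
          using lead_add_higher[OF leadp] unfolding expand by (simp only: add.assoc)
        then show ?thesis using False W[OF x] xmon by blast
      next
        fix l c assume c: "c \<noteq> 0" and l: "lead ?B (magnus t - 1) l c" "length l \<le> n" "l \<in> word_monoid W'"
        have lmon: "l \<in> word_monoid W" using l(3) W'_code(3) by blast
        have vanl: "vanishes_below (length l) (magnus t - 1)" using l(1) by (simp add: lead_def)
        have vx: "vanishes_below (Suc (length x)) ((magnus ?p - 1) * (magnus t - 1))"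
          using vanishes_below_mult[OF vanp van1(1)] by simp
        have vl: "vanishes_below (Suc (length l)) ((magnus ?p - 1) * (magnus t - 1))"
          using vanishes_below_mult[OF van1(2) vanl] by simp
        \<comment> \<open>Here it matters that x left the monoid: the two leading terms sit at
          different words and cannot cancel. If the lengths agree, the digits, being at most q < B,
          separate the values.\<close>
        have "l \<noteq> x" using l(3) W'_code(2) by blast
        then have "val ?B l \<noteq> val ?B x" if "length l = length x"
          using val_inj[OF that] alph[OF Wq[OF lmon]] alph[of x] W[OF x] by blast
        then have "prec ?B x l \<or> prec ?B l x" unfolding prec_def by linarith
        then show ?thesis
        proof
          assume "prec ?B x l"
          then have "lead ?B (magnus h - 1) x k"
            unfolding expand by (intro lead_add_higher[OF lead_add[OF leadp l(1)] vx])
          then show ?thesis using False W[OF x] xmon by blast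
        next
          assume "prec ?B l x"
          then have "lead ?B (magnus h - 1) l c"
            unfolding expand add.commute[of "magnus ?p - 1" "magnus t - 1"]
            by (intro lead_add_higher[OF lead_add[OF l(1) leadp] vl])
          then show ?thesis using c l(2) lmon by blast
        qed
      qed
    qed
  qed
qed

text \<open>For the hard half, the dichotomy is applied to the code of single letters with bound n -
  1: an element outside Gamma_n would have a nonzero coefficient in degree below n.\<close>

theorem Magnus:
  assumes "n \<ge> 1" "v \<in> carrier (FG q)"
  shows "v \<in> lcs (FG q) n \<longleftrightarrow> vanishes_below n (magnus v - 1)"
proof
  assume "v \<in> lcs (FG q) n"
  then show "vanishes_below n (magnus v - 1)" using magnus_lcs assms(1) by blast
next
  assume van: "vanishes_below n (magnus v - 1)"
  interpret group "FG q" by (rule free_group_is_group)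
  show "v \<in> lcs (FG q) n"
  proof (cases "n = 1")
    case True then show ?thesis using assms(2) by simp
  next
    case False
    then obtain k where n: "n = Suc k" "k \<ge> 1" using assms(1) by (cases n) auto
    define W where "W = (\<lambda>j. [j]) ` {1..q}"
    define g :: "nat list \<Rightarrow> (nat \<times> bool) list" where "g l = fgen (hd l)" for l
    have singletons: "us = map (\<lambda>j. [j]) (concat us)" if "us \<in> lists W" for us
      using that by induction (auto simp: W_def)
    then have "word_code W" unfolding word_code_def by metis
    moreover have "l \<noteq> [] \<and> length l \<le> k \<and> set l \<subseteq> {1..q}" if "l \<in> W" for l
      using that n by (auto simp: W_def)
    moreover have "g l \<in> lcs (FG q) (length l) \<and> lead (Suc q) (magnus (g l) - 1) l 1" if "l \<in> W" for l
    proof -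
      obtain j where j: "l = [j]" "j \<in> {1..q}" using \<open>l \<in> W\<close> unfolding W_def by blast
      have "lead (Suc q) (svar j) [j] 1"
        by (auto simp: lead_def vanishes_below_def svar_def)
      then show ?thesis using j fgen_carrier[OF j(2)] by (simp add: g_def magnus_fgen)
    qed
    moreover have "v \<in> generate (FG q) (g ` W \<union> lcs (FG q) (Suc k))"
    proof -
      have "fgen ` {1..q} = g ` W" by (auto simp: W_def g_def image_image)
      then show ?thesis
        using assms(2) free_group_generate[of "{1..q}"] mono_generate[of "g ` W" "g ` W \<union> lcs (FG q) (Suc k)"]
        by auto
    qed
    ultimately have "v \<in> lcs (FG q) (Suc k) \<or>
        (\<exists>l c. c \<noteq> 0 \<and> lead (Suc q) (magnus v - 1) l c \<and> length l \<le> k \<and> l \<in> word_monoid W)"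
      by (intro leading_word_dichotomy) (auto simp: W_def)
    then show ?thesis using van n(1) unfolding lead_def vanishes_below_def by auto
  qed
qed

section \<open>The unipotent Magnus embedding\<close>

text \<open>Keeps \<^term>\<open>FG q\<close>, which unfolds to \<^term>\<open>free_group {1..q}\<close>, in a form matched by the lemmas
  about it.\<close>

declare One_nat_def [simp del]

definition words :: "nat \<Rightarrow> nat \<Rightarrow> nat list set" where
  "words q k = {u. set u \<subseteq> {1..q} \<and> length u = k}"

lemma finite_words: "finite (words q k)"
  unfolding words_def by (rule finite_lists_length_eq) simp

text \<open>The monomial of a word read from row r: its i-th letter becomes an indeterminate with
  lower index r + i, so the order of the letters survives commutativity.\<close>

fun word_exp :: "nat \<Rightarrow> nat list \<Rightarrow> (nat \<times> nat) \<Rightarrow>\<^sub>0 nat" where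
  "word_exp r [] = 0"
| "word_exp r (a # u) = Poly_Mapping.single (r + 1, a) 1 + word_exp (r + 1) u"

lemma word_exp_append: "word_exp r (u @ v) = word_exp r u + word_exp (r + length u) v"
  by (induction u arbitrary: r) (simp_all add: add.assoc One_nat_def)

lemma keys_word_exp: "Poly_Mapping.keys (word_exp r u) \<subseteq> {r + 1..r + length u} \<times> set u"
proof (induction u arbitrary: r)
  case (Cons a u)
  have "Poly_Mapping.keys (word_exp r (a # u)) \<subseteq> {(r + 1, a)} \<union> Poly_Mapping.keys (word_exp (r + 1) u)"
    using Poly_Mapping.keys_add[of "Poly_Mapping.single (r + 1, a) 1" "word_exp (r + 1) u"] by simp
  then show ?case using Cons[of "r + 1"] by fastforce
qed simp

lemma word_exp_inj: "length u = length v \<Longrightarrow> word_exp r u = word_exp r v \<Longrightarrow> u = v"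
proof (induction u v arbitrary: r rule: list_induct2)
  case (Cons a u b v)
  have notin: "(r + 1, a) \<notin> Poly_Mapping.keys (word_exp (r + 1) w)" for w
    using keys_word_exp[of "r + 1" w] by auto
  then have 0: "Poly_Mapping.lookup (word_exp (r + 1) w) (r + 1, a) = 0" for w
    by (simp add: in_keys_iff)
  have "Poly_Mapping.lookup (word_exp r (a # u)) (r + 1, a) = Poly_Mapping.lookup (word_exp r (b # v)) (r + 1, a)"
    using Cons.prems by simp
  then have "a = b" using 0[of u] 0[of v]
    by (auto simp: lookup_add lookup_single when_def split: if_splits)
  then show ?case using Cons by simp
qed simp

lemma single_sum: "Poly_Mapping.single k (sum f I) = (\<Sum>i\<in>I. Poly_Mapping.single k (f i))"
  by (induction I rule: infinite_finite_induct) (simp_all add: single_add)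

text \<open>The representation of series by triangular matrices in which the variable X_j, for j in
  {1..q}, becomes the superdiagonal matrix of the lambda_i^(j). Degrees n and above vanish. It is a
  closed form for the entries of \<open>Ups\<close>, from which coefficients can be read
  off.\<close>

definition unipotent :: "nat \<Rightarrow> nat \<Rightarrow> series \<Rightarrow> lpoly mat" where
  "unipotent q n f = Matrix.mat n n (\<lambda>(r, c). if r \<le> c
     then \<Sum>u\<in>words q (c - r). Poly_Mapping.single (word_exp r u) (scoeff f u) else 0)"

lemma unipotent_carrier: "unipotent q n f \<in> carrier_mat n n"
  by (simp add: unipotent_def)

lemma unipotent_index:
  "r < n \<Longrightarrow> c < n \<Longrightarrow> unipotent q n f $$ (r, c) = (if r \<le> c
     then \<Sum>u\<in>words q (c - r). Poly_Mapping.single (word_exp r u) (scoeff f u) else 0)"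
  by (simp add: unipotent_def)

lemma words_0: "words q 0 = {[]}"
  by (auto simp: words_def)

lemma unipotent_cong:
  assumes "\<And>u. length u < n \<Longrightarrow> scoeff f u = scoeff g u"
  shows "unipotent q n f = unipotent q n g"
proof (rule eq_matI)
  fix r c assume "r < dim_row (unipotent q n g)" "c < dim_col (unipotent q n g)"
  then have rc: "r < n" "c < n" by (simp_all add: unipotent_def)
  have "(\<Sum>u\<in>words q (c - r). Poly_Mapping.single (word_exp r u) (scoeff f u)) =
      (\<Sum>u\<in>words q (c - r). Poly_Mapping.single (word_exp r u) (scoeff g u))"
    by (rule sum.cong) (use rc assms in \<open>auto simp: words_def\<close>)
  then show "unipotent q n f $$ (r, c) = unipotent q n g $$ (r, c)"
    using rc by (simp add: unipotent_index)
qed (simp_all add: unipotent_def)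

lemma unipotent_one: "unipotent q n 1 = 1\<^sub>m n"
proof (rule eq_matI)
  fix r c assume "r < dim_row (1\<^sub>m n :: lpoly mat)" "c < dim_col (1\<^sub>m n :: lpoly mat)"
  then have rc: "r < n" "c < n" by simp_all
  show "unipotent q n 1 $$ (r, c) = 1\<^sub>m n $$ (r, c)"
  proof (cases "r = c")
    case True
    then show ?thesis using rc by (simp add: unipotent_index words_0)
  next
    case False
    have "(\<Sum>u\<in>words q (c - r). Poly_Mapping.single (word_exp r u) (scoeff 1 u)) = 0" if "r \<le> c"
      by (rule sum.neutral) (use that False in \<open>auto simp: words_def\<close>)
    then show ?thesis using rc False by (simp add: unipotent_index)
  qed
qed (simp_all add: unipotent_def)

text \<open>The second factor starts in row r + i, where the indices used by the first factor stop,
  so the monomials multiply to that of the concatenated word.\<close>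

lemma sum_words_split:
  assumes "i \<le> d"
  shows "(\<Sum>u\<in>words q i. Poly_Mapping.single (word_exp r u) (f u)) *
      (\<Sum>v\<in>words q (d - i). Poly_Mapping.single (word_exp (r + i) v) (g v)) =
    (\<Sum>w\<in>words q d. Poly_Mapping.single (word_exp r w) (f (take i w) * g (drop i w) :: int))"
proof -
  have "(\<Sum>u\<in>words q i. Poly_Mapping.single (word_exp r u) (f u)) *
      (\<Sum>v\<in>words q (d - i). Poly_Mapping.single (word_exp (r + i) v) (g v)) =
      (\<Sum>(u, v)\<in>words q i \<times> words q (d - i).
        Poly_Mapping.single (word_exp r u + word_exp (r + i) v) (f u * g v))"
    by (simp add: sum_product sum.cartesian_product mult_single)
  also have "\<dots> = (\<Sum>w\<in>words q d. Poly_Mapping.single (word_exp r w) (f (take i w) * g (drop i w)))"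
  proof (rule sum.reindex_bij_witness[where j = "\<lambda>(u, v). u @ v" and i = "\<lambda>w. (take i w, drop i w)"])
    show "(\<lambda>(u, v). u @ v) a \<in> words q d" if "a \<in> words q i \<times> words q (d - i)" for a
      using that assms by (auto simp: words_def)
    show "(take i w, drop i w) \<in> words q i \<times> words q (d - i)" if "w \<in> words q d" for w
      using that assms by (auto simp: words_def dest: in_set_takeD in_set_dropD)
  qed (auto simp: words_def word_exp_append)
  finally show ?thesis .
qed

lemma unipotent_mult: "unipotent q n (f * g) = unipotent q n f * unipotent q n g"
proof (rule eq_matI)
  fix r c assume "r < dim_row (unipotent q n f * unipotent q n g)" "c < dim_col (unipotent q n f * unipotent q n g)"
  then have rc: "r < n" "c < n" by (simp_all add: unipotent_def)
  let ?E = "unipotent q n"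
  have prod: "(?E f * ?E g) $$ (r, c) = (\<Sum>k = 0..<n. ?E f $$ (r, k) * ?E g $$ (k, c))"
    using rc by (simp add: unipotent_def scalar_prod_def)
  show "?E (f * g) $$ (r, c) = (?E f * ?E g) $$ (r, c)"
  proof (cases "r \<le> c")
    case False
    then have "(\<Sum>k = 0..<n. ?E f $$ (r, k) * ?E g $$ (k, c)) = 0"
      using rc by (intro sum.neutral) (auto simp: unipotent_index)
    then show ?thesis using False rc prod by (simp add: unipotent_index)
  next
    case True
    let ?d = "c - r"
    have "(\<Sum>k = 0..<n. ?E f $$ (r, k) * ?E g $$ (k, c)) = (\<Sum>k\<in>{r..c}. ?E f $$ (r, k) * ?E g $$ (k, c))"
      using rc by (intro sum.mono_neutral_right) (auto simp: unipotent_index)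
    also have "\<dots> = (\<Sum>i\<in>{..?d}. ?E f $$ (r, r + i) * ?E g $$ (r + i, c))"
      by (rule sum.reindex_bij_witness[where i = "\<lambda>i. r + i" and j = "\<lambda>k. k - r"]) (use True in auto)
    also have "\<dots> = (\<Sum>i\<in>{..?d}. \<Sum>w\<in>words q ?d.
        Poly_Mapping.single (word_exp r w) (scoeff f (take i w) * scoeff g (drop i w)))"
    proof (rule sum.cong)
      fix i assume "i \<in> {..?d}"
      then have i: "i \<le> ?d" by simp
      then have "c - (r + i) = ?d - i" "r + i \<le> c" using True by auto
      then show "?E f $$ (r, r + i) * ?E g $$ (r + i, c) = (\<Sum>w\<in>words q ?d.
          Poly_Mapping.single (word_exp r w) (scoeff f (take i w) * scoeff g (drop i w)))"
        using rc sum_words_split[OF i, where q = q and r = r and f = "scoeff f" and g = "scoeff g"] by (simp add: unipotent_index)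
    qed simp
    also have "\<dots> = (\<Sum>w\<in>words q ?d. Poly_Mapping.single (word_exp r w)
        (\<Sum>i\<le>?d. scoeff f (take i w) * scoeff g (drop i w)))"
      by (subst sum.swap) (simp add: single_sum)
    also have "\<dots> = ?E (f * g) $$ (r, c)"
      using rc True by (auto simp: unipotent_index scoeff_mult_sum words_def intro!: sum.cong)
    finally show ?thesis using prod by simp
  qed
qed (simp_all add: unipotent_def)

section \<open>The homomorphism Upsilon_n as the matrix image of the Magnus series, and its
  kernel\<close>

lemma Omega_simps:
  "0 \<in> Omega q n" "1 \<in> Omega q n"
  "p \<in> Omega q n \<Longrightarrow> p' \<in> Omega q n \<Longrightarrow> p + p' \<in> Omega q n"
  "p \<in> Omega q n \<Longrightarrow> p' \<in> Omega q n \<Longrightarrow> p * p' \<in> Omega q n"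
proof -
  show "0 \<in> Omega q n" "1 \<in> Omega q n" by (auto simp: Omega_def)
  assume p: "p \<in> Omega q n" "p' \<in> Omega q n"
  show "p + p' \<in> Omega q n" using p Poly_Mapping.keys_add[of p p'] by (auto simp: Omega_def)
  show "p * p' \<in> Omega q n"
    unfolding Omega_def
  proof (intro CollectI ballI)
    fix \<mu> assume "\<mu> \<in> Poly_Mapping.keys (p * p')"
    then obtain a b where "\<mu> = a + b" "a \<in> Poly_Mapping.keys p" "b \<in> Poly_Mapping.keys p'"
      using Poly_Mapping.keys_mult[of p p'] by blast
    then show "Poly_Mapping.keys \<mu> \<subseteq> {1..n - 1} \<times> {1..q}"
      using p Poly_Mapping.keys_add[of a b] unfolding Omega_def by blast
  qed
qed

lemma Omega_sum: "(\<And>i. i \<in> I \<Longrightarrow> f i \<in> Omega q n) \<Longrightarrow> sum f I \<in> Omega q n"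
  by (induction I rule: infinite_finite_induct) (simp_all add: Omega_simps)

definition mat_monoid :: "nat \<Rightarrow> nat \<Rightarrow> lpoly mat monoid" where
  "mat_monoid q n =
     \<lparr> carrier = {A \<in> carrier_mat n n. \<forall>r<n. \<forall>c<n. A $$ (r, c) \<in> Omega q n}, mult = (*), one = 1\<^sub>m n \<rparr>"

lemma GL_eq: "GL q n = units_of (mat_monoid q n)"
  by (simp add: GL_def mat_monoid_def)

lemma mat_monoid: "monoid (mat_monoid q n)"
proof (rule monoidI)
  fix A B assume A: "A \<in> carrier (mat_monoid q n)" and B: "B \<in> carrier (mat_monoid q n)"
  have "(A * B) $$ (r, c) \<in> Omega q n" if "r < n" "c < n" for r c
    using A B that by (auto simp: mat_monoid_def scalar_prod_def intro!: Omega_sum Omega_simps)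
  then show "A \<otimes>\<^bsub>mat_monoid q n\<^esub> B \<in> carrier (mat_monoid q n)"
    using A B by (auto simp: mat_monoid_def)
qed (auto simp: mat_monoid_def Omega_simps)

lemma GL_group: "group (GL q n)"
  unfolding GL_eq using mat_monoid by (rule monoid.units_group)

lemma GL_simps: "A \<otimes>\<^bsub>GL q n\<^esub> B = A * B" "\<one>\<^bsub>GL q n\<^esub> = 1\<^sub>m n"
  by (simp_all add: GL_def units_of_def)

lemma unipotent_mat_monoid: "unipotent q n f \<in> carrier (mat_monoid q n)"
proof -
  have "Poly_Mapping.single (word_exp r u) k \<in> Omega q n" if "r \<le> c" "c < n" "u \<in> words q (c - r)" for r c u k
    using keys_word_exp[of r u] that unfolding Omega_def words_def by (fastforce split: if_splits)
  then show ?thesis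
    by (auto simp: mat_monoid_def unipotent_index unipotent_carrier intro!: Omega_sum Omega_simps)
qed

lemma unipotent_magnus_hom: "(\<lambda>v. unipotent q n (magnus v)) \<in> hom (FG q) (GL q n)"
proof (rule homI)
  interpret group "FG q" by (rule free_group_is_group)
  fix v assume v: "v \<in> carrier (FG q)"
  have "unipotent q n (magnus v) * unipotent q n (magnus (inv\<^bsub>FG q\<^esub> v)) = 1\<^sub>m n"
    "unipotent q n (magnus (inv\<^bsub>FG q\<^esub> v)) * unipotent q n (magnus v) = 1\<^sub>m n"
    using magnus_inv[OF v] by (metis unipotent_mult unipotent_one)+
  then show "unipotent q n (magnus v) \<in> carrier (GL q n)"
    using unipotent_mat_monoid[of q n "magnus v"] unipotent_mat_monoid[of q n "magnus (inv\<^bsub>FG q\<^esub> v)"]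
    unfolding GL_eq units_of_def Units_def by (auto simp: mat_monoid_def)
  fix w assume w: "w \<in> carrier (FG q)"
  show "unipotent q n (magnus (v \<otimes>\<^bsub>FG q\<^esub> w)) =
      unipotent q n (magnus v) \<otimes>\<^bsub>GL q n\<^esub> unipotent q n (magnus w)"
    using magnus_mult[OF v w] by (simp add: unipotent_mult GL_simps)
qed

lemma unipotent_fgen:
  assumes "j \<in> {1..q}"
  shows "unipotent q n (1 + svar j) = magnus_gen n j"
proof (rule eq_matI)
  fix r c assume "r < dim_row (magnus_gen n j)" "c < dim_col (magnus_gen n j)"
  then have rc: "r < n" "c < n" by (simp_all add: magnus_gen_def)
  let ?S = "\<Sum>u\<in>words q (c - r). Poly_Mapping.single (word_exp r u) (scoeff (1 + svar j) u)"
  have gen: "magnus_gen n j $$ (r, c) = (if c = r then 1 else if c = r + 1 then lam (r + 1) j else 0)"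
    using rc by (simp add: magnus_gen_def)
  consider "c < r" | "c = r" | "c = r + 1" | "c > r + 1" by linarith
  then show "unipotent q n (1 + svar j) $$ (r, c) = magnus_gen n j $$ (r, c)"
  proof cases
    case 1 then show ?thesis using rc gen by (simp add: unipotent_index)
  next
    case 2 then show ?thesis using rc gen by (simp add: unipotent_index words_0 svar_def)
  next
    case 3
    have "?S = (\<Sum>u\<in>{[j]}. Poly_Mapping.single (word_exp r u) (scoeff (1 + svar j) u))"
      using assms 3 by (intro sum.mono_neutral_right finite_words) (auto simp: words_def svar_def)
    also have "\<dots> = lam (r + 1) j" by (simp add: svar_def lam_def)
    finally show ?thesis using 3 rc gen by (simp add: unipotent_index)
  next
    case 4
    have "?S = 0" by (rule sum.neutral) (use 4 in \<open>auto simp: words_def svar_def\<close>)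
    then show ?thesis using 4 rc gen by (simp add: unipotent_index)
  qed
qed (simp_all add: unipotent_def magnus_gen_def)

lemma magnus_gen_GL: "magnus_gen n ` {1..q} \<subseteq> carrier (GL q n)"
proof (rule image_subsetI)
  fix j assume j: "j \<in> {1..q}"
  then have "unipotent q n (magnus (fgen j)) \<in> carrier (GL q n)"
    using hom_in_carrier[OF unipotent_magnus_hom fgen_carrier] by blast
  then show "magnus_gen n j \<in> carrier (GL q n)" using unipotent_fgen[OF j] by (simp add: magnus_fgen)
qed

lemma Ups_group_hom_GL: "group_hom (FG q) (GL q n) (Ups q n)"
  unfolding Ups_def using magnus_gen_GL by (rule group.free_lift_group_hom[OF GL_group])

lemma Ups_eq:
  assumes "v \<in> carrier (FG q)"
  shows "Ups q n v = unipotent q n (magnus v)"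
proof (rule free_group_hom_eqI[OF Ups_group_hom_GL _ _ assms])
  show "group_hom (FG q) (GL q n) (\<lambda>v. unipotent q n (magnus v))"
    by (simp add: group_hom_def group_hom_axioms_def free_group_is_group GL_group unipotent_magnus_hom)
  fix j assume j: "j \<in> {1..q}"
  then have "magnus_gen n j \<in> carrier (GL q n)" using magnus_gen_GL by blast
  then show "Ups q n (fgen j) = unipotent q n (magnus (fgen j))"
    unfolding Ups_def magnus_fgen unipotent_fgen[OF j] by (rule group.free_lift_fgen[OF GL_group])
qed

text \<open>\<open>unipotent\<close> reads only words over {1..q}; the remaining coefficients must
  be known to vanish before a matrix identity can determine the series in low degrees.\<close>

lemma scoeff_magnus_support:
  assumes "v \<in> carrier (free_group X)" "\<not> set u \<subseteq> X"
  shows "scoeff (magnus v) u = 0"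
proof -
  let ?P = "\<lambda>f. \<forall>u. \<not> set u \<subseteq> X \<longrightarrow> scoeff f u = 0"
  have mult: "?P (f * g)" if f: "?P f" and g: "?P g" for f g
    unfolding scoeff_mult_sum
  proof (intro allI impI sum.neutral ballI)
    fix u :: "nat list" and i assume "\<not> set u \<subseteq> X"
    then have "\<not> set (take i u @ drop i u) \<subseteq> X" by simp
    then have "\<not> set (take i u) \<subseteq> X \<or> \<not> set (drop i u) \<subseteq> X" unfolding set_append by blast
    then show "scoeff f (take i u) * scoeff g (drop i u) = 0" using f g by auto
  qed
  have letter: "?P (magnus (fgen x))" "?P (magnus (inv\<^bsub>free_group X\<^esub> (fgen x)))" if x: "x \<in> X" for x
  proof -
    show "?P (magnus (fgen x))" using x by (auto simp: magnus_fgen svar_def)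
    have "magnus (inv\<^bsub>free_group X\<^esub> (fgen x)) * ((1 + svar x) * inv_one_svar x) = inv_one_svar x"
      using magnus_inv(2)[OF fgen_carrier[OF x]] by (simp add: magnus_fgen mult.assoc[symmetric])
    then have "magnus (inv\<^bsub>free_group X\<^esub> (fgen x)) = inv_one_svar x" by (simp only: one_svar_inverse mult_1_right)
    then show "?P (magnus (inv\<^bsub>free_group X\<^esub> (fgen x)))"
      using x by (auto simp: inv_one_svar_def)
  qed
  have "?P (magnus v)"
    using assms(1)
  proof (induction rule: free_group_induct)
    case one
    then show ?case by (auto simp: magnus_one)
  next
    case (gen x v)
    then show ?case using mult[OF letter(1)[of x]] by (simp add: magnus_mult[of _ X] fgen_carrier)
  next
    case (inv x v)
    interpret group "free_group X" by (rule free_group_is_group)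
    show ?case using inv mult[OF letter(2)[of x]] by (simp add: magnus_mult[of _ X] fgen_carrier)
  qed
  then show ?thesis using assms(2) by blast
qed

lemma unipotent_eq_one_iff:
  assumes supp: "\<And>u. \<not> set u \<subseteq> {1..q} \<Longrightarrow> scoeff f u = 0"
  shows "unipotent q n f = 1\<^sub>m n \<longleftrightarrow> vanishes_below n (f - 1)"
proof
  assume "vanishes_below n (f - 1)"
  then have "unipotent q n f = unipotent q n 1"
    by (intro unipotent_cong) (simp add: vanishes_below_def)
  then show "unipotent q n f = 1\<^sub>m n" by (simp add: unipotent_one)
next
  assume "unipotent q n f = 1\<^sub>m n"
  then have eq: "unipotent q n f = unipotent q n 1" by (simp add: unipotent_one)
  show "vanishes_below n (f - 1)"
    unfolding vanishes_below_def
  proof (intro allI impI)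
    fix u :: "nat list" assume u: "length u < n"
    show "scoeff (f - 1) u = 0"
    proof (cases "set u \<subseteq> {1..q}")
      case False then show ?thesis using supp[of u] by (cases u) auto
    next
      case True
      then have uw: "u \<in> words q (length u)" by (simp add: words_def)
      \<comment> \<open>The first row suffices: in the column given by the length of u, the monomial
        of u comes from u alone.\<close>
      have lookup: "Poly_Mapping.lookup (unipotent q n g $$ (0, length u)) (word_exp 0 u) = scoeff g u" for g
      proof -
        have "Poly_Mapping.lookup (unipotent q n g $$ (0, length u)) (word_exp 0 u) =
            (\<Sum>v\<in>words q (length u). if v = u then scoeff g v else 0)"
          using u word_exp_inj[of _ u 0]
          by (auto simp: unipotent_index lookup_sum lookup_single when_def words_def intro!: sum.cong)
        then show ?thesis using uw by (simp add: finite_words)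
      qed
      show ?thesis using lookup[of f] lookup[of 1] eq by (metis scoeff_simps(5) diff_self)
    qed
  qed
qed

lemma Ups_eq_one_iff:
  assumes "n \<ge> 1" "v \<in> carrier (FG q)"
  shows "Ups q n v = 1\<^sub>m n \<longleftrightarrow> v \<in> lcs (FG q) n"
  using assms Ups_eq[OF assms(2)] unipotent_eq_one_iff[of q "magnus v" n] scoeff_magnus_support[OF assms(2)]
    Magnus[OF assms] by auto

lemma ImUps_simps:
  "carrier (ImUps q n) = Ups q n ` carrier (FG q)" "\<one>\<^bsub>ImUps q n\<^esub> = 1\<^sub>m n"
  by (simp_all add: ImUps_def GL_simps)

lemma ImUps_group: "group (ImUps q n)"
  unfolding ImUps_def
  using group_hom.img_is_subgroup[OF Ups_group_hom_GL] GL_group by (rule subgroup.subgroup_is_group)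

lemma Ups_group_hom: "group_hom (FG q) (ImUps q n) (Ups q n)"
proof -
  have "Ups q n \<in> hom (FG q) (ImUps q n)"
    using group_hom.homh[OF Ups_group_hom_GL[of q n]] by (auto simp: hom_def ImUps_def)
  then show ?thesis
    by (simp add: group_hom_def group_hom_axioms_def free_group_is_group ImUps_group)
qed

lemma Ups_eq_iff:
  assumes "n \<ge> 1" "u \<in> carrier (FG q)" "v \<in> carrier (FG q)"
  shows "Ups q n u = Ups q n v \<longleftrightarrow> u \<otimes>\<^bsub>FG q\<^esub> inv\<^bsub>FG q\<^esub> v \<in> lcs (FG q) n"
proof -
  interpret group_hom "FG q" "ImUps q n" "Ups q n" by (rule Ups_group_hom)
  have "Ups q n u = Ups q n v \<longleftrightarrow> Ups q n (u \<otimes>\<^bsub>FG q\<^esub> inv\<^bsub>FG q\<^esub> v) = \<one>\<^bsub>ImUps q n\<^esub>"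
    using assms(2,3) by (simp add: H.inv_solve_right' H.r_inv)
  also have "\<dots> \<longleftrightarrow> u \<otimes>\<^bsub>FG q\<^esub> inv\<^bsub>FG q\<^esub> v \<in> lcs (FG q) n"
    unfolding ImUps_simps using assms(2,3) by (intro Ups_eq_one_iff assms(1)) simp
  finally show ?thesis .
qed

lemma (in group) coset_proj_rcos:
  assumes "subgroup H G" "subgroup N G" "H \<subseteq> N" "v \<in> carrier G"
  shows "coset_proj G N (H #> v) = N #> v"
proof -
  have sub: "H \<subseteq> carrier G" "N \<subseteq> carrier G" using assms by (simp_all add: subgroup.subset)
  have "N <#> H = N"
  proof
    show "N <#> H \<subseteq> N"
      using assms(3) subgroup.m_closed[OF assms(2)] by (auto simp: set_mult_def)
    show "N \<subseteq> N <#> H"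
      using subgroup.one_closed[OF assms(1)] sub by (force simp: set_mult_def)
  qed
  then show ?thesis
    unfolding coset_proj_def using sub assms(4) by (simp add: setmult_rcos_assoc)
qed

lemma Ups_bar_rcos:
  assumes "n \<ge> 1" "v \<in> carrier (FG q)"
  shows "Ups_bar q n (lcs (FG q) n #>\<^bsub>FG q\<^esub> v) = Ups q n v"
proof -
  interpret group_hom "FG q" "ImUps q n" "Ups q n" by (rule Ups_group_hom)
  have "Ups q n (g \<otimes>\<^bsub>FG q\<^esub> v) = Ups q n v" if g: "g \<in> lcs (FG q) n" for g
  proof -
    have "Ups q n g = \<one>\<^bsub>ImUps q n\<^esub>"
      using Ups_eq_one_iff[OF assms(1), of g q] G.lcs_carrier[OF g] g by (simp add: ImUps_simps)
    then show ?thesis using assms(2) G.lcs_carrier[OF g] by simp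
  qed
  then have "Ups q n ` (lcs (FG q) n #>\<^bsub>FG q\<^esub> v) = {Ups q n v}"
    using G.rcos_self[OF assms(2) G.lcs_subgroup[of n]] by (auto simp: r_coset_def)
  then show ?thesis by (simp add: Ups_bar_def)
qed

text \<open>The choice hidden in \<open>inv_into\<close> is harmless because, by Magnus' theorem,
  \<open>Ups_bar\<close> separates the cosets of Gamma_(n+1)F.\<close>

lemma pUps_Ups:
  assumes n: "n \<ge> 1" and v: "v \<in> carrier (FG q)"
  shows "pUps q n (Ups q (n + 1) v) = Ups q n v"
proof -
  interpret group "FG q" by (rule free_group_is_group)
  let ?A = "carrier (FG q Mod lcs (FG q) (n + 1))"
  define C where "C = inv_into ?A (Ups_bar q (n + 1)) (Ups q (n + 1) v)"
  have img: "Ups q (n + 1) v \<in> Ups_bar q (n + 1) ` ?A"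
    using Ups_bar_rcos[of "n + 1" v q] v unfolding carrier_FactGroup by (auto intro!: image_eqI)
  have CA: "C \<in> ?A" and C: "Ups_bar q (n + 1) C = Ups q (n + 1) v"
    unfolding C_def using img by (rule inv_into_into, rule f_inv_into_f)
  obtain u where u: "u \<in> carrier (FG q)" "C = lcs (FG q) (n + 1) #>\<^bsub>FG q\<^esub> u"
    using CA unfolding carrier_FactGroup by blast
  have "Ups q (n + 1) u = Ups q (n + 1) v" using C u Ups_bar_rcos[of "n + 1" u q] by simp
  then have "C = lcs (FG q) (n + 1) #>\<^bsub>FG q\<^esub> v"
    using Ups_eq_iff[of "n + 1" u q v] u v rcos_eq_iff[OF lcs_normal u(1) v] by simp
  then have "pF q n C = lcs (FG q) n #>\<^bsub>FG q\<^esub> v"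
    unfolding pF_def using coset_proj_rcos[OF lcs_subgroup lcs_subgroup lcs_antimono v, of n "n + 1"]
    by simp
  then show ?thesis
    unfolding pUps_def C_def[symmetric] using Ups_bar_rcos[OF n v] by simp
qed

section \<open>Homomorphisms modulo the lower central series\<close>

declare lcs.simps(3) [simp del] mult_FactGroup [simp del]

abbreviation conj_pow :: "('a, 'b) monoid_scheme \<Rightarrow> 'a \<Rightarrow> int \<Rightarrow> 'a \<Rightarrow> 'a" where
  "conj_pow G y e x \<equiv> y [^]\<^bsub>G\<^esub> (- e) \<otimes>\<^bsub>G\<^esub> x \<otimes>\<^bsub>G\<^esub> y [^]\<^bsub>G\<^esub> e"

lemma (in group) rcos_group_hom:
  assumes "N \<lhd> G"
  shows "group_hom G (G Mod N) (\<lambda>x. N #> x)"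
  by (simp add: group_hom_def group_hom_axioms_def is_group normal.factorgroup_is_group[OF assms]
      normal.r_coset_hom_Mod[OF assms])

lemma (in group) rcos_mem_lcs_Suc_commute:
  assumes "n \<ge> 1" "x \<in> lcs G n" "y \<in> carrier G" "N \<lhd> G" "lcs G (Suc n) \<subseteq> N"
  shows "(N #> x) \<otimes>\<^bsub>G Mod N\<^esub> (N #> y) = (N #> y) \<otimes>\<^bsub>G Mod N\<^esub> (N #> x)"
proof -
  interpret \<pi>: group_hom G "G Mod N" "\<lambda>x. N #> x" using assms(4) by (rule rcos_group_hom)
  have x: "x \<in> carrier G" using assms(2) by (rule lcs_carrier)
  have "x \<otimes> y \<otimes> inv (y \<otimes> x) = comm_elt G x y" using x assms(3) by (simp add: word_simps)
  also have "\<dots> \<in> N" using comm_elt_lcs_Suc[OF assms(1-3)] assms(5) by blast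
  finally have "N #> (x \<otimes> y) = N #> (y \<otimes> x)"
    using rcos_eq_iff[OF assms(4) m_closed m_closed, OF x assms(3) assms(3) x] by blast
  then show ?thesis using \<pi>.hom_mult[of x y] \<pi>.hom_mult[of y x] x assms(3) by simp
qed

lemma (in group) comm_elt_central_left:
  assumes "z \<in> carrier G" "x \<in> carrier G" "y \<in> carrier G"
    and "\<And>g. g \<in> carrier G \<Longrightarrow> z \<otimes> g = g \<otimes> z"
  shows "comm_elt G (z \<otimes> x) y = comm_elt G x y"
proof -
  have "comm_elt G (z \<otimes> x) y = z \<otimes> (x \<otimes> y \<otimes> inv x) \<otimes> inv z \<otimes> inv y"
    using assms(1-3) by (simp add: word_simps)
  also have "z \<otimes> (x \<otimes> y \<otimes> inv x) = (x \<otimes> y \<otimes> inv x) \<otimes> z" using assms by simp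
  finally show ?thesis using assms(1-3) by (simp add: word_simps)
qed

text \<open>Here t commutes only with x and [x,y]: in the application t lies in Gamma_2, which need
  not be central in the quotient considered.\<close>

lemma (in group) comm_elt_central_right:
  assumes "t \<in> carrier G" "x \<in> carrier G" "y \<in> carrier G"
    and "t \<otimes> x = x \<otimes> t" "t \<otimes> comm_elt G x y = comm_elt G x y \<otimes> t"
  shows "comm_elt G x (t \<otimes> y) = comm_elt G x y"
proof -
  have "comm_elt G x (t \<otimes> y) = (x \<otimes> t) \<otimes> y \<otimes> inv x \<otimes> inv y \<otimes> inv t"
    using assms(1-3) by (simp add: word_simps)
  also have "\<dots> = (t \<otimes> comm_elt G x y) \<otimes> inv t"
    unfolding assms(4)[symmetric] using assms(1-3) by (simp add: word_simps)
  also have "\<dots> = comm_elt G x y" unfolding assms(5) using assms(1-3) by (simp add: word_simps)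
  finally show ?thesis .
qed

text \<open>The subgroup N h(V). That it is closed under products lets membership be checked on
  generators, such as single commutators.\<close>

lemma (in group_hom) image_mod_subgroup:
  assumes N: "N \<lhd> H" and V: "subgroup V G"
  shows "subgroup {g \<in> carrier H. \<exists>v\<in>V. g \<otimes>\<^bsub>H\<^esub> inv\<^bsub>H\<^esub> (h v) \<in> N} H" (is "subgroup ?S H")
proof (rule H.subgroupI)
  have sub: "subgroup N H" using N by (rule normal_imp_subgroup)
  have VG: "v \<in> carrier G" if "v \<in> V" for v using that V by (auto dest: subgroup.subset)
  have NH: "n \<in> carrier H" if "n \<in> N" for n using that sub by (auto dest: subgroup.subset)
  show "?S \<noteq> {}"
    using subgroup.one_closed[OF sub] subgroup.one_closed[OF V] by (auto intro!: exI[of _ "\<one>\<^bsub>H\<^esub>"] bexI[of _ \<one>])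
  fix g assume "g \<in> ?S"
  then obtain v where g: "g \<in> carrier H" and v: "v \<in> V" "g \<otimes>\<^bsub>H\<^esub> inv\<^bsub>H\<^esub> (h v) \<in> N" by blast
  have "inv\<^bsub>H\<^esub> g \<otimes>\<^bsub>H\<^esub> inv\<^bsub>H\<^esub> (h (inv v)) =
      inv\<^bsub>H\<^esub> g \<otimes>\<^bsub>H\<^esub> inv\<^bsub>H\<^esub> (g \<otimes>\<^bsub>H\<^esub> inv\<^bsub>H\<^esub> (h v)) \<otimes>\<^bsub>H\<^esub> g"
    using g VG[OF v(1)] by (simp add: H.word_simps)
  moreover have "inv\<^bsub>H\<^esub> g \<otimes>\<^bsub>H\<^esub> inv\<^bsub>H\<^esub> (g \<otimes>\<^bsub>H\<^esub> inv\<^bsub>H\<^esub> (h v)) \<otimes>\<^bsub>H\<^esub> g \<in> N"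
    using v(2) by (intro H.normal_conj(2)[OF N g] subgroup.m_inv_closed[OF sub])
  ultimately show "inv\<^bsub>H\<^esub> g \<in> ?S"
    using g subgroup.m_inv_closed[OF V v(1)] by (simp del: hom_inv) (metis (no_types, lifting))
  fix g' assume "g' \<in> ?S"
  then obtain v' where g': "g' \<in> carrier H" and v': "v' \<in> V" "g' \<otimes>\<^bsub>H\<^esub> inv\<^bsub>H\<^esub> (h v') \<in> N" by blast
  have "g \<otimes>\<^bsub>H\<^esub> g' \<otimes>\<^bsub>H\<^esub> inv\<^bsub>H\<^esub> (h (v \<otimes> v')) =
      (g \<otimes>\<^bsub>H\<^esub> (g' \<otimes>\<^bsub>H\<^esub> inv\<^bsub>H\<^esub> (h v')) \<otimes>\<^bsub>H\<^esub> inv\<^bsub>H\<^esub> g) \<otimes>\<^bsub>H\<^esub> (g \<otimes>\<^bsub>H\<^esub> inv\<^bsub>H\<^esub> (h v))"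
    using g g' VG[OF v(1)] VG[OF v'(1)] by (simp add: H.word_simps)
  moreover have "\<dots> \<in> N"
    using v(2) v'(2) by (intro subgroup.m_closed[OF sub H.normal_conj(1)[OF N g]])
  ultimately show "g \<otimes>\<^bsub>H\<^esub> g' \<in> ?S"
    using g g' subgroup.m_closed[OF V v(1) v'(1)] by (simp del: hom_mult) (metis (no_types, lifting))
qed auto

text \<open>Modulo Gamma_(n+2), a commutator [a,g] with a in Gamma_n depends only on a modulo
  Gamma_(n+1) and on g modulo Gamma_2, so both entries may be replaced by images under h.\<close>

lemma (in group_hom) lcs_generated_mod:
  assumes gen: "\<And>g. g \<in> carrier H \<Longrightarrow> \<exists>v\<in>carrier G. g \<otimes>\<^bsub>H\<^esub> inv\<^bsub>H\<^esub> (h v) \<in> lcs H 2"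
    and "n \<ge> 1" "g \<in> lcs H n"
  shows "\<exists>v\<in>lcs G n. g \<otimes>\<^bsub>H\<^esub> inv\<^bsub>H\<^esub> (h v) \<in> lcs H (Suc n)"
  using assms(2,3)
proof (induction n arbitrary: g rule: nat_induct_at_least)
  case base
  then show ?case using gen[of g] by (simp add: numeral_2_eq_2 One_nat_def)
next
  case (Suc n)
  let ?N = "lcs H (Suc (Suc n))"
  interpret \<pi>: group_hom H "H Mod ?N" "\<lambda>x. ?N #>\<^bsub>H\<^esub> x" by (rule H.rcos_group_hom[OF H.lcs_normal])
  let ?S = "{g \<in> carrier H. \<exists>v\<in>lcs G (Suc n). g \<otimes>\<^bsub>H\<^esub> inv\<^bsub>H\<^esub> (h v) \<in> ?N}"
  have "comm_elt H a g \<in> ?S" if a: "a \<in> lcs H n" and g: "g \<in> carrier H" for a g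
  proof -
    obtain u where u: "u \<in> lcs G n" "a \<otimes>\<^bsub>H\<^esub> inv\<^bsub>H\<^esub> (h u) \<in> lcs H (Suc n)" using Suc.IH[OF a] by blast
    obtain v where v: "v \<in> carrier G" "g \<otimes>\<^bsub>H\<^esub> inv\<^bsub>H\<^esub> (h v) \<in> lcs H 2" using gen[OF g] by blast
    define z t where "z = a \<otimes>\<^bsub>H\<^esub> inv\<^bsub>H\<^esub> (h u)" and "t = g \<otimes>\<^bsub>H\<^esub> inv\<^bsub>H\<^esub> (h v)"
    have uG: "u \<in> carrier G" and aH: "a \<in> carrier H" using u(1) a G.lcs_carrier H.lcs_carrier by auto
    have z: "z \<in> lcs H (Suc n)" "z \<in> carrier H" and t: "t \<in> lcs H 2" "t \<in> carrier H"
      using u(2) v(2) aH g uG v(1) by (simp_all add: z_def t_def)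
    have az: "a = z \<otimes>\<^bsub>H\<^esub> h u" and gt: "g = t \<otimes>\<^bsub>H\<^esub> h v"
      using aH g uG v(1) by (simp_all add: z_def t_def H.word_simps)
    have hu: "h u \<in> lcs H n" using lcs_img_subset u(1) by blast
    have huv: "comm_elt H (h u) (h v) \<in> lcs H (Suc n)"
      using Suc.hyps hu v(1) by (intro H.comm_elt_lcs_Suc) auto
    let ?p = "\<lambda>x. ?N #>\<^bsub>H\<^esub> x"
    have sub: "lcs H (Suc (Suc n)) \<subseteq> ?N" by simp
    have "?p (comm_elt H a g) = comm_elt (H Mod ?N) (?p z \<otimes>\<^bsub>H Mod ?N\<^esub> ?p (h u)) (?p g)"
      using \<pi>.hom_comm_elt[OF aH g] \<pi>.hom_mult[of z "h u"] z uG az by simp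
    also have "\<dots> = comm_elt (H Mod ?N) (?p (h u)) (?p g)"
    proof (rule \<pi>.H.comm_elt_central_left)
      fix x assume "x \<in> carrier (H Mod ?N)"
      then obtain y where "y \<in> carrier H" "x = ?p y" unfolding carrier_FactGroup by blast
      then show "?p z \<otimes>\<^bsub>H Mod ?N\<^esub> x = x \<otimes>\<^bsub>H Mod ?N\<^esub> ?p z"
        using H.rcos_mem_lcs_Suc_commute[OF _ z(1) _ H.lcs_normal sub] by simp
    qed (use z uG g in auto)
    also have "\<dots> = comm_elt (H Mod ?N) (?p (h u)) (?p t \<otimes>\<^bsub>H Mod ?N\<^esub> ?p (h v))"
      using \<pi>.hom_mult[of t "h v"] t v(1) gt by simp
    also have "\<dots> = comm_elt (H Mod ?N) (?p (h u)) (?p (h v))"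
    proof (rule \<pi>.H.comm_elt_central_right)
      \<comment> \<open>This needs [Gamma_2, Gamma_n] \<subseteq> Gamma_(n+2), which comes from the
        three subgroups argument.\<close>
      have "t \<otimes>\<^bsub>H\<^esub> h u \<otimes>\<^bsub>H\<^esub> inv\<^bsub>H\<^esub> (h u \<otimes>\<^bsub>H\<^esub> t) = comm_elt H t (h u)"
        using t uG by (simp add: H.word_simps)
      also have "\<dots> \<in> lcs H (2 + n)" using H.lcs_comm_elt[OF _ _ t(1) hu] Suc.hyps by simp
      finally have "?p (t \<otimes>\<^bsub>H\<^esub> h u) = ?p (h u \<otimes>\<^bsub>H\<^esub> t)"
        using H.rcos_eq_iff[OF H.lcs_normal H.m_closed H.m_closed, OF t(2) hom_closed hom_closed t(2), OF uG uG]
        by simp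
      then show "?p t \<otimes>\<^bsub>H Mod ?N\<^esub> ?p (h u) = ?p (h u) \<otimes>\<^bsub>H Mod ?N\<^esub> ?p t"
        using \<pi>.hom_mult[of t "h u"] \<pi>.hom_mult[of "h u" t] t uG by simp
      show "?p t \<otimes>\<^bsub>H Mod ?N\<^esub> comm_elt (H Mod ?N) (?p (h u)) (?p (h v)) =
          comm_elt (H Mod ?N) (?p (h u)) (?p (h v)) \<otimes>\<^bsub>H Mod ?N\<^esub> ?p t"
        using H.rcos_mem_lcs_Suc_commute[OF _ huv t(2) H.lcs_normal sub]
          \<pi>.hom_comm_elt[of "h u" "h v"] uG v(1) by simp
    qed (use t uG v in auto)
    also have "\<dots> = ?p (h (comm_elt G u v))"
      using \<pi>.hom_comm_elt[of "h u" "h v"] hom_comm_elt[of u v] uG v(1) by simp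
    finally have "comm_elt H a g \<otimes>\<^bsub>H\<^esub> inv\<^bsub>H\<^esub> h (comm_elt G u v) \<in> ?N"
      using H.rcos_eq_iff[OF H.lcs_normal H.comm_elt_closed hom_closed[OF G.comm_elt_closed], OF aH g uG v(1)]
      by blast
    moreover have "comm_elt G u v \<in> lcs G (Suc n)" using Suc.hyps u(1) v(1) by (rule G.comm_elt_lcs_Suc)
    ultimately show ?thesis using H.comm_elt_closed[OF aH g] by blast
  qed
  then have "lcs H (Suc n) \<subseteq> ?S"
    unfolding H.lcs_Suc[OF Suc.hyps] commutator_subgroup_def[of H]
    by (intro H.generate_subgroup_incl image_mod_subgroup H.lcs_normal G.lcs_subgroup) blast
  then show ?case using Suc.prems by blast
qed

text \<open>Successive approximation: the error in Gamma_n is an image modulo Gamma_(n+1) and is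
  absorbed into v.\<close>

lemma (in group_hom) generated_mod_lcs:
  assumes gen: "\<And>g. g \<in> carrier H \<Longrightarrow> \<exists>v\<in>carrier G. g \<otimes>\<^bsub>H\<^esub> inv\<^bsub>H\<^esub> (h v) \<in> lcs H 2"
    and "n \<ge> 1" "g \<in> carrier H"
  shows "\<exists>v\<in>carrier G. g \<otimes>\<^bsub>H\<^esub> inv\<^bsub>H\<^esub> (h v) \<in> lcs H n"
  using assms(2)
proof (induction n rule: nat_induct_at_least)
  case base
  then show ?case using assms(3) by (auto simp: One_nat_def intro: G.one_closed)
next
  case (Suc n)
  then obtain v where v: "v \<in> carrier G" "g \<otimes>\<^bsub>H\<^esub> inv\<^bsub>H\<^esub> (h v) \<in> lcs H n" by blast
  obtain u where u: "u \<in> lcs G n" "g \<otimes>\<^bsub>H\<^esub> inv\<^bsub>H\<^esub> (h v) \<otimes>\<^bsub>H\<^esub> inv\<^bsub>H\<^esub> (h u) \<in> lcs H (Suc n)"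
    using lcs_generated_mod[OF gen Suc.hyps v(2)] by blast
  have uG: "u \<in> carrier G" using u(1) by (rule G.lcs_carrier)
  have "g \<otimes>\<^bsub>H\<^esub> inv\<^bsub>H\<^esub> (h v) \<otimes>\<^bsub>H\<^esub> inv\<^bsub>H\<^esub> (h u) = g \<otimes>\<^bsub>H\<^esub> inv\<^bsub>H\<^esub> (h (u \<otimes> v))"
    using uG v(1) assms(3) by (simp add: H.word_simps)
  then have "g \<otimes>\<^bsub>H\<^esub> inv\<^bsub>H\<^esub> (h (u \<otimes> v)) \<in> lcs H (Suc n)" using u(2) by simp
  then show ?case using uG v(1) by (intro bexI[of _ "u \<otimes> v"]) simp_all
qed

lemma (in group) conj_central_mult:
  assumes "a \<in> carrier G" "y \<in> carrier G" "z \<in> carrier G"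
    and "\<And>g. g \<in> carrier G \<Longrightarrow> z \<otimes> g = g \<otimes> z" and "e = 1 \<or> e = (- 1 :: int)"
  shows "(z \<otimes> y) [^] (- e) \<otimes> a \<otimes> (z \<otimes> y) [^] e = y [^] (- e) \<otimes> a \<otimes> y [^] e"
proof -
  have pow: "x [^] (- 1 :: int) = inv x" if "x \<in> carrier G" for x
    using that int_pow_neg[of x 1] by simp
  have "inv (z \<otimes> y) \<otimes> a \<otimes> (z \<otimes> y) = inv y \<otimes> a \<otimes> y"
  proof -
    have "inv (z \<otimes> y) \<otimes> a \<otimes> (z \<otimes> y) = inv y \<otimes> inv z \<otimes> (a \<otimes> z) \<otimes> y"
      using assms(1-3) by (simp add: word_simps)
    also have "a \<otimes> z = z \<otimes> a" using assms by simp
    finally show ?thesis using assms(1-3) by (simp add: word_simps)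
  qed
  moreover have "(z \<otimes> y) \<otimes> a \<otimes> inv (z \<otimes> y) = y \<otimes> a \<otimes> inv y"
  proof -
    have "(z \<otimes> y) \<otimes> a \<otimes> inv (z \<otimes> y) = z \<otimes> (y \<otimes> a \<otimes> inv y) \<otimes> inv z"
      using assms(1-3) by (simp add: word_simps)
    also have "z \<otimes> (y \<otimes> a \<otimes> inv y) = (y \<otimes> a \<otimes> inv y) \<otimes> z" using assms by simp
    finally show ?thesis using assms(1-3) by (simp add: word_simps)
  qed
  ultimately show ?thesis using assms(1-3,5) by (auto simp: pow)
qed

text \<open>Write x = z y with z in Gamma_n; then h z is central, because h kills every [z,g']. The
  form with a surjection killing Gamma_(n+1) covers both the link group modulo Gamma_(n+1) and the
  quotients of F.\<close>

lemma (in group_hom) conj_mod_lcs: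
  assumes n: "n \<ge> 1" and triv: "\<And>x. x \<in> lcs G (Suc n) \<Longrightarrow> h x = \<one>\<^bsub>H\<^esub>" and surj: "h ` carrier G = carrier H"
    and x: "x \<in> carrier G" and y: "y \<in> carrier G" and xy: "x \<otimes> inv y \<in> lcs G n"
    and a: "a \<in> carrier H" and e: "e = 1 \<or> e = (- 1 :: int)"
  shows "conj_pow H (h x) e a = conj_pow H (h y) e a"
proof -
  define z where "z = x \<otimes> inv y"
  have z: "z \<in> lcs G n" "z \<in> carrier G" using xy x y by (simp_all add: z_def)
  have "h x = h z \<otimes>\<^bsub>H\<^esub> h y"
    using x y unfolding z_def by (simp add: H.word_simps)
  moreover have "h z \<otimes>\<^bsub>H\<^esub> g = g \<otimes>\<^bsub>H\<^esub> h z" if "g \<in> carrier H" for g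
  proof -
    obtain g' where g': "g' \<in> carrier G" "g = h g'" using \<open>g \<in> carrier H\<close> surj by blast
    have "h (comm_elt G z g') = \<one>\<^bsub>H\<^esub>" using n z(1) g'(1) by (intro triv G.comm_elt_lcs_Suc)
    then have "comm_elt H (h z) g = \<one>\<^bsub>H\<^esub>" using hom_comm_elt[OF z(2) g'(1)] g'(2) by simp
    then have "comm_elt H (h z) g \<otimes>\<^bsub>H\<^esub> g \<otimes>\<^bsub>H\<^esub> h z = \<one>\<^bsub>H\<^esub> \<otimes>\<^bsub>H\<^esub> g \<otimes>\<^bsub>H\<^esub> h z" by simp
    then show ?thesis using z(2) that by (simp add: H.word_simps)
  qed
  ultimately show ?thesis
    using H.conj_central_mult[OF a, of "h y" "h z" e] y z e by simp
qed

lemma hom_factors: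
  assumes p: "group_hom A G p" and f: "group_hom A H f" and surj: "p ` carrier A = carrier G"
    and ker: "\<And>v. v \<in> carrier A \<Longrightarrow> p v = \<one>\<^bsub>G\<^esub> \<Longrightarrow> f v = \<one>\<^bsub>H\<^esub>"
  shows "\<exists>\<phi>\<in>hom G H. \<forall>v\<in>carrier A. \<phi> (p v) = f v"
proof -
  interpret p: group_hom A G p by (rule p)
  interpret f: group_hom A H f by (rule f)
  define \<phi> where "\<phi> g = f (SOME v. v \<in> carrier A \<and> p v = g)" for g
  have eq: "f u = f v" if "u \<in> carrier A" "v \<in> carrier A" "p u = p v" for u v
  proof -
    have "p (u \<otimes>\<^bsub>A\<^esub> inv\<^bsub>A\<^esub> v) = \<one>\<^bsub>G\<^esub>" using that by simp
    then have "f (u \<otimes>\<^bsub>A\<^esub> inv\<^bsub>A\<^esub> v) = \<one>\<^bsub>H\<^esub>" using that by (intro ker) auto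
    then have "f u \<otimes>\<^bsub>H\<^esub> inv\<^bsub>H\<^esub> f v = \<one>\<^bsub>H\<^esub>" using that by simp
    then show ?thesis using that f.H.inv_solve_right'[of "\<one>\<^bsub>H\<^esub>" "f u" "f v"] by simp
  qed
  have \<phi>: "\<phi> (p v) = f v" if "v \<in> carrier A" for v
  proof -
    have "\<exists>u. u \<in> carrier A \<and> p u = p v" using that by blast
    then show ?thesis unfolding \<phi>_def using eq that by (metis (mono_tags, lifting) someI_ex)
  qed
  have "\<phi> \<in> hom G H"
  proof (rule homI)
    fix x assume "x \<in> carrier G"
    then obtain u where u: "u \<in> carrier A" "x = p u" using surj by blast
    then show "\<phi> x \<in> carrier H" using \<phi> by simp
    fix y assume "y \<in> carrier G"
    then obtain v where v: "v \<in> carrier A" "y = p v" using surj by blast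
    have "\<phi> (p (u \<otimes>\<^bsub>A\<^esub> v)) = f (u \<otimes>\<^bsub>A\<^esub> v)" using u v by (intro \<phi>) auto
    then show "\<phi> (x \<otimes>\<^bsub>G\<^esub> y) = \<phi> x \<otimes>\<^bsub>H\<^esub> \<phi> y" using u v \<phi> by simp
  qed
  then show ?thesis using \<phi> by blast
qed

lemma (in group_hom) induces_isoI:
  assumes "h ` carrier G = carrier H" "kernel G H h = N"
  shows "induces_iso G N H h"
  unfolding induces_iso_def
proof (intro conjI bexI ballI)
  show "h \<in> hom G H" by (rule homh)
  show "(\<lambda>X. the_elem (h ` X)) \<in> iso (G Mod N) H"
    using FactGroup_iso_set[OF assms(1)] unfolding assms(2) .
  fix g assume g: "g \<in> carrier G"
  have N: "subgroup N G" using subgroup_kernel unfolding assms(2) .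
  have "h x = h g" if x: "x \<in> N #> g" for x
  proof -
    obtain n where n: "n \<in> N" "x = n \<otimes> g" using x unfolding r_coset_def by blast
    then have "n \<in> carrier G" "h n = \<one>\<^bsub>H\<^esub>" using assms(2) by (auto simp: kernel_def)
    then show ?thesis using n g by simp
  qed
  then have "h ` (N #> g) = {h g}" using G.rcos_self[OF g N] by blast
  then show "the_elem (h ` (N #> g)) = h g" by simp
qed

section \<open>Chains of conjugates\<close>

lemma (in group) arc_chain_closed:
  assumes "x \<in> carrier G" "\<And>i. 1 \<le> i \<Longrightarrow> i < k \<Longrightarrow> b i \<in> carrier G"
  shows "arc_chain G x b e k \<in> carrier G"
  using assms(2)
proof (induction k rule: less_induct)
  case (less k)
  consider "k = 0" | "k = Suc 0" | i where "k = Suc (Suc i)" by (metis not0_implies_Suc)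
  then show ?case
    by cases (use less assms(1) in simp_all)
qed

lemma (in group_hom) arc_chain_hom:
  assumes "x \<in> carrier G" "\<And>i. 1 \<le> i \<Longrightarrow> i < k \<Longrightarrow> b i \<in> carrier G"
  shows "h (arc_chain G x b e k) = arc_chain H (h x) (\<lambda>i. h (b i)) e k"
  using assms
proof (induction k rule: less_induct)
  case (less k)
  consider "k = 0" | "k = Suc 0" | i where "k = Suc (Suc i)" by (metis not0_implies_Suc)
  then show ?case
  proof cases
    case 3
    have "b (Suc i) \<in> carrier G" "arc_chain G x b e (Suc i) \<in> carrier G"
      using less.prems 3 by (auto intro!: G.arc_chain_closed)
    then show ?thesis using 3 less.IH[of "Suc i"] less.prems by (simp add: hom_int_pow)
  qed simp_all
qed

lemma arc_chain_cong:
  assumes "\<And>i. 1 \<le> i \<Longrightarrow> i < k \<Longrightarrow> b i = b' i"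
  shows "arc_chain A x b e k = arc_chain A x b' e k"
  using assms
proof (induction k rule: less_induct)
  case (less k)
  consider "k = 0" | "k = Suc 0" | i where "k = Suc (Suc i)" by (metis not0_implies_Suc)
  then show ?case
    by cases (use less in simp_all)
qed

text \<open>The closing crossing counts as one more step of the chain, so facts about chains also
  cover the classes mu.\<close>

lemma (in group) arc_holonomy_eq:
  assumes "x \<in> carrier G" "\<And>i. 1 \<le> i \<Longrightarrow> i \<le> n \<Longrightarrow> b i \<in> carrier G" "n \<ge> 1"
  shows "arc_holonomy G x b e n = inv x \<otimes> arc_chain G x b e (Suc n)"
proof -
  obtain i where n: "n = Suc i" using assms(3) by (cases n) auto
  have "b n \<in> carrier G" "arc_chain G x b e n \<in> carrier G"
    using assms by (auto intro!: arc_chain_closed)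
  then show ?thesis using assms(1) unfolding n arc_holonomy_def by (simp add: m_assoc)
qed

section \<open>Link groups\<close>

lemma crossing_sign_cases: "crossing_sign q c j k = 1 \<or> crossing_sign q c j k = - 1"
  by (simp add: crossing_sign_def)

lemma arcs_iff: "(j, k) \<in> arcs q c \<longleftrightarrow> j \<in> {1..q} \<and> 1 \<le> k \<and> k \<le> n_arcs q c j"
  by (auto simp: arcs_def)

text \<open>Separates the algebra from the topology: from here on the link enters only through a
  presented group and the combinatorics of its arcs.\<close>

locale wirtinger_group = group G for G :: "('a, 'b) monoid_scheme" (structure) +
  fixes q :: nat and c :: "nat \<Rightarrow> real \<Rightarrow> R3" and w :: "nat \<times> nat \<Rightarrow> 'a"
  assumes n_arcs_pos: "j \<in> {1..q} \<Longrightarrow> n_arcs q c j \<ge> 1"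
    and over_arc_arcs: "(j, k) \<in> arcs q c \<Longrightarrow> over_arc q c j k \<in> arcs q c"
    and wirtinger: "wirtinger_generators q c G w"
begin

abbreviation A where "A \<equiv> free_group (arcs q c)"

abbreviation F where "F \<equiv> FG q"

sublocale A: group A by (rule free_group_is_group)

sublocale F: group F by (rule free_group_is_group)

abbreviation \<epsilon> where "\<epsilon> \<equiv> crossing_sign q c"

abbreviation relator where
  "relator j k \<equiv> inv\<^bsub>A\<^esub> (fgen (next_arc q c j k)) \<otimes>\<^bsub>A\<^esub>
     conj_pow A (fgen (over_arc q c j k)) (\<epsilon> j k) (fgen (j, k))"

lemma w_closed: "a \<in> arcs q c \<Longrightarrow> w a \<in> carrier G"
  using wirtinger unfolding wirtinger_generators_def is_presentation_def by blast

lemma meridian_arc: "j \<in> {1..q} \<Longrightarrow> (j, 1) \<in> arcs q c"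
  using n_arcs_pos by (simp add: arcs_iff)

lemma next_arc_arcs: "(j, k) \<in> arcs q c \<Longrightarrow> next_arc q c j k \<in> arcs q c"
  by (auto simp: arcs_iff next_arc_def)

lemma lift_group_hom:
  assumes "group H" "y ` arcs q c \<subseteq> carrier H"
  shows "group_hom A H (free_lift H y)"
  using assms by (rule group.free_lift_group_hom)

lemma lift_relator:
  assumes H: "group H" and y: "y ` arcs q c \<subseteq> carrier H" and jk: "(j, k) \<in> arcs q c"
  shows "free_lift H y (relator j k) =
    inv\<^bsub>H\<^esub> (y (next_arc q c j k)) \<otimes>\<^bsub>H\<^esub>
      (conj_pow H (y (over_arc q c j k)) (\<epsilon> j k) (y (j, k)))"
proof -
  interpret h: group_hom A H "free_lift H y" using H y by (rule lift_group_hom)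
  have fg: "fgen a \<in> carrier A" "free_lift H y (fgen a) = y a" if "a \<in> arcs q c" for a
    using that y by (auto intro!: fgen_carrier group.free_lift_fgen[OF H])
  show ?thesis
    using fg[OF jk] fg[OF next_arc_arcs[OF jk]] fg[OF over_arc_arcs[OF jk]]
    by (simp add: h.hom_int_pow)
qed

lemma relators_subset: "wirtinger_relators q c \<subseteq> carrier A"
  unfolding wirtinger_relators_def Let_def
proof (clarify)
  fix j k assume jk: "(j, k) \<in> arcs q c"
  show "relator j k \<in> carrier A"
    using fgen_carrier[OF jk] fgen_carrier[OF next_arc_arcs[OF jk]] fgen_carrier[OF over_arc_arcs[OF jk]]
    by simp
qed

lemma wirtinger_relation:
  assumes jk: "(j, k) \<in> arcs q c"
  shows "w (next_arc q c j k) =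
    conj_pow G (w (over_arc q c j k)) (\<epsilon> j k) (w (j, k))"
proof -
  let ?r = "relator j k"
  have "?r \<in> wirtinger_relators q c" using jk unfolding wirtinger_relators_def Let_def by blast
  then have "?r \<in> kernel A G (free_lift G w)"
    using A.normal_closure_incl[OF relators_subset] wirtinger
    unfolding wirtinger_generators_def is_presentation_def by blast
  then have "inv (w (next_arc q c j k)) \<otimes>
      (conj_pow G (w (over_arc q c j k)) (\<epsilon> j k) (w (j, k))) = \<one>"
    using lift_relator[OF is_group image_subsetI jk, of w] w_closed by (simp add: kernel_def)
  then have "conj_pow G (w (over_arc q c j k)) (\<epsilon> j k) (w (j, k)) =
      w (next_arc q c j k)"
    using w_closed[OF jk] w_closed[OF next_arc_arcs[OF jk]] w_closed[OF over_arc_arcs[OF jk]]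
    by (simp add: inv_solve_left')
  then show ?thesis by simp
qed

text \<open>The universal property of the Wirtinger presentation; it is the source of the
  homomorphism of each new level.\<close>

lemma hom_extension:
  assumes H: "group H" and y: "y ` arcs q c \<subseteq> carrier H"
    and rel: "\<And>j k. (j, k) \<in> arcs q c \<Longrightarrow> y (next_arc q c j k) =
      conj_pow H (y (over_arc q c j k)) (\<epsilon> j k) (y (j, k))"
  shows "\<exists>\<phi>\<in>hom G H. \<forall>a\<in>arcs q c. \<phi> (w a) = y a"
proof -
  interpret H: group H by (rule H)
  have w: "w ` arcs q c \<subseteq> carrier G" using w_closed by blast
  interpret p: group_hom A G "free_lift G w" using is_group w by (rule lift_group_hom)
  interpret f: group_hom A H "free_lift H y" using H y by (rule lift_group_hom)
  have pres: "generate G (w ` arcs q c) = carrier G"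
    "kernel A G (free_lift G w) = normal_closure A (wirtinger_relators q c)"
    using wirtinger unfolding wirtinger_generators_def is_presentation_def by blast+
  have "wirtinger_relators q c \<subseteq> kernel A H (free_lift H y)"
  proof
    fix r assume r: "r \<in> wirtinger_relators q c"
    then obtain j k where jk: "(j, k) \<in> arcs q c" and "r = relator j k"
      unfolding wirtinger_relators_def Let_def by blast
    then have "free_lift H y r = inv\<^bsub>H\<^esub> (y (next_arc q c j k)) \<otimes>\<^bsub>H\<^esub> y (next_arc q c j k)"
      using lift_relator[OF H y jk] rel[OF jk] by simp
    also have "\<dots> = \<one>\<^bsub>H\<^esub>" using y next_arc_arcs[OF jk] by (intro H.l_inv) blast
    finally show "r \<in> kernel A H (free_lift H y)" using r relators_subset by (auto simp: kernel_def)
  qed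
  then have ker: "kernel A G (free_lift G w) \<subseteq> kernel A H (free_lift H y)"
    unfolding pres(2) by (rule A.normal_closure_minimal[OF f.normal_kernel])
  have "\<exists>\<phi>\<in>hom G H. \<forall>v\<in>carrier A. \<phi> (free_lift G w v) = free_lift H y v"
  proof (rule hom_factors[OF p.group_hom_axioms f.group_hom_axioms])
    show "free_lift G w ` carrier A = carrier G" using free_lift_image[OF w] pres(1) by simp
  qed (use ker in \<open>auto simp: kernel_def\<close>)
  then obtain \<phi> where \<phi>: "\<phi> \<in> hom G H" "\<And>v. v \<in> carrier A \<Longrightarrow> \<phi> (free_lift G w v) = free_lift H y v" by blast
  have "\<phi> (w a) = y a" if a: "a \<in> arcs q c" for a
  proof -
    have "free_lift G w (fgen a) = w a" using w_closed[OF a] by (rule free_lift_fgen)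
    moreover have "free_lift H y (fgen a) = y a" using y a by (intro H.free_lift_fgen) blast
    ultimately show ?thesis using \<phi>(2)[OF fgen_carrier[OF a]] by simp
  qed
  then show ?thesis using \<phi>(1) by blast
qed

definition \<psi> where "\<psi> = free_lift G (meridian w)"

lemma meridian_closed: "meridian w ` {1..q} \<subseteq> carrier G"
  using w_closed meridian_arc by blast

sublocale \<psi>: group_hom F G \<psi>
  unfolding \<psi>_def using meridian_closed by (rule free_lift_group_hom)

lemma \<psi>_fgen: "j \<in> {1..q} \<Longrightarrow> \<psi> (fgen j) = meridian w j"
  unfolding \<psi>_def using meridian_closed by (intro free_lift_fgen) blast

text \<open>Each crossing replaces a by d a d^-1 = [d,a] a, so passing from arc to arc only collects
  factors in Gamma_2.\<close>

lemma arc_conj_meridian: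
  assumes "(j, k) \<in> arcs q c"
  shows "w (j, k) \<otimes> inv (meridian w j) \<in> lcs G 2"
proof -
  have "1 \<le> k" using assms by (simp add: arcs_iff)
  then show ?thesis
    using assms
  proof (induction k rule: nat_induct_at_least)
    case base
    then show ?case using w_closed by (simp add: lcs_closed)
  next
    case (Suc k)
    have jk: "(j, k) \<in> arcs q c" and next_jk: "next_arc q c j k = (j, Suc k)"
      using Suc by (auto simp: arcs_iff next_arc_def)
    let ?a = "w (j, k)" and ?m = "meridian w j" and ?b = "w (over_arc q c j k)"
    have j: "j \<in> {1..q}" using jk by (simp add: arcs_iff)
    have cl: "?a \<in> carrier G" "?m \<in> carrier G" "?b \<in> carrier G"
      using w_closed jk over_arc_arcs[OF jk] meridian_arc[OF j] by auto
    have pow: "x [^] (- 1 :: int) = inv x" if "x \<in> carrier G" for x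
      using that int_pow_neg[of x 1] by simp
    obtain d where d: "d \<in> carrier G" "w (j, Suc k) = d \<otimes> ?a \<otimes> inv d"
    proof (cases "\<epsilon> j k = 1")
      case True
      then show ?thesis
        using wirtinger_relation[OF jk] next_jk cl that[of "inv ?b"] by (simp add: pow)
    next
      case False
      then show ?thesis
        using wirtinger_relation[OF jk] next_jk crossing_sign_cases[of q c j k] cl that[of ?b]
        by (simp add: pow)
    qed
    have "comm_elt G d ?a \<in> lcs G (Suc 1)"
      using comm_elt_lcs_Suc[of 1 ?a d] comm_elt_lcs_Suc[of 1 d ?a] d(1) cl by (simp add: One_nat_def)
    then have "comm_elt G d ?a \<otimes> (?a \<otimes> inv ?m) \<in> lcs G 2"
      using Suc.IH[OF jk] by (simp add: lcs_closed numeral_2_eq_2 One_nat_def)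
    moreover have "comm_elt G d ?a \<otimes> (?a \<otimes> inv ?m) = w (j, Suc k) \<otimes> inv ?m"
      using d cl by (simp add: word_simps)
    ultimately show ?case by simp
  qed
qed

lemma meridians_generate_mod_2:
  assumes "g \<in> carrier G"
  shows "\<exists>v\<in>carrier F. g \<otimes> inv (\<psi> v) \<in> lcs G 2"
proof -
  let ?S = "{g \<in> carrier G. \<exists>v\<in>carrier F. g \<otimes> inv (\<psi> v) \<in> lcs G 2}"
  have "w ` arcs q c \<subseteq> ?S"
  proof (rule image_subsetI)
    fix a assume a: "a \<in> arcs q c"
    obtain j k where jk: "a = (j, k)" by (cases a)
    have j: "j \<in> {1..q}" using a jk by (simp add: arcs_iff)
    then show "w a \<in> ?S"
      using arc_conj_meridian[of j k] a jk w_closed[OF a] \<psi>_fgen[OF j] fgen_carrier[OF j]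
      by (auto intro!: bexI[of _ "fgen j"])
  qed
  then have "generate G (w ` arcs q c) \<subseteq> ?S"
    by (intro generate_subgroup_incl \<psi>.image_mod_subgroup lcs_normal F.subgroup_self)
  then show ?thesis
    using assms wirtinger unfolding wirtinger_generators_def is_presentation_def by blast
qed

lemma meridians_generate:
  "n \<ge> 1 \<Longrightarrow> g \<in> carrier G \<Longrightarrow> \<exists>v\<in>carrier F. g \<otimes> inv (\<psi> v) \<in> lcs G n"
  using \<psi>.generated_mod_lcs meridians_generate_mod_2 by blast

lemma meridians_generate_lcs:
  "n \<ge> 1 \<Longrightarrow> g \<in> lcs G n \<Longrightarrow> \<exists>v\<in>lcs F n. g \<otimes> inv (\<psi> v) \<in> lcs G (Suc n)"
  using \<psi>.lcs_generated_mod meridians_generate_mod_2 by blast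

section \<open>The quotients of Im(Upsilon_h) and the kernel of the map at one level\<close>

abbreviation I where "I h \<equiv> ImUps q h"

abbreviation \<Upsilon> where "\<Upsilon> h \<equiv> Ups q h"

abbreviation ncl where "ncl h K \<equiv> normal_closure (I h) K"

abbreviation Q where "Q h K \<equiv> I h Mod ncl h K"

abbreviation proj where "proj h K v \<equiv> ncl h K #>\<^bsub>I h\<^esub> \<Upsilon> h v"

abbreviation quot_chain where
  "quot_chain h K B j \<equiv> arc_chain (Q h K) (proj h K (fgen j)) (\<lambda>k. ncl h K #>\<^bsub>I h\<^esub> B j k) (\<epsilon> j)"

abbreviation quot_holonomy where
  "quot_holonomy h K B j \<equiv>
     arc_holonomy (Q h K) (proj h K (fgen j)) (\<lambda>k. ncl h K #>\<^bsub>I h\<^esub> B j k) (\<epsilon> j) (n_arcs q c j)"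

lemma ncl_normal: "K \<subseteq> carrier (I h) \<Longrightarrow> ncl h K \<lhd> I h"
  using group.normal_closure_normal[OF ImUps_group] .

text \<open>The invariant of the induction: elements of \<open>K\<close> are true relations of the
  meridians modulo Gamma_h. Any two preimages of an element differ by Gamma_hF, which
  \<open>\<psi>\<close> maps into Gamma_h, so no choice of preimage matters.\<close>

definition relations_hold :: "nat \<Rightarrow> lpoly mat set \<Rightarrow> bool" where
  "relations_hold h K \<longleftrightarrow> (\<forall>v\<in>carrier F. \<Upsilon> h v \<in> K \<longrightarrow> \<psi> v \<in> lcs G h)"

definition stage :: "nat \<Rightarrow> lpoly mat set \<Rightarrow> ('a \<Rightarrow> lpoly mat set) \<Rightarrow> bool" where
  "stage h K \<phi> \<longleftrightarrow> K \<subseteq> carrier (I h) \<and> \<phi> \<in> hom G (Q h K) \<and>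
     (\<forall>j\<in>{1..q}. \<phi> (meridian w j) = proj h K (fgen j))"

lemma proj_group_hom:
  assumes "K \<subseteq> carrier (I h)"
  shows "group_hom F (Q h K) (\<lambda>v. proj h K v)"
proof -
  interpret U: group_hom F "I h" "\<Upsilon> h" by (rule Ups_group_hom)
  interpret p: group_hom "I h" "Q h K" "\<lambda>x. ncl h K #>\<^bsub>I h\<^esub> x"
    using ncl_normal[OF assms] by (rule group.rcos_group_hom[OF ImUps_group])
  show ?thesis
    using Group.hom_compose[OF U.homh p.homh]
    by (simp add: group_hom_def group_hom_axioms_def F.is_group p.H.is_group comp_def)
qed

lemma proj_surj: "(\<lambda>v. proj h K v) ` carrier F = carrier (Q h K)"
  unfolding carrier_FactGroup ImUps_simps image_image ..

lemma proj_eq_iff: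
  assumes "K \<subseteq> carrier (I h)" "u \<in> carrier F" "v \<in> carrier F"
  shows "proj h K u = proj h K v \<longleftrightarrow> \<Upsilon> h (u \<otimes>\<^bsub>F\<^esub> inv\<^bsub>F\<^esub> v) \<in> ncl h K"
proof -
  interpret U: group_hom F "I h" "\<Upsilon> h" by (rule Ups_group_hom)
  show ?thesis
    using U.H.rcos_eq_iff[OF ncl_normal[OF assms(1)], of "\<Upsilon> h u" "\<Upsilon> h v"] assms(2,3) by simp
qed

lemma Ups_lcs: "h \<ge> 1 \<Longrightarrow> v \<in> lcs F h \<Longrightarrow> \<Upsilon> h v = \<one>\<^bsub>I h\<^esub>"
  using Ups_eq_one_iff F.lcs_carrier by (simp add: ImUps_simps)

lemma ncl_Ups:
  assumes "V \<subseteq> carrier F"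
  shows "ncl h (\<Upsilon> h ` V) = \<Upsilon> h ` normal_closure F V"
  using group_hom.normal_closure_img[OF Ups_group_hom _ assms] by (simp add: ImUps_simps)

text \<open>The normal closure is the image of one taken in F, and there \<open>\<psi>\<close> pulls
  Gamma_h back to a normal subgroup. Passing to another preimage costs only a factor in
  Gamma_hF.\<close>

lemma relations_hold_normal_closure:
  assumes h: "h \<ge> 1" and K: "K \<subseteq> carrier (I h)" and rel: "relations_hold h K"
    and v: "v \<in> carrier F" "\<Upsilon> h v \<in> ncl h K"
  shows "\<psi> v \<in> lcs G h"
proof -
  let ?V = "{u \<in> carrier F. \<Upsilon> h u \<in> K}"
  have "K = \<Upsilon> h ` ?V" using K unfolding ImUps_simps by blast
  then have "ncl h K = ncl h (\<Upsilon> h ` ?V)" by (rule arg_cong)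
  also have "\<dots> = \<Upsilon> h ` normal_closure F ?V" by (rule ncl_Ups) blast
  finally have "\<Upsilon> h v \<in> \<Upsilon> h ` normal_closure F ?V" using v(2) by (rule subst)
  then obtain u where u: "u \<in> normal_closure F ?V" "\<Upsilon> h v = \<Upsilon> h u" by (rule imageE)
  have "normal_closure F ?V \<subseteq> {x \<in> carrier F. \<psi> x \<in> lcs G h}"
    using rel by (intro F.normal_closure_minimal \<psi>.vimage_normal lcs_normal) (auto simp: relations_hold_def)
  then have uF: "u \<in> carrier F" and \<psi>u: "\<psi> u \<in> lcs G h" using u(1) by auto
  have "v \<otimes>\<^bsub>F\<^esub> inv\<^bsub>F\<^esub> u \<in> lcs F h" using Ups_eq_iff[OF h v(1) uF] u(2) by simp
  then have "\<psi> (v \<otimes>\<^bsub>F\<^esub> inv\<^bsub>F\<^esub> u) \<in> lcs G h" using \<psi>.lcs_img_subset by blast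
  then have "\<psi> v \<otimes> inv (\<psi> u) \<otimes> \<psi> u \<in> lcs G h" using \<psi>u uF v(1) by (simp add: lcs_closed(2))
  then show ?thesis using uF v(1) by (simp add: m_assoc)
qed

text \<open>Two homomorphisms on F with the same values on the generators. The equation turns
  statements about \<open>\<phi>\<close> into statements about words in the meridians.\<close>

lemma stage_\<psi>:
  assumes "stage h K \<phi>" "v \<in> carrier F"
  shows "\<phi> (\<psi> v) = proj h K v"
proof (rule free_group_hom_eqI[OF _ _ _ assms(2)])
  have K: "K \<subseteq> carrier (I h)" and hom: "\<phi> \<in> hom G (Q h K)" using assms(1) by (simp_all add: stage_def)
  show "group_hom F (Q h K) (\<lambda>v. proj h K v)" using K by (rule proj_group_hom)
  then interpret p: group_hom F "Q h K" "\<lambda>v. proj h K v" .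
  show "group_hom F (Q h K) (\<lambda>v. \<phi> (\<psi> v))"
    using Group.hom_compose[OF \<psi>.homh hom]
    by (simp add: group_hom_def group_hom_axioms_def F.is_group p.H.is_group comp_def)
  show "\<phi> (\<psi> (fgen j)) = proj h K (fgen j)" if "j \<in> {1..q}" for j
    using that assms(1) \<psi>_fgen by (simp add: stage_def)
qed

lemma stage_surj:
  assumes "stage h K \<phi>"
  shows "\<phi> ` carrier G = carrier (Q h K)"
proof
  have hom: "\<phi> \<in> hom G (Q h K)" using assms by (simp add: stage_def)
  then show "\<phi> ` carrier G \<subseteq> carrier (Q h K)" by (auto simp: hom_def)
  show "carrier (Q h K) \<subseteq> \<phi> ` carrier G"
    unfolding proj_surj[symmetric]
  proof (rule image_subsetI)
    fix v assume v: "v \<in> carrier F"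
    show "proj h K v \<in> \<phi> ` carrier G"
      using stage_\<psi>[OF assms v] v by (intro image_eqI[where f = \<phi> and x = "\<psi> v"]) simp_all
  qed
qed

text \<open>Gamma_h dies because the target is a quotient of F/Gamma_hF. Conversely an element of
  the kernel is \<open>\<psi> v\<close> modulo Gamma_h with \<open>\<Upsilon> h v\<close> in the
  normal closure of \<open>K\<close>, and such words v are mapped into Gamma_h.\<close>

lemma stage_kernel:
  assumes h: "h \<ge> 1" and st: "stage h K \<phi>" and rel: "relations_hold h K"
  shows "kernel G (Q h K) \<phi> = lcs G h"
proof -
  have K: "K \<subseteq> carrier (I h)" and hom: "\<phi> \<in> hom G (Q h K)" using st by (simp_all add: stage_def)
  interpret p: group_hom F "Q h K" "\<lambda>v. proj h K v" using K by (rule proj_group_hom)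
  interpret f: group_hom G "Q h K" \<phi>
    by (simp add: group_hom_def group_hom_axioms_def is_group p.H.is_group hom)
  interpret U: group_hom F "I h" "\<Upsilon> h" by (rule Ups_group_hom)
  have one: "ncl h K #>\<^bsub>I h\<^esub> \<one>\<^bsub>I h\<^esub> = \<one>\<^bsub>Q h K\<^esub>"
    using ncl_normal[OF K] by (simp add: normal_imp_subgroup subgroup.subset)
  have triv: "\<phi> g = \<one>\<^bsub>Q h K\<^esub>" if g: "g \<in> lcs G h" for g
  proof -
    have "\<phi> g \<in> lcs (Q h K) h" using f.lcs_img_subset g by blast
    also have "lcs (Q h K) h = (\<lambda>v. proj h K v) ` lcs F h"
      using p.lcs_img[OF proj_surj] by simp
    finally show ?thesis using Ups_lcs[OF h] one by auto
  qed
  have "g \<in> lcs G h" if g: "g \<in> carrier G" "\<phi> g = \<one>\<^bsub>Q h K\<^esub>" for g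
  proof -
    obtain v where v: "v \<in> carrier F" "g \<otimes> inv (\<psi> v) \<in> lcs G h" using meridians_generate[OF h g(1)] by blast
    have "\<phi> (g \<otimes> inv (\<psi> v)) = \<one>\<^bsub>Q h K\<^esub>" using v(2) by (rule triv)
    then have "inv\<^bsub>Q h K\<^esub> (\<phi> (\<psi> v)) = \<one>\<^bsub>Q h K\<^esub>" using g v(1) by (simp del: one_FactGroup)
    then have "\<phi> (\<psi> v) = \<one>\<^bsub>Q h K\<^esub>" using v(1) by (metis p.H.inv_inv p.H.inv_one f.hom_closed \<psi>.hom_closed)
    then have "proj h K v = ncl h K" using stage_\<psi>[OF st v(1)] by simp
    then have "\<Upsilon> h v \<in> ncl h K"
      using U.H.rcos_eq_normal_iff[OF ncl_normal[OF K]] v(1) by simp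
    then have "\<psi> v \<in> lcs G h" by (rule relations_hold_normal_closure[OF h K rel v(1)])
    then have "g \<otimes> inv (\<psi> v) \<otimes> \<psi> v \<in> lcs G h" using v(2) by (rule lcs_closed(2)[rotated])
    then show ?thesis using g(1) v(1) by (simp add: m_assoc)
  qed
  then show ?thesis using triv lcs_subset[of h] by (auto simp: kernel_def)
qed

lemma stage_eq_iff:
  assumes h: "h \<ge> 1" and st: "stage h K \<phi>" and rel: "relations_hold h K"
    and g: "g \<in> carrier G" "g' \<in> carrier G"
  shows "\<phi> g = \<phi> g' \<longleftrightarrow> g \<otimes> inv g' \<in> lcs G h"
proof -
  have K: "K \<subseteq> carrier (I h)" and hom: "\<phi> \<in> hom G (Q h K)" using st by (simp_all add: stage_def)
  interpret p: group_hom F "Q h K" "\<lambda>v. proj h K v" using K by (rule proj_group_hom)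
  interpret f: group_hom G "Q h K" \<phi>
    by (simp add: group_hom_def group_hom_axioms_def is_group p.H.is_group hom)
  have "\<phi> g = \<phi> g' \<longleftrightarrow> \<phi> (g \<otimes> inv g') = \<one>\<^bsub>Q h K\<^esub>"
    using g by (simp add: p.H.inv_solve_right' del: one_FactGroup)
  also have "\<dots> \<longleftrightarrow> g \<otimes> inv g' \<in> kernel G (Q h K) \<phi>" using g by (simp add: kernel_def)
  finally show ?thesis unfolding stage_kernel[OF h st rel] .
qed

lemma stage_induces_iso:
  assumes "h \<ge> 1" "stage h K \<phi>" "relations_hold h K"
  shows "induces_iso G (lcs G h) (Q h K) \<phi>"
proof -
  have K: "K \<subseteq> carrier (I h)" and hom: "\<phi> \<in> hom G (Q h K)" using assms(2) by (simp_all add: stage_def)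
  interpret p: group_hom F "Q h K" "\<lambda>v. proj h K v" using K by (rule proj_group_hom)
  interpret f: group_hom G "Q h K" \<phi>
    by (simp add: group_hom_def group_hom_axioms_def is_group p.H.is_group hom)
  show ?thesis using stage_surj[OF assms(2)] stage_kernel[OF assms] by (rule f.induces_isoI)
qed

end

section \<open>Passing from level h to level h + 1\<close>

lemma arc_chain_Suc:
  "k \<ge> 1 \<Longrightarrow> arc_chain A x b e (Suc k) = conj_pow A (b k) (e k) (arc_chain A x b e k)"
  by (cases k) simp_all

context wirtinger_group
begin

text \<open>A single passage of the construction, with the data as single objects instead of
  families in h, so that it can be iterated by dependent choice.\<close>

definition step ::
    "nat \<Rightarrow> lpoly mat set \<Rightarrow> ('a \<Rightarrow> lpoly mat set) \<Rightarrow> (lpoly mat \<Rightarrow> lpoly mat) \<Rightarrow> (nat \<Rightarrow> nat \<Rightarrow> lpoly mat) \<Rightarrow>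
     (nat \<Rightarrow> lpoly mat) \<Rightarrow> lpoly mat set \<Rightarrow> ('a \<Rightarrow> lpoly mat set) \<Rightarrow> bool" where
  "step h K \<phi> s B \<rho> K' \<phi>' \<longleftrightarrow>
     (\<forall>M\<in>carrier (I h). s M \<in> carrier (I (h + 1)) \<and> pUps q h (s M) = M) \<and>
     (\<forall>(j, k)\<in>arcs q c. B j k \<in> carrier (I (h + 1)) \<and>
        ncl h K #>\<^bsub>I h\<^esub> pUps q h (B j k) = \<phi> (w (over_arc q c j k))) \<and>
     (\<forall>j\<in>{1..q}. \<rho> j \<in> \<Upsilon> (h + 1) ` lcs F h \<and>
        ncl (h + 1) (s ` K) #>\<^bsub>I (h + 1)\<^esub> \<rho> j =
          quot_holonomy (h + 1) (s ` K) B j) \<and>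
     K' = s ` K \<union> \<rho> ` {1..q} \<and> \<phi>' \<in> hom G (Q (h + 1) K') \<and>
     (\<forall>(j, k)\<in>arcs q c. \<phi>' (w (j, k)) = coset_proj (I (h + 1)) (ncl (h + 1) K')
        (quot_chain (h + 1) (s ` K) B j k))"

lemma is_construction_iff:
  "is_construction q m c G w f s B \<rho> K \<phi> \<longleftrightarrow> K m = {} \<and>
     (\<forall>g\<in>carrier G. \<phi> m g = ncl m {} #>\<^bsub>I m\<^esub> Ups_bar q m (f m g)) \<and>
     (\<forall>h\<ge>m. step h (K h) (\<phi> h) (s h) (B h) (\<rho> h) (K (h + 1)) (\<phi> (h + 1)))"
  unfolding is_construction_def step_def Nsub_def Ssub_def Ccls_def mu_bar_def Let_def by auto

lemma lifts_relations_iff: "lifts_relations q G w s K h \<longleftrightarrow> relations_hold (h + 1) (s h ` K h)"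
  unfolding lifts_relations_def relations_hold_def \<psi>_def by simp

text \<open>The elements B_k pulled back to words in F. Agreement with the over-passing arc modulo
  Gamma_h is what a lift along p_h provides.\<close>

definition over_lift :: "nat \<Rightarrow> (nat \<Rightarrow> nat \<Rightarrow> (nat \<times> bool) list) \<Rightarrow> bool" where
  "over_lift h b \<longleftrightarrow> (\<forall>(j, k)\<in>arcs q c. b j k \<in> carrier F \<and> \<psi> (b j k) \<otimes> inv (w (over_arc q c j k)) \<in> lcs G h)"

abbreviation chain where "chain b j k \<equiv> arc_chain F (fgen j) (b j) (\<epsilon> j) k"

lemma over_liftD:
  assumes "over_lift h b" "(j, k) \<in> arcs q c"
  shows "b j k \<in> carrier F" "\<psi> (b j k) \<otimes> inv (w (over_arc q c j k)) \<in> lcs G h"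
  using assms unfolding over_lift_def by auto

lemma over_lift_closed:
  assumes "over_lift h b" "j \<in> {1..q}" "1 \<le> i" "i < k" "k \<le> Suc (n_arcs q c j)"
  shows "b j i \<in> carrier F"
  using over_liftD(1)[OF assms(1), of j i] assms by (simp add: arcs_iff)

lemma chain_closed:
  assumes "over_lift h b" "j \<in> {1..q}" "k \<le> Suc (n_arcs q c j)"
  shows "chain b j k \<in> carrier F"
  using assms over_lift_closed[OF assms(1,2) _ _ assms(3)]
  by (intro F.arc_chain_closed fgen_carrier) auto

text \<open>Replacing the over-passing arc by its word changes the conjugator by an element of
  Gamma_h, which conjugation modulo Gamma_(h+1) does not see; each step then matches a Wirtinger
  relation. Index N + 1 stands for the first arc, reached again after the last crossing.\<close>

lemma chain_arc:
  assumes h: "h \<ge> 1" and b: "over_lift h b" and j: "j \<in> {1..q}"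
    and k: "1 \<le> k" "k \<le> Suc (n_arcs q c j)"
  shows "\<psi> (chain b j k) \<otimes> inv (w (j, if k = Suc (n_arcs q c j) then 1 else k)) \<in> lcs G (Suc h)"
  using k
proof (induction k rule: nat_induct_at_least)
  case base
  then show ?case
    using n_arcs_pos[OF j] \<psi>_fgen[OF j] w_closed[OF meridian_arc[OF j]] by (simp add: lcs_closed One_nat_def)
next
  case (Suc k)
  let ?N = "lcs G (Suc h)"
  interpret \<pi>: group_hom G "G Mod ?N" "\<lambda>x. ?N #> x" by (rule rcos_group_hom[OF lcs_normal])
  have jk: "(j, k) \<in> arcs q c" using Suc j by (simp add: arcs_iff)
  let ?o = "w (over_arc q c j k)" and ?C = "chain b j k" and ?e = "\<epsilon> j k"
  have cl: "w (j, k) \<in> carrier G" "?o \<in> carrier G" "b j k \<in> carrier F" "?C \<in> carrier F"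
    using w_closed[OF jk] w_closed[OF over_arc_arcs[OF jk]] over_liftD(1)[OF b jk] chain_closed[OF b j, of k] Suc.prems
    by auto
  have next_jk: "next_arc q c j k = (j, if Suc k = Suc (n_arcs q c j) then 1 else Suc k)"
    by (simp add: next_arc_def)
  have IH: "?N #> \<psi> ?C = ?N #> w (j, k)"
    using Suc cl rcos_eq_iff[OF lcs_normal, of "\<psi> ?C" "w (j, k)" "Suc h"] by simp
  have "?N #> \<psi> (chain b j (Suc k)) =
      conj_pow (G Mod ?N) (?N #> \<psi> (b j k)) ?e (?N #> \<psi> ?C)"
    using cl by (simp add: arc_chain_Suc[OF Suc.hyps] \<psi>.hom_int_pow \<pi>.hom_int_pow)
  also have "\<dots> = conj_pow (G Mod ?N) (?N #> ?o) ?e (?N #> w (j, k))"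
    unfolding IH
  proof (rule \<pi>.conj_mod_lcs[OF h])
    show "?N #> x = \<one>\<^bsub>G Mod ?N\<^esub>" if "x \<in> ?N" for x
      using that rcos_eq_normal_iff[OF lcs_normal lcs_carrier] by simp
    show "(\<lambda>x. ?N #> x) ` carrier G = carrier (G Mod ?N)" by (simp add: carrier_FactGroup)
    show "\<psi> (b j k) \<otimes> inv ?o \<in> lcs G h" using b jk by (rule over_liftD)
    show "?e = 1 \<or> ?e = - 1" by (rule crossing_sign_cases)
  qed (use cl in auto)
  also have "\<dots> = ?N #> w (next_arc q c j k)"
    using cl by (simp add: wirtinger_relation[OF jk] \<pi>.hom_int_pow)
  finally have "?N #> \<psi> (chain b j (Suc k)) = ?N #> w (next_arc q c j k)" .
  then show ?case
    using rcos_eq_iff[OF lcs_normal, of "\<psi> (chain b j (Suc k))" "w (next_arc q c j k)" "Suc h"]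
      chain_closed[OF b j Suc.prems] w_closed[OF next_arc_arcs[OF jk]] next_jk by simp
qed

abbreviation holonomy where "holonomy b j \<equiv> arc_holonomy F (fgen j) (b j) (\<epsilon> j) (n_arcs q c j)"

lemma holonomy_eq:
  assumes "over_lift h b" "j \<in> {1..q}"
  shows "holonomy b j = inv\<^bsub>F\<^esub> (fgen j) \<otimes>\<^bsub>F\<^esub> chain b j (Suc (n_arcs q c j))"
  using over_lift_closed[OF assms] fgen_carrier[OF assms(2)] n_arcs_pos[OF assms(2)]
  by (intro F.arc_holonomy_eq) auto

lemma holonomy_closed:
  assumes "over_lift h b" "j \<in> {1..q}"
  shows "holonomy b j \<in> carrier F"
  unfolding holonomy_eq[OF assms] using chain_closed[OF assms order.refl] fgen_carrier[OF assms(2)] by simp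

text \<open>Modulo Gamma_(h+1) the chain ends at the meridian from which it started, so the class mu
  is a true relation there.\<close>

lemma holonomy_lcs:
  assumes h: "h \<ge> 1" and b: "over_lift h b" and j: "j \<in> {1..q}"
  shows "\<psi> (holonomy b j) \<in> lcs G (Suc h)"
proof -
  let ?C = "chain b j (Suc (n_arcs q c j))" and ?m = "meridian w j"
  have cl: "?C \<in> carrier F" "?m \<in> carrier G" "fgen j \<in> carrier F"
    using chain_closed[OF b j order.refl] w_closed[OF meridian_arc[OF j]] fgen_carrier[OF j] by auto
  have "\<psi> ?C \<otimes> inv ?m \<in> lcs G (Suc h)"
    using chain_arc[OF h b j, of "Suc (n_arcs q c j)"] by simp
  then have "inv ?m \<otimes> (\<psi> ?C \<otimes> inv ?m) \<otimes> ?m \<in> lcs G (Suc h)"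
    using cl by (intro normal_conj(2)[OF lcs_normal])
  moreover have "\<psi> (holonomy b j) = inv ?m \<otimes> (\<psi> ?C \<otimes> inv ?m) \<otimes> ?m"
    unfolding holonomy_eq[OF b j] using cl \<psi>_fgen[OF j] by (simp add: m_assoc)
  ultimately show ?thesis by simp
qed

lemma proj_chain:
  assumes K: "K \<subseteq> carrier (I n)" and b: "over_lift h b" and j: "j \<in> {1..q}"
    and B: "\<And>k. (j, k) \<in> arcs q c \<Longrightarrow> B j k = \<Upsilon> n (b j k)" and k: "k \<le> Suc (n_arcs q c j)"
  shows "quot_chain n K B j k =
    proj n K (chain b j k)"
proof -
  interpret p: group_hom F "Q n K" "\<lambda>v. proj n K v" using K by (rule proj_group_hom)
  have "proj n K (chain b j k) =
      arc_chain (Q n K) (proj n K (fgen j)) (\<lambda>k. proj n K (b j k)) (\<epsilon> j) k"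
    using over_lift_closed[OF b j _ _ k] fgen_carrier[OF j] by (intro p.arc_chain_hom) auto
  also have "\<dots> = quot_chain n K B j k"
    by (rule arc_chain_cong) (use B k j in \<open>simp add: arcs_iff\<close>)
  finally show ?thesis by simp
qed

lemma proj_holonomy:
  assumes K: "K \<subseteq> carrier (I n)" and b: "over_lift h b" and j: "j \<in> {1..q}"
    and B: "\<And>k. (j, k) \<in> arcs q c \<Longrightarrow> B j k = \<Upsilon> n (b j k)"
  shows "quot_holonomy n K B j =
    proj n K (holonomy b j)"
proof -
  interpret p: group_hom F "Q n K" "\<lambda>v. proj n K v" using K by (rule proj_group_hom)
  have fj: "fgen j \<in> carrier F" using j by (rule fgen_carrier)
  have Bi: "ncl n K #>\<^bsub>I n\<^esub> B j i \<in> carrier (Q n K)" if "1 \<le> i" "i \<le> n_arcs q c j" for i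
    using that B[of i] over_liftD(1)[OF b, of j i] j p.hom_closed[of "b j i"] by (simp add: arcs_iff)
  have "quot_holonomy n K B j =
      inv\<^bsub>Q n K\<^esub> (proj n K (fgen j)) \<otimes>\<^bsub>Q n K\<^esub>
        quot_chain n K B j (Suc (n_arcs q c j))"
    using Bi p.hom_closed[OF fj] n_arcs_pos[OF j] by (intro p.H.arc_holonomy_eq) auto
  also have "quot_chain n K B j (Suc (n_arcs q c j)) =
      proj n K (chain b j (Suc (n_arcs q c j)))"
    using K b j B order.refl by (rule proj_chain)
  also have "inv\<^bsub>Q n K\<^esub> (proj n K (fgen j)) \<otimes>\<^bsub>Q n K\<^esub>
      (proj n K (chain b j (Suc (n_arcs q c j)))) = proj n K (holonomy b j)"
    unfolding holonomy_eq[OF b j]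
    using fj chain_closed[OF b j order.refl] p.hom_mult[of "inv\<^bsub>F\<^esub> (fgen j)"] p.hom_inv[of "fgen j"] by simp
  finally show ?thesis .
qed

lemma coset_proj_proj:
  assumes "K \<subseteq> K'" "K' \<subseteq> carrier (I n)" "v \<in> carrier F"
  shows "coset_proj (I n) (ncl n K') (proj n K v) = proj n K' v"
    "ncl n K \<subseteq> ncl n K'"
proof -
  interpret U: group_hom F "I n" "\<Upsilon> n" by (rule Ups_group_hom)
  have K: "K \<subseteq> carrier (I n)" using assms by blast
  show sub: "ncl n K \<subseteq> ncl n K'"
    using U.H.normal_closure_incl[OF assms(2)] assms(1)
    by (intro U.H.normal_closure_minimal ncl_normal assms(2)) blast
  show "coset_proj (I n) (ncl n K') (proj n K v) = proj n K' v"
    using ncl_normal[OF K] ncl_normal[OF assms(2)] sub assms(3)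
    by (intro U.H.coset_proj_rcos normal_imp_subgroup) auto
qed

text \<open>Elements of \<open>s\<close>
  K\<open>are covered by\<close>lift\<open>. A representative\<close>\<rho> j\<open>differs from the
  image of the holonomy word only by the normal closure of\<close>s \<open>K\<close>, and both the
  difference and the holonomy word go to Gamma_(h+1).\<close>

lemma step_stage:
  assumes h: "h \<ge> 1" and st: "stage h K \<phi>" and rel: "relations_hold h K"
    and step: "step h K \<phi> s B \<rho> K' \<phi>'" and lift: "relations_hold (h + 1) (s ` K)"
  shows "stage (h + 1) K' \<phi>' \<and> relations_hold (h + 1) K'"
proof -
  let ?n = "h + 1" and ?S = "s ` K"
  interpret U: group_hom F "I ?n" "\<Upsilon> ?n" by (rule Ups_group_hom)
  have K: "K \<subseteq> carrier (I h)" using st by (simp add: stage_def)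
  have S: "?S \<subseteq> carrier (I ?n)" using step K unfolding step_def by blast
  have "\<forall>a\<in>arcs q c. \<exists>v. v \<in> carrier F \<and> B (fst a) (snd a) = \<Upsilon> ?n v"
    using step unfolding step_def ImUps_simps by fastforce
  then obtain b' where b': "\<And>a. a \<in> arcs q c \<Longrightarrow> b' a \<in> carrier F \<and> B (fst a) (snd a) = \<Upsilon> ?n (b' a)"
    by metis
  define b where "b j k = b' (j, k)" for j k
  have bF: "b j k \<in> carrier F" and B: "B j k = \<Upsilon> ?n (b j k)" if "(j, k) \<in> arcs q c" for j k
    using b'[OF that] by (simp_all add: b_def)
  \<comment> \<open>The condition on B_k compares only images under \<open>\<phi>\<close>;
    injectivity on G/Gamma_h at the present level makes it a congruence in G.\<close>
  have "\<psi> (b j k) \<otimes> inv (w (over_arc q c j k)) \<in> lcs G h" if jk: "(j, k) \<in> arcs q c" for j k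
  proof -
    have "\<phi> (\<psi> (b j k)) = ncl h K #>\<^bsub>I h\<^esub> pUps q h (B j k)"
      using stage_\<psi>[OF st bF[OF jk]] B[OF jk] pUps_Ups[OF h bF[OF jk]] by simp
    also have "\<dots> = \<phi> (w (over_arc q c j k))" using step jk unfolding step_def by blast
    finally show ?thesis
      using stage_eq_iff[OF h st rel, of "\<psi> (b j k)" "w (over_arc q c j k)"] bF[OF jk] w_closed[OF over_arc_arcs[OF jk]]
      by simp
  qed
  then have b: "over_lift h b" using bF unfolding over_lift_def by blast
  have \<rho>: "\<rho> j \<in> \<Upsilon> ?n ` lcs F h" and \<rho>S: "ncl ?n ?S #>\<^bsub>I ?n\<^esub> \<rho> j = proj ?n ?S (holonomy b j)"
    if j: "j \<in> {1..q}" for j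
    using step j proj_holonomy[where b = b and B = B, OF S b j B] unfolding step_def by auto
  have K': "K' = ?S \<union> \<rho> ` {1..q}" using step unfolding step_def by blast
  have K'I: "K' \<subseteq> carrier (I ?n)"
    unfolding K' ImUps_simps using S \<rho> F.lcs_subset unfolding ImUps_simps by blast
  have "relations_hold ?n K'"
    unfolding relations_hold_def
  proof (intro ballI impI)
    fix v assume v: "v \<in> carrier F" and "\<Upsilon> ?n v \<in> K'"
    then consider "\<Upsilon> ?n v \<in> ?S" | j where "j \<in> {1..q}" "\<Upsilon> ?n v = \<rho> j" unfolding K' by blast
    then show "\<psi> v \<in> lcs G ?n"
    proof cases
      case 1
      then show ?thesis using lift v by (simp add: relations_hold_def)
    next
      case 2
      have hol: "holonomy b j \<in> carrier F" using b 2(1) by (rule holonomy_closed)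
      have "\<Upsilon> ?n (v \<otimes>\<^bsub>F\<^esub> inv\<^bsub>F\<^esub> (holonomy b j)) \<in> ncl ?n ?S"
        using proj_eq_iff[OF S v hol] \<rho>S[OF 2(1)] 2(2) by simp
      then have "\<psi> (v \<otimes>\<^bsub>F\<^esub> inv\<^bsub>F\<^esub> (holonomy b j)) \<in> lcs G ?n"
        using v hol by (intro relations_hold_normal_closure[OF _ S lift]) auto
      moreover have "\<psi> (holonomy b j) \<in> lcs G ?n"
        using holonomy_lcs[OF h b 2(1)] by (simp add: Suc_eq_plus1)
      ultimately have "\<psi> (v \<otimes>\<^bsub>F\<^esub> inv\<^bsub>F\<^esub> (holonomy b j)) \<otimes> \<psi> (holonomy b j) \<in> lcs G ?n"
        by (rule lcs_closed)
      then show ?thesis using v hol by (simp add: m_assoc)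
    qed
  qed
  moreover have "\<phi>' (meridian w j) = proj ?n K' (fgen j)" if j: "j \<in> {1..q}" for j
  proof -
    have "\<phi>' (meridian w j) = coset_proj (I ?n) (ncl ?n K') (proj ?n ?S (fgen j))"
      using step meridian_arc[OF j] unfolding step_def by (fastforce simp: One_nat_def)
    then show ?thesis
      using coset_proj_proj(1)[OF _ K'I fgen_carrier[OF j], of ?S] K' by simp
  qed
  moreover have "\<phi>' \<in> hom G (Q ?n K')" using step unfolding step_def by blast
  ultimately show ?thesis using K'I by (simp add: stage_def)
qed

end

section \<open>Existence of suitable sections and of the construction\<close>

lemma image_preimage_eq: "A \<subseteq> f ` C \<Longrightarrow> f ` {u \<in> C. f u \<in> A} = A"
  by blast

context wirtinger_group
begin

text \<open>If v lies over M and \<open>\<psi> v\<close> is in Gamma_h, then \<open>\<psi> v\<close>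
  equals \<open>\<psi> r\<close> modulo Gamma_(h+1) for some r in Gamma_hF. The word v r^-1 still
  lies over M and is mapped into Gamma_(h+1). The choice depends on M alone, so one section serves
  every \<open>K\<close>.\<close>

lemma section_exists:
  assumes h: "h \<ge> 1"
  shows "\<exists>s. (\<forall>M\<in>carrier (I h). s M \<in> carrier (I (h + 1)) \<and> pUps q h (s M) = M) \<and>
    (\<forall>K\<subseteq>carrier (I h). relations_hold h K \<longrightarrow> relations_hold (h + 1) (s ` K))"
proof -
  interpret U: group_hom F "I h" "\<Upsilon> h" by (rule Ups_group_hom)
  have "\<exists>u. u \<in> carrier F \<and> \<Upsilon> h u = M \<and>
      ((\<exists>v\<in>carrier F. \<Upsilon> h v = M \<and> \<psi> v \<in> lcs G h) \<longrightarrow> \<psi> u \<in> lcs G (h + 1))"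
    if M: "M \<in> carrier (I h)" for M
  proof (cases "\<exists>v\<in>carrier F. \<Upsilon> h v = M \<and> \<psi> v \<in> lcs G h")
    case True
    then obtain v where v: "v \<in> carrier F" "\<Upsilon> h v = M" "\<psi> v \<in> lcs G h" by blast
    obtain r where r: "r \<in> lcs F h" "\<psi> v \<otimes> inv (\<psi> r) \<in> lcs G (Suc h)"
      using meridians_generate_lcs[OF h v(3)] by blast
    have rF: "r \<in> carrier F" using r(1) by (rule F.lcs_carrier)
    have "\<Upsilon> h (v \<otimes>\<^bsub>F\<^esub> inv\<^bsub>F\<^esub> r) = M" using v rF Ups_lcs[OF h r(1)] M by simp
    then show ?thesis
      using v(1) rF r(2) by (intro exI[of _ "v \<otimes>\<^bsub>F\<^esub> inv\<^bsub>F\<^esub> r"]) (simp add: Suc_eq_plus1)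
  next
    case False
    then show ?thesis using M unfolding ImUps_simps by blast
  qed
  then obtain u where u: "\<And>M. M \<in> carrier (I h) \<Longrightarrow> u M \<in> carrier F \<and> \<Upsilon> h (u M) = M \<and>
      ((\<exists>v\<in>carrier F. \<Upsilon> h v = M \<and> \<psi> v \<in> lcs G h) \<longrightarrow> \<psi> (u M) \<in> lcs G (h + 1))"
    by metis
  define s where "s M = \<Upsilon> (h + 1) (u M)" for M
  have sec: "s M \<in> carrier (I (h + 1)) \<and> pUps q h (s M) = M" if M: "M \<in> carrier (I h)" for M
    using u[OF M] pUps_Ups[OF h, of "u M" q] unfolding s_def ImUps_simps by auto
  have "relations_hold (h + 1) (s ` K)" if K: "K \<subseteq> carrier (I h)" and rel: "relations_hold h K" for K
    unfolding relations_hold_def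
  proof (intro ballI impI)
    fix v assume v: "v \<in> carrier F" "\<Upsilon> (h + 1) v \<in> s ` K"
    then obtain M where M: "M \<in> K" "\<Upsilon> (h + 1) v = \<Upsilon> (h + 1) (u M)" unfolding s_def by blast
    have MI: "M \<in> carrier (I h)" using M(1) K by blast
    then have uF: "u M \<in> carrier F" and uM: "\<Upsilon> h (u M) = M" using u by blast+
    then have "\<psi> (u M) \<in> lcs G h" using rel M(1) by (simp add: relations_hold_def)
    then have \<psi>u: "\<psi> (u M) \<in> lcs G (h + 1)" using u[OF MI] uF uM by blast
    have "v \<otimes>\<^bsub>F\<^esub> inv\<^bsub>F\<^esub> (u M) \<in> lcs F (h + 1)"
      using Ups_eq_iff[OF _ v(1) uF, of "h + 1"] M(2) by simp
    then have "\<psi> (v \<otimes>\<^bsub>F\<^esub> inv\<^bsub>F\<^esub> (u M)) \<in> lcs G (h + 1)" using \<psi>.lcs_img_subset by blast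
    then have "\<psi> (v \<otimes>\<^bsub>F\<^esub> inv\<^bsub>F\<^esub> (u M)) \<otimes> \<psi> (u M) \<in> lcs G (h + 1)" using \<psi>u by (rule lcs_closed)
    then show "\<psi> v \<in> lcs G (h + 1)" using v(1) uF by (simp add: m_assoc)
  qed
  then show ?thesis using sec by blast
qed

text \<open>Lifting \<open>K\<close> along a section, the normal closure in the image of \<open>\<Upsilon>\<^sub>h\<^sub>+\<^sub>1\<close> maps onto the one in the
  image of \<open>\<Upsilon>\<^sub>h\<close>; hence an element over the latter is congruent to one of \<open>\<Upsilon>\<^sub>h\<^sub>+\<^sub>1(\<Gamma>\<^sub>hF)\<close>.\<close>

lemma central_representative:
  assumes h: "h \<ge> 1" and K: "K \<subseteq> carrier (I h)"
    and sec: "\<And>M. M \<in> carrier (I h) \<Longrightarrow> s M \<in> carrier (I (h + 1)) \<and> pUps q h (s M) = M"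
    and x: "x \<in> carrier F" "\<Upsilon> h x \<in> ncl h K"
  shows "\<exists>r\<in>lcs F h. proj (h + 1) (s ` K) r = proj (h + 1) (s ` K) x"
proof -
  let ?n = "h + 1" and ?V = "{u \<in> carrier F. \<Upsilon> (h + 1) u \<in> s ` K}"
  have S: "s ` K \<subseteq> carrier (I ?n)"
  proof (rule image_subsetI)
    fix M assume "M \<in> K"
    then have "M \<in> carrier (I h)" using K by blast
    then show "s M \<in> carrier (I ?n)" by (rule conjunct1[OF sec])
  qed
  have "s ` K = \<Upsilon> ?n ` ?V"
    by (rule image_preimage_eq[OF S[unfolded ImUps_simps], symmetric])
  then have "ncl ?n (s ` K) = ncl ?n (\<Upsilon> ?n ` ?V)" by (rule arg_cong)
  also have "\<dots> = \<Upsilon> ?n ` normal_closure F ?V" by (rule ncl_Ups) blast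
  finally have nclS: "ncl ?n (s ` K) = \<Upsilon> ?n ` normal_closure F ?V" .
  have V: "?V \<subseteq> carrier F" by blast
  have "\<Upsilon> h ` ?V = K"
  proof
    show "\<Upsilon> h ` ?V \<subseteq> K"
    proof (rule image_subsetI)
      fix u assume "u \<in> ?V"
      then obtain M where u: "u \<in> carrier F" "M \<in> K" "\<Upsilon> ?n u = s M" by blast
      then have "\<Upsilon> h u = M" using pUps_Ups[OF h u(1)] sec[of M] K by auto
      then show "\<Upsilon> h u \<in> K" using u(2) by simp
    qed
    show "K \<subseteq> \<Upsilon> h ` ?V"
    proof
      fix M assume M: "M \<in> K"
      then have "s M \<in> \<Upsilon> ?n ` carrier F" using S unfolding ImUps_simps by blast
      then obtain u where u: "u \<in> carrier F" "s M = \<Upsilon> ?n u" by blast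
      then have "\<Upsilon> h u = M" using pUps_Ups[OF h u(1)] sec[of M] K M by auto
      moreover have "u \<in> ?V" using u M by (metis (mono_tags, lifting) imageI mem_Collect_eq)
      ultimately show "M \<in> \<Upsilon> h ` ?V" by blast
    qed
  qed
  then have nclK: "ncl h K = \<Upsilon> h ` normal_closure F ?V" using ncl_Ups[OF V, of h] by (simp only:)
  then obtain n where n: "n \<in> normal_closure F ?V" "\<Upsilon> h x = \<Upsilon> h n" using x(2) by blast
  have nF: "n \<in> carrier F"
    using n(1) F.normal_closure_normal[OF V] by (auto dest: normal_imp_subgroup subgroup.subset)
  \<comment> \<open>Dividing by a word of the closure with the same image at level h leaves an
    element of Gamma_hF.\<close>
  define r where "r = x \<otimes>\<^bsub>F\<^esub> inv\<^bsub>F\<^esub> n"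
  have r: "r \<in> lcs F h" unfolding r_def using Ups_eq_iff[OF h x(1) nF] n(2) by simp
  have rF: "r \<in> carrier F" using r by (rule F.lcs_carrier)
  have "r \<otimes>\<^bsub>F\<^esub> inv\<^bsub>F\<^esub> x = x \<otimes>\<^bsub>F\<^esub> inv\<^bsub>F\<^esub> n \<otimes>\<^bsub>F\<^esub> inv\<^bsub>F\<^esub> x" by (simp add: r_def)
  also have "\<dots> \<in> normal_closure F ?V"
    using n(1) F.normal_closure_normal[OF V]
    by (intro F.normal_conj(1)[OF F.normal_closure_normal[OF V] x(1)])
      (auto intro: subgroup.m_inv_closed normal_imp_subgroup)
  finally have "\<Upsilon> ?n (r \<otimes>\<^bsub>F\<^esub> inv\<^bsub>F\<^esub> x) \<in> ncl ?n (s ` K)" unfolding nclS by blast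
  then show ?thesis using proj_eq_iff[OF S rF x(1)] r by blast
qed

text \<open>Beyond the choice of lifts, two points need proof: mu has a representative in the image
  of Gamma_hF, and the values on arcs satisfy the Wirtinger relations.\<close>

lemma step_exists:
  assumes h: "h \<ge> 1" and st: "stage h K \<phi>" and rel: "relations_hold h K"
  shows "\<exists>s B \<rho> K' \<phi>'. step h K \<phi> s B \<rho> K' \<phi>' \<and> relations_hold (h + 1) (s ` K)"
proof -
  let ?n = "h + 1"
  interpret U: group_hom F "I ?n" "\<Upsilon> ?n" by (rule Ups_group_hom)
  have K: "K \<subseteq> carrier (I h)" using st by (simp add: stage_def)
  obtain s where sec: "\<And>M. M \<in> carrier (I h) \<Longrightarrow> s M \<in> carrier (I ?n) \<and> pUps q h (s M) = M"
    and lift: "relations_hold ?n (s ` K)"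
    using section_exists[OF h] K rel by blast
  let ?S = "s ` K"
  have S: "?S \<subseteq> carrier (I ?n)"
  proof (rule image_subsetI)
    fix M assume "M \<in> K"
    then have "M \<in> carrier (I h)" using K by blast
    then show "s M \<in> carrier (I ?n)" by (rule conjunct1[OF sec])
  qed
  have "\<forall>a\<in>arcs q c. \<exists>v. v \<in> carrier F \<and> w a \<otimes> inv (\<psi> v) \<in> lcs G h"
    using meridians_generate[OF h] w_closed by blast
  then obtain v where v: "\<And>a. a \<in> arcs q c \<Longrightarrow> v a \<in> carrier F \<and> w a \<otimes> inv (\<psi> (v a)) \<in> lcs G h"
    by metis
  have v': "\<psi> (v a) \<otimes> inv (w a) \<in> lcs G h" if a: "a \<in> arcs q c" for a
    using lcs_closed(3)[of "w a \<otimes> inv (\<psi> (v a))" h] v[OF a] w_closed[OF a] by (simp add: inv_mult_group)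
  \<comment> \<open>Words in the meridians reach every arc modulo Gamma_h; the word used at a
    crossing depends only on its over-passing arc.\<close>
  define b where "b j k = v (over_arc q c j k)" for j k
  define B where "B j k = \<Upsilon> ?n (b j k)" for j k
  have b: "over_lift h b"
    unfolding over_lift_def b_def
  proof (clarify)
    fix j k assume jk: "(j, k) \<in> arcs q c"
    show "v (over_arc q c j k) \<in> carrier F \<and> \<psi> (v (over_arc q c j k)) \<otimes> inv (w (over_arc q c j k)) \<in> lcs G h"
      using v[OF over_arc_arcs[OF jk]] v'[OF over_arc_arcs[OF jk]] by blast
  qed
  have B_ok: "B j k \<in> carrier (I ?n) \<and> ncl h K #>\<^bsub>I h\<^esub> pUps q h (B j k) = \<phi> (w (over_arc q c j k))"
    if jk: "(j, k) \<in> arcs q c" for j k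
  proof -
    note bjk = over_liftD[OF b jk]
    have "\<phi> (\<psi> (b j k)) = \<phi> (w (over_arc q c j k))"
      using stage_eq_iff[OF h st rel] bjk w_closed[OF over_arc_arcs[OF jk]] by simp
    then show ?thesis
      using stage_\<psi>[OF st bjk(1)] pUps_Ups[OF h bjk(1)] bjk(1) by (simp add: B_def)
  qed
  have "\<exists>r\<in>lcs F h. proj ?n ?S r = proj ?n ?S (holonomy b j)"
    if j: "j \<in> {1..q}" for j
  proof (rule central_representative[OF h K sec holonomy_closed[OF b j]])
    \<comment> \<open>The holonomy word is trivial at level h, so
      \<open>central_representative\<close> finds its class in the image of Gamma_hF.\<close>
    have "\<psi> (holonomy b j) \<in> lcs G h" using holonomy_lcs[OF h b j] lcs_Suc_subset by blast
    then have "\<phi> (\<psi> (holonomy b j)) = \<one>\<^bsub>Q h K\<^esub>" using stage_kernel[OF h st rel] by (auto simp: kernel_def)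
    then have "proj h K (holonomy b j) = ncl h K"
      using stage_\<psi>[OF st holonomy_closed[OF b j]] by simp
    moreover have "\<Upsilon> h (holonomy b j) \<in> carrier (I h)" using holonomy_closed[OF b j] by (simp add: ImUps_simps)
    ultimately show "\<Upsilon> h (holonomy b j) \<in> ncl h K"
      using group.rcos_eq_normal_iff[OF ImUps_group ncl_normal[OF K]] by blast
  qed
  then obtain r where r: "\<And>j. j \<in> {1..q} \<Longrightarrow> r j \<in> lcs F h \<and>
      proj ?n ?S (r j) = proj ?n ?S (holonomy b j)"
    by metis
  define \<rho> where "\<rho> j = \<Upsilon> ?n (r j)" for j
  define K' where "K' = ?S \<union> \<rho> ` {1..q}"
  have rF: "r j \<in> carrier F" if "j \<in> {1..q}" for j using r[OF that] F.lcs_carrier by blast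
  have K'I: "K' \<subseteq> carrier (I ?n)" unfolding K'_def \<rho>_def ImUps_simps using S rF unfolding ImUps_simps by blast
  have SK': "?S \<subseteq> K'" by (simp add: K'_def)
  interpret p: group_hom F "Q ?n K'" "\<lambda>v. proj ?n K' v" using K'I by (rule proj_group_hom)
  have proj_mono: "proj ?n K' u = proj ?n K' u'"
    if "proj ?n ?S u = proj ?n ?S u'" "u \<in> carrier F" "u' \<in> carrier F" for u u'
    using that coset_proj_proj(1)[OF SK' K'I] by metis
  have one: "proj ?n K' u = \<one>\<^bsub>Q ?n K'\<^esub> \<longleftrightarrow> \<Upsilon> ?n u \<in> ncl ?n K'" if "u \<in> carrier F" for u
    using U.H.rcos_eq_normal_iff[OF ncl_normal[OF K'I]] that by simp
  define y where "y a = proj ?n K' (chain b (fst a) (snd a))" for a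
  have arc_closed: "chain b j k \<in> carrier F" if "(j, k) \<in> arcs q c" for j k
    using chain_closed[OF b, of j k] that by (simp add: arcs_iff)
  \<comment> \<open>Dividing by \<open>\<rho> j\<close> closes the chain of component j: its value
    at N + 1 becomes that of the first arc.\<close>
  have wrap: "y (next_arc q c j k) = proj ?n K' (chain b j (Suc k))" if jk: "(j, k) \<in> arcs q c" for j k
  proof (cases "k = n_arcs q c j")
    case True
    have j: "j \<in> {1..q}" using jk by (simp add: arcs_iff)
    have "\<rho> j \<in> ncl ?n K'" using U.H.normal_closure_incl[OF K'I] j by (auto simp: K'_def)
    then have "proj ?n K' (r j) = \<one>\<^bsub>Q ?n K'\<^esub>" using one[OF rF[OF j]] by (simp add: \<rho>_def)
    then have "proj ?n K' (holonomy b j) = \<one>\<^bsub>Q ?n K'\<^esub>"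
      using proj_mono[of "r j" "holonomy b j"] r[OF j] rF[OF j] holonomy_closed[OF b j] by simp
    moreover have C: "chain b j (Suc k) \<in> carrier F" "fgen j \<in> carrier F"
      using chain_closed[OF b j, of "Suc k"] True fgen_carrier[OF j] by auto
    have "chain b j (Suc k) = fgen j \<otimes>\<^bsub>F\<^esub> holonomy b j"
      using holonomy_eq[OF b j] True C by (simp add: F.cancel_left)
    ultimately have "proj ?n K' (chain b j (Suc k)) = proj ?n K' (fgen j)"
      using p.hom_mult[of "fgen j" "holonomy b j"] C holonomy_closed[OF b j] by (simp del: one_FactGroup)
    then show ?thesis using True by (simp add: y_def next_arc_def One_nat_def)
  next
    case False
    then show ?thesis by (simp add: y_def next_arc_def Suc_eq_plus1)
  qed
  have "\<exists>\<phi>'\<in>hom G (Q ?n K'). \<forall>a\<in>arcs q c. \<phi>' (w a) = y a"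
  proof (rule hom_extension[OF p.H.is_group])
    show "y ` arcs q c \<subseteq> carrier (Q ?n K')"
      using arc_closed p.hom_closed by (auto simp: y_def)
    fix j k assume jk: "(j, k) \<in> arcs q c"
    let ?e = "\<epsilon> j k" and ?y = "\<lambda>u. proj ?n K' u"
    obtain i l where o: "over_arc q c j k = (i, l)" by (cases "over_arc q c j k")
    have il: "(i, l) \<in> arcs q c" using over_arc_arcs[OF jk] o by simp
    have cl: "chain b j k \<in> carrier F" "chain b i l \<in> carrier F" "b j k \<in> carrier F"
      using arc_closed[OF jk] arc_closed[OF il] over_liftD(1)[OF b jk] by auto
    have i: "i \<in> {1..q}" "1 \<le> l" "l \<le> n_arcs q c i" using il by (simp_all add: arcs_iff)
    \<comment> \<open>The Wirtinger relation conjugates by the value of the over-passing arc, the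
      chain element at (i, l), whereas the chain conjugates by \<open>b j k\<close>. The two agree
      at level h, hence differ at level h + 1 by some z from Gamma_hF, which conjugation
      ignores.\<close>
    have "\<psi> (chain b i l) \<otimes> inv (w (i, l)) \<in> lcs G h"
      using chain_arc[OF h b i(1,2)] i(3) lcs_Suc_subset[of h] by auto
    then have "\<phi> (\<psi> (chain b i l)) = \<phi> (\<psi> (b j k))"
      using stage_eq_iff[OF h st rel, of "\<psi> (chain b i l)" "w (i, l)"]
        stage_eq_iff[OF h st rel, of "\<psi> (b j k)" "w (i, l)"] over_liftD(2)[OF b jk] cl w_closed[OF il] o by simp
    then have "\<Upsilon> h (chain b i l \<otimes>\<^bsub>F\<^esub> inv\<^bsub>F\<^esub> b j k) \<in> ncl h K"
      using stage_\<psi>[OF st cl(2)] stage_\<psi>[OF st cl(3)] proj_eq_iff[OF K cl(2,3)] by simp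
    then obtain z where z: "z \<in> lcs F h"
      "proj ?n ?S z = proj ?n ?S (chain b i l \<otimes>\<^bsub>F\<^esub> inv\<^bsub>F\<^esub> b j k)"
      using central_representative[OF h K sec _ ] cl by blast
    have zF: "z \<in> carrier F" using z(1) by (rule F.lcs_carrier)
    have "?y z = ?y (chain b i l \<otimes>\<^bsub>F\<^esub> inv\<^bsub>F\<^esub> b j k)" using z(2) zF cl by (intro proj_mono) auto
    then have "?y (z \<otimes>\<^bsub>F\<^esub> b j k) = ?y (chain b i l \<otimes>\<^bsub>F\<^esub> inv\<^bsub>F\<^esub> b j k) \<otimes>\<^bsub>Q ?n K'\<^esub> ?y (b j k)"
      using p.hom_mult[of z "b j k"] zF cl by simp
    also have "\<dots> = ?y (chain b i l)"
      using p.hom_mult[of "chain b i l \<otimes>\<^bsub>F\<^esub> inv\<^bsub>F\<^esub> b j k" "b j k"] cl by (simp add: F.m_assoc)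
    finally have yz: "?y (z \<otimes>\<^bsub>F\<^esub> b j k) = ?y (chain b i l)" .
    have "?y (chain b j (Suc k)) = conj_pow (Q ?n K') (?y (b j k)) ?e (?y (chain b j k))"
    proof -
      have k: "k \<ge> 1" using jk by (simp add: arcs_iff)
      have pow: "b j k [^]\<^bsub>F\<^esub> x \<in> carrier F" "?y (b j k [^]\<^bsub>F\<^esub> x) = ?y (b j k) [^]\<^bsub>Q ?n K'\<^esub> x" for x :: int
        using cl(3) p.hom_int_pow[of "b j k" x] by simp_all
      show ?thesis
        unfolding arc_chain_Suc[OF k] pow(2)[symmetric]
        using pow(1) cl(1) by (simp only: p.hom_mult F.m_closed)
    qed
    also have "\<dots> = conj_pow (Q ?n K') (?y (z \<otimes>\<^bsub>F\<^esub> b j k)) ?e (?y (chain b j k))"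
    proof (rule p.conj_mod_lcs[OF h, symmetric])
      show "?y x = \<one>\<^bsub>Q ?n K'\<^esub>" if x: "x \<in> lcs F (Suc h)" for x
        using one[of x] F.lcs_carrier[OF x] Ups_lcs[of ?n x] x[unfolded Suc_eq_plus1]
          subgroup.one_closed[OF normal_imp_subgroup[OF ncl_normal[OF K'I]]] by (simp del: one_FactGroup)
      show "?y ` carrier F = carrier (Q ?n K')" by (rule proj_surj)
      show "z \<otimes>\<^bsub>F\<^esub> b j k \<otimes>\<^bsub>F\<^esub> inv\<^bsub>F\<^esub> b j k \<in> lcs F h" using z(1) zF cl by (simp add: F.m_assoc)
      show "?e = 1 \<or> ?e = - 1" by (rule crossing_sign_cases)
    qed (use zF cl p.hom_closed in auto)
    finally show "y (next_arc q c j k) = conj_pow (Q ?n K') (y (over_arc q c j k)) ?e (y (j, k))"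
      unfolding wrap[OF jk] yz by (simp add: y_def o)
  qed
  then obtain \<phi>' where \<phi>': "\<phi>' \<in> hom G (Q ?n K')" "\<And>a. a \<in> arcs q c \<Longrightarrow> \<phi>' (w a) = y a" by blast
  have "step h K \<phi> s B \<rho> K' \<phi>'"
    unfolding step_def
  proof (intro conjI)
    show "\<forall>M\<in>carrier (I h). s M \<in> carrier (I ?n) \<and> pUps q h (s M) = M" using sec by blast
    show "\<forall>(j, k)\<in>arcs q c. B j k \<in> carrier (I ?n) \<and> ncl h K #>\<^bsub>I h\<^esub> pUps q h (B j k) = \<phi> (w (over_arc q c j k))"
      using B_ok by blast
    show "\<forall>j\<in>{1..q}. \<rho> j \<in> \<Upsilon> ?n ` lcs F h \<and> ncl ?n ?S #>\<^bsub>I ?n\<^esub> \<rho> j =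
        quot_holonomy ?n ?S B j"
    proof
      fix j assume j: "j \<in> {1..q}"
      show "\<rho> j \<in> \<Upsilon> ?n ` lcs F h \<and> ncl ?n ?S #>\<^bsub>I ?n\<^esub> \<rho> j =
          quot_holonomy ?n ?S B j"
        using r[OF j] proj_holonomy[where b = b and B = B, OF S b j B_def] by (simp add: \<rho>_def)
    qed
    show "\<forall>(j, k)\<in>arcs q c. \<phi>' (w (j, k)) = coset_proj (I ?n) (ncl ?n K')
        (quot_chain ?n ?S B j k)"
    proof (clarify)
      fix j k assume jk: "(j, k) \<in> arcs q c"
      then have "j \<in> {1..q}" "k \<le> Suc (n_arcs q c j)" by (simp_all add: arcs_iff)
      then show "\<phi>' (w (j, k)) = coset_proj (I ?n) (ncl ?n K')
        (quot_chain ?n ?S B j k)"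
        using \<phi>'(2)[OF jk] proj_chain[where b = b and B = B, OF S b _ B_def]
          coset_proj_proj(1)[OF SK' K'I arc_closed[OF jk]] by (simp add: y_def)
    qed
  qed (use \<phi>'(1) in \<open>simp_all add: K'_def\<close>)
  then show ?thesis using lift by blast
qed

text \<open>With no relations imposed, \<open>\<phi>\<close> is f_m followed by the identification
  of F/Gamma_mF with the image of Upsilon_m.\<close>

lemma initial_stage:
  assumes m: "m \<ge> 1" and f: "f \<in> hom G (F Mod lcs F m)"
    and fm: "\<And>j. j \<in> {1..q} \<Longrightarrow> f (meridian w j) = lcs F m #>\<^bsub>F\<^esub> fgen j"
    and \<phi>: "\<And>g. g \<in> carrier G \<Longrightarrow> \<phi> g = ncl m {} #>\<^bsub>I m\<^esub> Ups_bar q m (f g)"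
  shows "stage m {} \<phi>"
  unfolding stage_def
proof (intro conjI ballI)
  interpret p: group_hom F "Q m {}" "\<lambda>v. proj m {} v" by (rule proj_group_hom) simp
  interpret \<pi>: group_hom F "F Mod lcs F m" "\<lambda>x. lcs F m #>\<^bsub>F\<^esub> x" by (rule F.rcos_group_hom[OF F.lcs_normal])
  have rep: "\<exists>v\<in>carrier F. f g = lcs F m #>\<^bsub>F\<^esub> v" if "g \<in> carrier G" for g
    using hom_in_carrier[OF f that] unfolding carrier_FactGroup by blast
  have \<phi>_rep: "\<phi> g = proj m {} v"
    if "g \<in> carrier G" "v \<in> carrier F" "f g = lcs F m #>\<^bsub>F\<^esub> v" for g v
    using \<phi>[OF that(1)] that(3) Ups_bar_rcos[OF m that(2)] by simp
  show "\<phi> \<in> hom G (Q m {})"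
  proof (rule homI)
    fix g assume g: "g \<in> carrier G"
    obtain u where u: "u \<in> carrier F" "f g = lcs F m #>\<^bsub>F\<^esub> u" using rep[OF g] by blast
    show "\<phi> g \<in> carrier (Q m {})" using \<phi>_rep[OF g u] p.hom_closed[OF u(1)] by simp
    fix g' assume g': "g' \<in> carrier G"
    obtain v where v: "v \<in> carrier F" "f g' = lcs F m #>\<^bsub>F\<^esub> v" using rep[OF g'] by blast
    have "f (g \<otimes> g') = lcs F m #>\<^bsub>F\<^esub> (u \<otimes>\<^bsub>F\<^esub> v)"
      using hom_mult[OF f g g'] \<pi>.hom_mult[OF u(1) v(1)] u(2) v(2) by simp
    then have "\<phi> (g \<otimes> g') = proj m {} (u \<otimes>\<^bsub>F\<^esub> v)" using g g' u v by (intro \<phi>_rep) auto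
    then show "\<phi> (g \<otimes> g') = \<phi> g \<otimes>\<^bsub>Q m {}\<^esub> \<phi> g'"
      using \<phi>_rep[OF g u] \<phi>_rep[OF g' v] p.hom_mult[OF u(1) v(1)] by simp
  qed
  show "\<phi> (meridian w j) = proj m {} (fgen j)" if "j \<in> {1..q}" for j
    using \<phi>_rep[OF w_closed[OF meridian_arc[OF that]] fgen_carrier[OF that] fm[OF that]] .
qed simp

lemma construction_stage:
  assumes m: "m \<ge> 1" and init: "stage m {} (\<phi> m)" and "is_construction q m c G w f s B \<rho> K \<phi>"
    and lifts: "\<And>i. i \<in> {m..<h} \<Longrightarrow> lifts_relations q G w s K i" and "h \<ge> m"
  shows "stage h (K h) (\<phi> h) \<and> relations_hold h (K h)"
  using assms(5) lifts
proof (induction h rule: dec_induct)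
  case base
  then show ?case using init assms(3) by (simp add: is_construction_iff relations_hold_def)
next
  case (step i)
  then have IH: "stage i (K i) (\<phi> i)" "relations_hold i (K i)" by auto
  have "step i (K i) (\<phi> i) (s i) (B i) (\<rho> i) (K (i + 1)) (\<phi> (i + 1))"
    using assms(3) step(1) by (simp add: is_construction_iff)
  moreover have "relations_hold (i + 1) (s i ` K i)"
    using step.prems[of i] step(1,2) by (simp add: lifts_relations_iff)
  ultimately show ?case using step_stage[OF _ IH] m step(1) by (simp add: Suc_eq_plus1)
qed

lemma construction_exists:
  assumes m: "m \<ge> 1"
    and init: "\<And>\<phi>. (\<And>g. g \<in> carrier G \<Longrightarrow> \<phi> g = ncl m {} #>\<^bsub>I m\<^esub> Ups_bar q m (f m g)) \<Longrightarrow> stage m {} \<phi>"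
  shows "\<exists>s B \<rho> K \<phi>. is_construction q m c G w f s B \<rho> K \<phi> \<and> (\<forall>i\<ge>m. lifts_relations q G w s K i)"
proof -
  define \<phi>0 where "\<phi>0 g = ncl m {} #>\<^bsub>I m\<^esub> Ups_bar q m (f m g)" for g
  \<comment> \<open>The clause at n = 0 pins the start of the sequence to f_m; dependent choice by
    itself only gives some start satisfying the predicate.\<close>
  define P where "P n x \<longleftrightarrow> stage (m + n) (fst x) (snd x) \<and> relations_hold (m + n) (fst x) \<and> (n = 0 \<longrightarrow> x = ({}, \<phi>0))" for n x
  define R where "R n x y \<longleftrightarrow> (\<exists>s B \<rho>. step (m + n) (fst x) (snd x) s B \<rho> (fst y) (snd y) \<and> relations_hold (m + n + 1) (s ` fst x))" for n x y
  have "\<exists>t. \<forall>n. P n (t n) \<and> R n (t n) (t (Suc n))"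
  proof (rule dependent_nat_choice)
    show "\<exists>x. P 0 x"
      using init[of \<phi>0] by (intro exI[of _ "({}, \<phi>0)"]) (simp add: P_def \<phi>0_def relations_hold_def)
    fix x n assume x: "P n x"
    then have st: "stage (m + n) (fst x) (snd x)" "relations_hold (m + n) (fst x)" by (simp_all add: P_def)
    have mn: "m + n \<ge> 1" using m by simp
    obtain s B \<rho> K' \<phi>' where step: "step (m + n) (fst x) (snd x) s B \<rho> K' \<phi>'" "relations_hold (m + n + 1) (s ` fst x)"
      using step_exists[OF mn st] by blast
    have "stage (m + n + 1) K' \<phi>' \<and> relations_hold (m + n + 1) K'" using step_stage[OF mn st step] .
    then have "P (Suc n) (K', \<phi>')" by (simp add: P_def One_nat_def)
    moreover have "R n x (K', \<phi>')" unfolding R_def using step by auto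
    ultimately show "\<exists>y. P (Suc n) y \<and> R n x y" by blast
  qed
  then obtain t where t: "\<And>n. P n (t n)" "\<And>n. R n (t n) (t (Suc n))" by blast
  have "\<forall>n. \<exists>s B \<rho>. step (m + n) (fst (t n)) (snd (t n)) s B \<rho> (fst (t (Suc n))) (snd (t (Suc n))) \<and>
      relations_hold (m + n + 1) (s ` fst (t n))"
    using t(2) unfolding R_def by blast
  then obtain s B \<rho> where sB: "\<And>n. step (m + n) (fst (t n)) (snd (t n)) (s n) (B n) (\<rho> n) (fst (t (Suc n))) (snd (t (Suc n)))"
    "\<And>n. relations_hold (m + n + 1) (s n ` fst (t n))"
    by metis
  \<comment> \<open>Position n of the sequence is level m + n; by truncated subtraction, indices
    below m get the value at m as a default.\<close>
  define K \<phi> where "K i = fst (t (i - m))" and "\<phi> i = snd (t (i - m))" for i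
  have t0: "t 0 = ({}, \<phi>0)" using t(1)[of 0] by (simp add: P_def)
  have "is_construction q m c G w f (\<lambda>i. s (i - m)) (\<lambda>i. B (i - m)) (\<lambda>i. \<rho> (i - m)) K \<phi>"
    unfolding is_construction_iff
  proof (intro conjI ballI allI impI)
    show "K m = {}" "\<phi> m g = ncl m {} #>\<^bsub>I m\<^esub> Ups_bar q m (f m g)" for g
      using t0 by (simp_all add: K_def \<phi>_def \<phi>0_def)
    show "step h (K h) (\<phi> h) (s (h - m)) (B (h - m)) (\<rho> (h - m)) (K (h + 1)) (\<phi> (h + 1))" if h: "h \<ge> m" for h
    proof -
      have "h + 1 - m = Suc (h - m)" "m + (h - m) = h" using h by auto
      then show ?thesis using sB(1)[of "h - m"] by (simp add: K_def \<phi>_def)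
    qed
  qed
  moreover have "lifts_relations q G w (\<lambda>i. s (i - m)) K i" if "i \<ge> m" for i
    using sB(2)[of "i - m"] that by (simp add: lifts_relations_iff K_def)
  ultimately show ?thesis by blast
qed

end

section \<open>The fundamental group\<close>

lemma loop_class_eq_iff:
  assumes "path p" "path_image p \<subseteq> X"
  shows "loop_class X p = loop_class X r \<longleftrightarrow> homotopic_paths X p r"
proof
  assume eq: "loop_class X p = loop_class X r"
  have "p \<in> loop_class X p" using assms by (simp add: loop_class_def)
  then show "homotopic_paths X p r" unfolding eq by (simp add: loop_class_def homotopic_paths_sym)
next
  assume "homotopic_paths X p r"
  then show "loop_class X p = loop_class X r"
    unfolding loop_class_def by (blast intro: homotopic_paths_sym homotopic_paths_trans)
qed

lemma pi1_mult:
  assumes "path p" "path_image p \<subseteq> X" "path r" "path_image r \<subseteq> X" "pathfinish p = pathstart r"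
  shows "loop_class X p \<otimes>\<^bsub>pi1 X b\<^esub> loop_class X r = loop_class X (p +++ r)"
proof -
  have pr: "path (p +++ r)" "path_image (p +++ r) \<subseteq> X"
    using assms by (auto simp: path_image_join)
  have "loop_class X (p' +++ r') = loop_class X (p +++ r)"
    if "p' \<in> loop_class X p" "r' \<in> loop_class X r" for p' r'
  proof -
    have "homotopic_paths X (p +++ r) (p' +++ r')"
      using that assms(5) by (intro homotopic_paths_join) (simp_all add: loop_class_def)
    then show ?thesis using loop_class_eq_iff[OF pr] by blast
  qed
  then have "(\<Union>p'\<in>loop_class X p. \<Union>r'\<in>loop_class X r. loop_class X (p' +++ r')) =
      (\<Union>p'\<in>loop_class X p. \<Union>r'\<in>loop_class X r. loop_class X (p +++ r))" by (intro SUP_cong) auto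
  \<comment> \<open>The union over representatives has a constant value, but equals it only because
    both classes are nonempty.\<close>
  moreover have "p \<in> loop_class X p" "r \<in> loop_class X r" using assms by (simp_all add: loop_class_def)
  then have "loop_class X p \<noteq> {}" "loop_class X r \<noteq> {}" by blast+
  ultimately show ?thesis by (simp add: pi1_def)
qed

lemma pi1_group:
  assumes "b \<in> X"
  shows "group (pi1 X b)"
proof -
  let ?loop = "\<lambda>p. path p \<and> path_image p \<subseteq> X \<and> pathstart p = b \<and> pathfinish p = b"
  let ?e = "linepath b b"
  have carrier: "x \<in> carrier (pi1 X b) \<longleftrightarrow> (\<exists>p. x = loop_class X p \<and> ?loop p)" for x
    by (simp add: pi1_def)
  have one: "\<one>\<^bsub>pi1 X b\<^esub> = loop_class X ?e" by (simp add: pi1_def)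
  have e: "?loop ?e" using assms by simp
  have join: "?loop (p +++ r)" if "?loop p" "?loop r" for p r
    using that by (auto simp: path_image_join)
  have mult: "loop_class X p \<otimes>\<^bsub>pi1 X b\<^esub> loop_class X r = loop_class X (p +++ r)" if "?loop p" "?loop r" for p r
    using that by (intro pi1_mult) auto
  show ?thesis
  proof (rule groupI)
    show "\<one>\<^bsub>pi1 X b\<^esub> \<in> carrier (pi1 X b)" unfolding carrier one using e by blast
    fix x assume "x \<in> carrier (pi1 X b)"
    then obtain p where p: "x = loop_class X p" "?loop p" unfolding carrier by blast
    have "homotopic_paths X (?e +++ p) p" using p(2) homotopic_paths_lid[of p X] by simp
    then show "\<one>\<^bsub>pi1 X b\<^esub> \<otimes>\<^bsub>pi1 X b\<^esub> x = x"
      unfolding one p(1) mult[OF e p(2)] using join[OF e p(2)] by (simp add: loop_class_eq_iff)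
    have rp: "?loop (reversepath p)" using p(2) by simp
    have "homotopic_paths X (reversepath p +++ p) ?e" using p(2) homotopic_paths_linv[of p X] by simp
    then have "loop_class X (reversepath p) \<otimes>\<^bsub>pi1 X b\<^esub> x = \<one>\<^bsub>pi1 X b\<^esub>"
      unfolding one p(1) mult[OF rp p(2)] using join[OF rp p(2)] by (simp add: loop_class_eq_iff)
    then show "\<exists>y\<in>carrier (pi1 X b). y \<otimes>\<^bsub>pi1 X b\<^esub> x = \<one>\<^bsub>pi1 X b\<^esub>" using rp carrier by blast
    fix y assume "y \<in> carrier (pi1 X b)"
    then obtain r where r: "y = loop_class X r" "?loop r" unfolding carrier by blast
    show "x \<otimes>\<^bsub>pi1 X b\<^esub> y \<in> carrier (pi1 X b)"
      unfolding p(1) r(1) mult[OF p(2) r(2)] carrier using join[OF p(2) r(2)] by blast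
    fix z assume "z \<in> carrier (pi1 X b)"
    then obtain s where s: "z = loop_class X s" "?loop s" unfolding carrier by blast
    have "homotopic_paths X (p +++ (r +++ s)) ((p +++ r) +++ s)"
      using p(2) r(2) s(2) by (intro homotopic_paths_assoc) auto
    then show "x \<otimes>\<^bsub>pi1 X b\<^esub> y \<otimes>\<^bsub>pi1 X b\<^esub> z = x \<otimes>\<^bsub>pi1 X b\<^esub> (y \<otimes>\<^bsub>pi1 X b\<^esub> z)"
      unfolding p(1) r(1) s(1) mult[OF p(2) r(2)] mult[OF r(2) s(2)]
        mult[OF join[OF p(2) r(2)] s(2)] mult[OF p(2) join[OF r(2) s(2)]]
      using join[OF p(2) join[OF r(2) s(2)]] loop_class_eq_iff by metis
  qed
qed

section \<open>Crossings of a diagram\<close>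

lemma finite_under_params:
  assumes "link_diagram q c"
  shows "finite (under_params q c j)"
proof -
  let ?D = "{(a, b). a \<in> params q \<and> b \<in> params q \<and> a \<noteq> b \<and> fst (pt c a) = fst (pt c b)}"
  have "under_params q c j \<subseteq> (\<lambda>(a, b). snd b) ` ?D"
    unfolding under_params_def passes_over_def by (force simp: image_iff)
  moreover have "finite ?D" using assms unfolding link_diagram_def by blast
  ultimately show ?thesis by (meson finite_imageI finite_subset)
qed

text \<open>Existence comes from \<open>under_params\<close>, uniqueness from the absence of triple
  points; together they give the definite description a meaning.\<close>

lemma over_strand_passes_over:
  assumes D: "link_diagram q c" and jk: "(j, k) \<in> arcs q c"
  shows "passes_over q c (over_strand q c j k) (under_strand q c j k)"
proof -
  let ?u = "under_strand q c j k" and ?U = "under_params q c j"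
  have k: "1 \<le> k" "k \<le> card ?U" using jk by (simp_all add: arcs_iff n_arcs_def)
  have "sorted_list_of_set ?U ! (k - 1) \<in> ?U"
    using k nth_mem[of "k - 1" "sorted_list_of_set ?U"] finite_under_params[OF D] by (simp add: One_nat_def)
  then obtain a where a: "passes_over q c a ?u" unfolding under_strand_def under_params_def by blast
  have "a' = a" if a': "passes_over q c a' ?u" for a'
  proof -
    have "a \<in> params q" "?u \<in> params q" "a \<noteq> ?u" "fst (pt c a) = fst (pt c ?u)"
      "a' \<in> params q" "fst (pt c a') = fst (pt c a)" "a' \<noteq> ?u"
      using a a' unfolding passes_over_def by auto
    then show ?thesis using D unfolding link_diagram_def by blast
  qed
  then show ?thesis unfolding over_strand_def using a by (metis theI)
qed

text \<open>\<open>arc_at\<close> reduces modulo the number of arcs of the over-passing component,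
  so that component must itself pass under a crossing.\<close>

lemma over_arc_in_arcs:
  assumes D: "link_diagram q c" and jk: "(j, k) \<in> arcs q c"
    and pos: "\<And>j. j \<in> {1..q} \<Longrightarrow> n_arcs q c j \<ge> 1"
  shows "over_arc q c j k \<in> arcs q c"
proof -
  obtain i t where a: "over_strand q c j k = (i, t)" by (cases "over_strand q c j k")
  have i: "i \<in> {1..q}"
    using over_strand_passes_over[OF D jk] unfolding a passes_over_def params_def by simp
  have "x mod n_arcs q c i < n_arcs q c i" for x using pos[OF i] by simp
  then show ?thesis using i by (simp add: over_arc_def arc_at_def a arcs_iff Suc_le_eq[symmetric] Suc_eq_plus1)
qed

text \<open>An unfortunate section can destroy injectivity, so the isomorphism is claimed for
  sections lifting relations at the levels below h. The second conjunct ensures that such sections,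
  and with them the whole construction, exist.\<close>

theorem theorem5p3:
  fixes q m h :: nat and \<gamma> :: "nat \<Rightarrow> real \<Rightarrow> R4" and c :: "nat \<Rightarrow> real \<Rightarrow> R3" and b :: R4
    and G :: "(real \<Rightarrow> R4) set monoid"
    and w :: "nat \<times> nat \<Rightarrow> (real \<Rightarrow> R4) set"
    and f :: "nat \<Rightarrow> (real \<Rightarrow> R4) set \<Rightarrow> (nat \<times> bool) list set"
  assumes "m \<ge> 2" and "h \<ge> m"
    and "oriented_link q \<gamma>"
    and "b \<in> S3 - link_set q \<gamma>"
    and "G = pi1 (S3 - link_set q \<gamma>) b"
    and "diagram_of_link q c \<gamma>"
    and "\<And>j. j \<in> {1..q} \<Longrightarrow> under_params q c j \<noteq> {}"
    and "wirtinger_generators q c G w"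
    and "assumption_A q m G w f"
  shows "(\<forall>s B \<rho> K \<phi>.
            is_construction q m c G w f s B \<rho> K \<phi> \<longrightarrow>
            (\<forall>i\<in>{m..<h}. lifts_relations q G w s K i) \<longrightarrow>
            induces_iso G (lcs G h) (ImUps q h Mod Nsub q K h) (\<phi> h)) \<and>
         (\<exists>s B \<rho> K \<phi>.
            is_construction q m c G w f s B \<rho> K \<phi> \<and>
            (\<forall>i\<ge>m. lifts_relations q G w s K i))"
proof -
  have D: "link_diagram q c" using assms(6) by (simp add: diagram_of_link_def)
  have pos: "n_arcs q c j \<ge> 1" if "j \<in> {1..q}" for j
    using assms(7)[OF that] finite_under_params[OF D, of j]
    by (simp add: n_arcs_def card_gt_0_iff Suc_le_eq One_nat_def)
  interpret group G unfolding assms(5) using assms(4) by (rule pi1_group)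
  interpret wirtinger_group G q c w
  proof
    show "n_arcs q c j \<ge> 1" if "j \<in> {1..q}" for j using pos[OF that] .
    show "over_arc q c j k \<in> arcs q c" if "(j, k) \<in> arcs q c" for j k
      using D that pos by (rule over_arc_in_arcs)
  qed (rule assms(8))
  have m: "m \<ge> 1" using assms(1) by simp
  have f: "f m \<in> hom G (FG q Mod lcs (FG q) m)"
    "\<And>j. j \<in> {1..q} \<Longrightarrow> f m (meridian w j) = lcs (FG q) m #>\<^bsub>FG q\<^esub> fgen j"
    using assms(1,9) unfolding assumption_A_def by auto
  note init = initial_stage[OF m f]
  have "induces_iso G (lcs G h) (ImUps q h Mod Nsub q K h) (\<phi> h)"
    if "is_construction q m c G w f s B \<rho> K \<phi>" "\<forall>i\<in>{m..<h}. lifts_relations q G w s K i" for s B \<rho> K \<phi>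
  proof -
    have "stage m {} (\<phi> m)" using that(1) by (intro init) (simp_all add: is_construction_iff)
    then have "stage h (K h) (\<phi> h) \<and> relations_hold h (K h)"
      using that assms(2) by (intro construction_stage[OF m]) auto
    then show ?thesis unfolding Nsub_def using m assms(2) by (intro stage_induces_iso) auto
  qed
  moreover have "\<exists>s B \<rho> K \<phi>. is_construction q m c G w f s B \<rho> K \<phi> \<and> (\<forall>i\<ge>m. lifts_relations q G w s K i)"
    using m init by (rule construction_exists)
  ultimately show ?thesis by blast
qed

end
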